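(* Let $(\mathbf X,Y)$ be a random pair with $\mathbf X\in\mathbb R^\nu$ and $Y\in\mathbb R$, let $(\mathbf X_1,Y_1),\dots,(\mathbf X_n,Y_n)$ be i.i.d. copies of $(\mathbf X,Y)$ (the offline sample), with $(\mathbf X,Y)$ independent of the offline sample and of the randomness used to build the forest. Let $\alpha\in(0,1)$, let $F(y\mid \mathbf x)=\mathbb P(Y\le y\mid \mathbf X=\mathbf x)$, and split $\{1,\dots,n\}$ into disjoint sets $\mathcal I_1$ (training) and $\mathcal I_2$ (calibration). Let $\hat v_\alpha$ be the quantile regression forest (QRF) estimator trained on the data indexed by $\mathcal I_1$, let $E_i=Y_i-\hat v_\alpha(\mathbf X_i)$, $i\in\mathcal I_2$, be the conformity scores, and let $\hat v^{\mathrm c}_{\alpha,n}(\mathbf x)=\hat v_\alpha(\mathbf x)+q_\alpha(E,\mathcal I_2)$ be the conformal QRF estimator, all as defined in the context. Assume: 1. The support $\mathcal X\subset\mathbb R^\nu$ of $\mathbf X$ is bounded, and the density of $\mathbf X$ is positive and bounded from above and below by positive constants. 2. Writing $k_\theta(l)$ for the number of training indices $i\in\mathcal I_1$ such that $\mathbf X_i$ lies in the region of the leaf $l$ of the tree with parameter $\theta$, one has, as $n\to\infty$, $\max_{l,\theta}k_\theta(l)=o(|\mathcal I_1|)$ and $1/\min_{l,\theta}k_\theta(l)=o(1)$. 3. There is a constant $C_0>0$ such that, whenever a node is split, for every coordinate $m\in\{1,\dots,\nu\}$ the probability that coordinate $m$ is selected as the split variable is at least $C_0$. Moreover there is a constant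 $\gamma\in(0,1/2]$ such that, whenever a node $r$ containing $n_r$ observations is split, each resulting child node $r_c$, containing $n_{r_c}$ observations, satisfies $n_{r_c}/n_r\ge\gamma$. 4. There is a constant $C>0$ such that for all $\mathbf x,\mathbf x'\in\mathcal X$, $\sup_{y\in\mathbb R}|F(y\mid\mathbf x)-F(y\mid\mathbf x')|\le C\|\mathbf x-\mathbf x'\|_1$, where $\|\cdot\|_1$ is the $\ell_1$ norm. 5. For every $\mathbf x\in\mathcal X$, $F(y\mid\mathbf x)$ is strictly monotonically increasing in $y$. 6. There exist constants $\delta>0$ and $M<\infty$ such that $\mathbb E[|Y|^{2+\delta}\mid\mathbf X=\mathbf x]\le M$ for all $\mathbf x$. 7. (Honesty) The randomization used to determine the tree structure, i.e., the sequence of splits, is independent of the response samples $\{Y_i\}$, so that the responses are used only to estimate quantities within the leaves of a fixed, data-independent partition. 8. The density of the conformity scores $E$ is bounded away from zero in an open neighborhood of zero. 9. The conditional distribution of $Y$ given $\mathbf X=\mathbf x$ admits a continuous density with respect to the Lebesgue measure. Then there exists a sequence of random sets $\Lambda_n\subseteq\mathbb R^\nu$ such that $\mathbb P(\mathbf X\in\Lambda_n)=1-o(1)$ and $$\sup_{\mathbf x\in\Lambda_n}\Big|\mathbb P\big(Y\le \hat v^{\mathrm c}_{\alpha,n}(\mathbf x)\mid\mathbf X=\mathbf x\big)-\alpha\Big|=o_p(1),\qquad n\to\infty.$$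
   Context: Quantile regression forest (QRF) estimator. From the training data $\{(\mathbf X_i,Y_i)\}_{i\in\mathcal I_1}$ one constructs an ensemble of $B$ regression trees $T(\theta_1),\dots,T(\theta_B)$, using bootstrap resampling and randomized splitting rules; $\theta_b$ collects all randomness in the construction of tree $b$. Each tree is obtained by recursively splitting nodes, each split being made along one coordinate (the split variable) of $\mathbb R^\nu$, and its leaves correspond to regions partitioning the covariate space. For a point $\mathbf x$, let $l(\mathbf x,\theta_b)$ be the leaf of $T(\theta_b)$ into which $\mathbf x$ falls and $R_{l(\mathbf x,\theta_b)}$ its associated region. Define, for $i\in\mathcal I_1$, $$w_i(\mathbf x,\theta_b)=\frac{\mathbf 1\{\mathbf X_i\in R_{l(\mathbf x,\theta_b)}\}}{\#\{j\in\mathcal I_1:\mathbf X_j\in R_{l(\mathbf x,\theta_b)}\}},\qquad w_i(\mathbf x)=\frac1B\sum_{b=1}^B w_i(\mathbf x,\theta_b),$$ and $$\hat v_\alpha(\mathbf x)=\inf\Big\{y\in\mathbb R:\ \sum_{i\in\mathcal I_1} w_i(\mathbf x)\,\mathbf 1\{Y_i\le y\}\ge\alpha\Big\}.$$ Conformal QRF estimator. The conformity scores are computed on the calibration set: $E_i=Y_i-\hat v_\alpha(\mathbf X_i)$, $i\in\mathcal I_2$. Let $q_\alpha(E,\mathcal I_2)$ be the empirical $\alpha$-quantile of $\{E_i\}_{i\in\mathcal I_2}$. The conformal estimator is $\hat v^{\mathrm c}_{\alpha,n}(\mathbf x)=\hat v_\alpha(\mathbf x)+q_\alpha(E,\mathcal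 I_2)$ (the subscript $n$ records the offline sample size). Notation: $U_n=o_p(1)$ means $U_n\to0$ in probability as $n\to\infty$. The probability inside the supremum is over $Y$ given $\mathbf X=\mathbf x$ with the offline sample and forest held fixed, i.e. it equals $F(\hat v^{\mathrm c}_{\alpha,n}(\mathbf x)\mid\mathbf x)$. Interpretation: $\mathbf X$ is the vector of risk factors at the monitoring time, $Y$ is the portfolio loss at the risk horizon, and $\hat v^{\mathrm c}_{\alpha,n}(\mathbf x)$ is an estimate of the conditional Value at Risk (conditional $\alpha$-quantile of $Y$ given $\mathbf X=\mathbf x$).
   Formalization: The formal theorem additionally assumes that the size of the calibration set I_2 tends to infinity; without this the claim fails (e.g. with a single calibration point the conformal correction stays a non-degenerate random variable). *)

theory Defs
  imports "HOL-Probability.Probability" "HOL-Library.Landau_Symbols"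
begin

text \<open>Only the split structure is recorded. A node is addressed by the list of turns leading to it
  from the root, \<^term>\<open>True\<close> meaning the child on which the split coordinate is at most the threshold.\<close>

datatype 'n rtree = Leaf | Split 'n real "'n rtree" "'n rtree"

fun split_at :: "'n rtree \<Rightarrow> bool list \<Rightarrow> ('n \<times> real) option" where
  "split_at Leaf p = None"
| "split_at (Split m s l r) [] = Some (m, s)"
| "split_at (Split m s l r) (True # p) = split_at l p"
| "split_at (Split m s l r) (False # p) = split_at r p"

fun nodes :: "'n rtree \<Rightarrow> bool list set" where
  "nodes Leaf = {[]}"
| "nodes (Split m s l r) = {[]} \<union> (#) True ` nodes l \<union> (#) False ` nodes r"

definition leaves :: "'n rtree \<Rightarrow> bool list set" where
  "leaves t = {p \<in> nodes t. split_at t p = None}"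

fun region :: "'n::finite rtree \<Rightarrow> bool list \<Rightarrow> (real ^ 'n) set" where
  "region t [] = UNIV"
| "region Leaf (c # p) = {}"
| "region (Split m s l r) (True # p) = {x. x $ m \<le> s} \<inter> region l p"
| "region (Split m s l r) (False # p) = {x. s < x $ m} \<inter> region r p"

fun leaf_of :: "'n::finite rtree \<Rightarrow> real ^ 'n \<Rightarrow> bool list" where
  "leaf_of Leaf x = []"
| "leaf_of (Split m s l r) x =
    (if x $ m \<le> s then True # leaf_of l x else False # leaf_of r x)"

text \<open>The \<open>\<sigma>\<close>-algebra making the split variable and threshold at every address measurable.\<close>

definition tree_space :: "'n::finite rtree measure" where
  "tree_space = sigma UNIV {{t. \<exists>s\<le>a. split_at t p = Some (m, s)} |p m a. True}"

definition node_count :: "nat set \<Rightarrow> (nat \<Rightarrow> real ^ 'n) \<Rightarrow> 'n::finite rtree \<Rightarrow> bool list \<Rightarrow> nat" where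
  "node_count I x t p = card {i \<in> I. x i \<in> region t p}"

text \<open>For a random tree \<open>T\<close> grown from data \<open>D\<close> with values in \<open>N\<close>: the information consisting
  of the data, the splits made at the proper ancestors of the node \<open>p\<close>, and whether \<open>p\<close> is split.\<close>

definition split_history ::
    "'w measure \<Rightarrow> 'd measure \<Rightarrow> ('w \<Rightarrow> 'd) \<Rightarrow> ('w \<Rightarrow> 'n::finite rtree) \<Rightarrow> bool list \<Rightarrow> 'w measure" where
  "split_history M N D T p = sigma (space M)
     ({D -` A \<inter> space M |A. A \<in> sets N}
      \<union> {{\<omega> \<in> space M. \<exists>s\<le>a. split_at (T \<omega>) (take k p) = Some (m, s)} |k m a. k < length p}
      \<union> {{\<omega> \<in> space M. split_at (T \<omega>) p \<noteq> None}})"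

definition tree_weight ::
    "nat set \<Rightarrow> (nat \<Rightarrow> real ^ 'n) \<Rightarrow> 'n::finite rtree \<Rightarrow> real ^ 'n \<Rightarrow> nat \<Rightarrow> real" where
  "tree_weight I x t z i =
     indicat_real (region t (leaf_of t z)) (x i) / real (node_count I x t (leaf_of t z))"

definition forest_weight ::
    "nat set \<Rightarrow> (nat \<Rightarrow> real ^ 'n) \<Rightarrow> nat \<Rightarrow> (nat \<Rightarrow> 'n::finite rtree) \<Rightarrow> real ^ 'n \<Rightarrow> nat \<Rightarrow> real" where
  "forest_weight I x B T z i = 1 / real B * (\<Sum>b<B. tree_weight I x (T b) z i)"

definition qrf ::
    "real \<Rightarrow> nat set \<Rightarrow> (nat \<Rightarrow> real ^ 'n) \<Rightarrow> (nat \<Rightarrow> real) \<Rightarrow> nat \<Rightarrow> (nat \<Rightarrow> 'n::finite rtree)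
      \<Rightarrow> real ^ 'n \<Rightarrow> real" where
  "qrf \<alpha> I x y B T z =
     Inf {v. (\<Sum>i\<in>I. forest_weight I x B T z i * of_bool (y i \<le> v)) \<ge> \<alpha>}"

definition empirical_quantile :: "real \<Rightarrow> nat set \<Rightarrow> (nat \<Rightarrow> real) \<Rightarrow> real" where
  "empirical_quantile \<alpha> I e = Inf {q. real (card {i \<in> I. e i \<le> q}) / real (card I) \<ge> \<alpha>}"

definition measure_support :: "'a::topological_space measure \<Rightarrow> 'a set" where
  "measure_support N = {x. \<forall>U. open U \<longrightarrow> x \<in> U \<longrightarrow> emeasure N U > 0}"

text \<open>The library's \<open>indep_var\<close> requires both random variables to have values in the same type.\<close>

definition indep_rv ::
    "'w measure \<Rightarrow> 'a measure \<Rightarrow> ('w \<Rightarrow> 'a) \<Rightarrow> 'b measure \<Rightarrow> ('w \<Rightarrow> 'b) \<Rightarrow> bool" where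
  "indep_rv M N U N' V \<longleftrightarrow> U \<in> M \<rightarrow>\<^sub>M N \<and> V \<in> M \<rightarrow>\<^sub>M N' \<and>
     prob_space.indep_set M {U -` A \<inter> space M |A. A \<in> sets N} {V -` A \<inter> space M |A. A \<in> sets N'}"

text \<open>\<open>K x\<close> is the conditional law of \<open>Y\<close> given \<open>X = x\<close>, so \<open>F (y | x)\<close> is \<^term>\<open>cdf (K x) y\<close>.\<close>

definition is_regular_cond_dist ::
    "'w measure \<Rightarrow> ('w \<Rightarrow> 'a::topological_space) \<Rightarrow> ('w \<Rightarrow> real) \<Rightarrow> ('a \<Rightarrow> real measure) \<Rightarrow> bool" where
  "is_regular_cond_dist M X Y K \<longleftrightarrow>
     K \<in> borel \<rightarrow>\<^sub>M prob_algebra borel \<and>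
     (\<forall>A\<in>sets borel. \<forall>C\<in>sets borel.
        emeasure M {\<omega> \<in> space M. X \<omega> \<in> A \<and> Y \<omega> \<in> C}
          = (\<integral>\<^sup>+x\<in>A. emeasure (K x) C \<partial>distr M borel X))"

text \<open>Convergence to zero in probability. The outer measure is used because a supremum over an
  uncountable random set need not be measurable; for measurable \<open>U\<close> this is the usual notion.\<close>

definition tendsto_zero_in_prob :: "'w measure \<Rightarrow> (nat \<Rightarrow> 'w \<Rightarrow> ennreal) \<Rightarrow> bool" where
  "tendsto_zero_in_prob M U \<longleftrightarrow>
     (\<forall>\<epsilon>>0. (\<lambda>n. outer_measure_of M {\<omega> \<in> space M. U n \<omega> > \<epsilon>}) \<longlonglongrightarrow> 0)"

end

theory Submission
  imports Defs
begin

text \<open>The set \<open>\<Lambda>\<^sub>n\<close> consists of the points whose coverage error is at most \<open>\<epsilon>\<^sub>n\<close>, so it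
  suffices that the coverage error at the independent point \<open>X\<close> tends to 0 in probability.

  The error of the forest estimate of \<open>F(y | X)\<close> splits into a centred sum, whose second
  moment is at most the expected sum of squared weights (by honesty), hence at most the inverse of
  the minimal leaf count, and a bias, which the Lipschitz condition bounds by the size of the leaf of
  \<open>X\<close>. For the bias consider all cells at a fixed depth \<open>J\<close>, each weighted by its number of
  observations times its width in direction \<open>m\<close>. An \<open>m\<close>-split divides the width \<open>w\<close> into
  \<open>w\<^sub>1 + w\<^sub>2 = w\<close> and leaves at most the fraction \<open>1 - \<gamma>\<close> of the points on either side, so the
  weighted width decreases by the factor \<open>1 - \<gamma>\<close>, whatever the law of \<open>X\<close>; in mean it decays
  like \<open>(1 - \<gamma> C\<^sub>0)\<^sup>J\<close>. For fixed \<open>J\<close> there are only \<open>2\<^sup>J\<close> cells, and a grid argument replaces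
  empirical by true probabilities of cells. All leaves are eventually deeper than \<open>J\<close>, since leaf
  counts are \<open>o(n)\<close> while a node of depth \<open>j\<close> holds at least the fraction \<open>\<gamma>\<^sup>j\<close> of the points.

  Strict monotonicity of \<open>F\<close> then makes the forest quantile close to the true one, the scores close
  to i.i.d. scores whose \<open>\<alpha>\<close>-quantile is 0, and so the conformal correction negligible.\<close>

section \<open>Trees and their cells\<close>

text \<open>The splits may depend on the training covariates, so the number of training points in a
  cell is not a sum of independent indicators. Two devices deal with this. Widths are weighted by
  counts and not by probabilities, because balance is stated in counts and the split probabilities
  are conditional on the training data; and frequencies are compared with probabilities only on the
  cubes of a fixed grid, by a bound that holds for every tree at once. Cells are indexed by
  addresses, and an address that leaves the tree has the empty region, so sums over the random cells
  of depth \<open>J\<close> run over \<open>2 ^ J\<close> fixed addresses. Constants are chosen in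
  the order depth, slab error, mesh, sample size.

  Strict monotonicity is not uniform in \<open>x\<close>: the gap between \<alpha> and the
  conditional distribution function slightly off the quantile need not have a common lower bound.
  Hence the statements on quantiles are made at the random point \<open>X\<close>, in probability.
  They carry over to the calibration points because a calibration covariate has the same joint law
  with the training data and the forest randomness as \<open>X\<close>.\<close>

definition right_side :: "bool \<Rightarrow> real \<Rightarrow> real \<Rightarrow> bool" where
  "right_side c u s \<longleftrightarrow> (if c then u \<le> s else s < u)"

text \<open>Unfolds the recursion on the tree into one condition per proper prefix of the address.
  Measurability, widths and the grid argument all start from this form, because it consults the tree
  at finitely many addresses only.\<close>

lemma region_iff:
  "x \<in> region t p \<longleftrightarrow>
    (\<forall>k<length p. \<exists>m s. split_at t (take k p) = Some (m, s) \<and> right_side (p ! k) (x $ m) s)"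
proof (induction t p rule: region.induct)
  case (3 m s l r p)
  then show ?case by (auto simp: right_side_def All_less_Suc2)
next
  case (4 m s l r p)
  then show ?case by (auto simp: right_side_def All_less_Suc2)
qed auto

lemma split_at_prefix: "split_at t p \<noteq> None \<Longrightarrow> k \<le> length p \<Longrightarrow> split_at t (take k p) \<noteq> None"
proof (induction t p arbitrary: k rule: split_at.induct)
  case (3 m s l r p)
  then show ?case by (cases k) auto
next
  case (4 m s l r p)
  then show ?case by (cases k) auto
qed auto

text \<open>The \<open>None\<close> case matters: below a leaf every region is empty, which makes
  sums over all addresses of a given length harmless.\<close>

lemma region_snoc:
  "region t (p @ [c]) =
    (case split_at t p of None \<Rightarrow> {} | Some (m, s) \<Rightarrow> {x \<in> region t p. right_side c (x $ m) s})"
  by (auto simp: region_iff All_less_Suc nth_append split: option.splits)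

lemma in_region_leaf_of: "x \<in> region t (leaf_of t x)"
  by (induction t) auto

lemma split_at_leaf_of [simp]: "split_at t (leaf_of t x) = None"
  by (induction t) auto

lemma leaf_of_in_leaves: "leaf_of t x \<in> leaves t"
proof -
  have "leaf_of t x \<in> nodes t"
    by (induction t) auto
  then show ?thesis by (simp add: leaves_def)
qed

lemma finite_nodes: "finite (nodes t)"
  by (induction t) auto

lemma finite_leaves: "finite (leaves t)"
  by (simp add: leaves_def finite_nodes)

lemma leaf_of_unique: "x \<in> region t p \<Longrightarrow> split_at t p = None \<Longrightarrow> leaf_of t x = p"
proof (induction t p rule: region.induct)
  case (1 t)
  then show ?case by (cases t) auto
qed auto

lemma leaf_of_iff: "leaf_of t x = p \<longleftrightarrow> x \<in> region t p \<and> split_at t p = None"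
  using in_region_leaf_of leaf_of_unique split_at_leaf_of by metis

lemma region_take: "region t p \<subseteq> region t (take k p)"
proof
  fix x assume "x \<in> region t p"
  then show "x \<in> region t (take k p)"
    unfolding region_iff by (auto simp: min_def)
qed

lemma node_count_split:
  assumes "finite I" "split_at t p \<noteq> None"
  shows "node_count I x t (p @ [True]) + node_count I x t (p @ [False]) = node_count I x t p"
proof -
  obtain m s where ms: "split_at t p = Some (m, s)" using assms by auto
  have "{i \<in> I. x i \<in> region t p} =
      {i \<in> I. x i \<in> region t (p @ [True])} \<union> {i \<in> I. x i \<in> region t (p @ [False])}"
    by (auto simp: region_snoc ms right_side_def)
  then show ?thesis unfolding node_count_def
    by (simp add: assms(1) card_Un_disjoint[symmetric] region_snoc ms right_side_def disjoint_iff
        flip: card_Un_disjoint)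
qed

lemma node_count_nil [simp]: "node_count I x t [] = card I"
  by (simp add: node_count_def)

lemma node_count_unsplit: "split_at t p = None \<Longrightarrow> node_count I x t (p @ [c]) = 0"
  by (simp add: node_count_def region_snoc)

text \<open>Since division by zero gives zero, a positive \<open>g\<close> also forbids splitting a
  node without observations.\<close>

definition balanced :: "real \<Rightarrow> nat set \<Rightarrow> (nat \<Rightarrow> real ^ 'n) \<Rightarrow> 'n::finite rtree \<Rightarrow> bool" where
  "balanced g I x t \<longleftrightarrow> (\<forall>p c. split_at t p \<noteq> None \<longrightarrow>
     real (node_count I x t (p @ [c])) / real (node_count I x t p) \<ge> g)"

lemma balanced_node_count_ge:
  assumes "balanced g I x t" "g > 0" "split_at t p \<noteq> None"
  shows "real (node_count I x t (p @ [c])) \<ge> g * real (node_count I x t p)"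
proof -
  have *: "real (node_count I x t (p @ [c])) / real (node_count I x t p) \<ge> g"
    using assms unfolding balanced_def by blast
  then have "node_count I x t p \<noteq> 0" using assms(2) by (intro notI) simp
  with * show ?thesis by (simp add: field_simps)
qed

text \<open>Every proper ancestor of a node is split, and each step down keeps at least the fraction
  \<open>g\<close> of the points.\<close>

lemma balanced_node_count_power:
  assumes "balanced g I x t" "g > 0" "p \<in> nodes t"
  shows "real (node_count I x t p) \<ge> g ^ length p * real (card I)"
proof -
  have "p = [] \<or> split_at t (butlast p) \<noteq> None" if "p \<in> nodes t" for p and t :: "'n::finite rtree"
    using that
  proof (induction t arbitrary: p)
    case Leaf then show ?case by simp
  next
    case (Split m s l r)
    then show ?case by fastforce
  qed
  then have *: "p = [] \<or> split_at t (butlast p) \<noteq> None" using assms by blast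
  have "k \<le> length p \<Longrightarrow> real (node_count I x t (take k p)) \<ge> g ^ k * real (card I)" for k
  proof (induction k)
    case (Suc k)
    then have "split_at t (butlast p) \<noteq> None" using * by auto
    then have "split_at t (take k p) \<noteq> None"
      using split_at_prefix[of t "butlast p" k] Suc.prems by (simp add: take_butlast)
    then have "real (node_count I x t (take k p @ [p ! k])) \<ge> g * real (node_count I x t (take k p))"
      using balanced_node_count_ge assms by blast
    also have "take k p @ [p ! k] = take (Suc k) p"
      using Suc.prems by (simp add: take_Suc_conv_app_nth)
    finally show ?case using Suc assms(2)
      by (smt (verit, best) Suc_leD mult.assoc mult_left_mono power_Suc)
  qed simp
  from this[of "length p"] show ?thesis by simp
qed

section \<open>Measurability of trees\<close>

lemma split_at_measurable [measurable]:
  "{t. \<exists>s\<le>a. split_at t p = Some (m, s)} \<in> sets tree_space"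
  unfolding tree_space_def by (subst sets_measure_of) auto

lemma pred_split_at:
  assumes "T \<in> N \<rightarrow>\<^sub>M tree_space"
  shows "Measurable.pred N (\<lambda>w. \<exists>s\<le>a. split_at (T w) p = Some (m, s))"
proof -
  have "T -` {t. \<exists>s\<le>a. split_at t p = Some (m, s)} \<inter> space N \<in> sets N"
    using assms by measurable
  also have "T -` {t. \<exists>s\<le>a. split_at t p = Some (m, s)} \<inter> space N
      = {w \<in> space N. \<exists>s\<le>a. split_at (T w) p = Some (m, s)}" by auto
  finally show ?thesis by (simp add: pred_def)
qed

text \<open>The basic events bound the threshold from above, so the existence of some threshold is a
  countable union over natural bounds.\<close>

lemma pred_split_at_var:
  fixes T :: "'a \<Rightarrow> 'n::finite rtree"
  assumes "\<And>a. Measurable.pred N (\<lambda>w. \<exists>s\<le>a. split_at (T w) p = Some (m, s))"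
  shows "Measurable.pred N (\<lambda>w. \<exists>s. split_at (T w) p = Some (m, s))"
proof -
  have "(\<lambda>w. \<exists>s. split_at (T w) p = Some (m, s))
      = (\<lambda>w. \<exists>k::nat. \<exists>s\<le>real k. split_at (T w) p = Some (m, s))"
    by (auto simp: fun_eq_iff) (meson real_arch_simple)
  then show ?thesis using assms by simp
qed

text \<open>The assumption concerns one address and not the measurability of \<open>T\<close>: in
  the \<sigma>-algebra of a split history only the ancestors of a node are known, and the whole tree
  need not be measurable.\<close>

lemma pred_right_side:
  fixes T :: "'a \<Rightarrow> 'n::finite rtree"
  assumes *: "\<And>a. Measurable.pred N (\<lambda>w. \<exists>s\<le>a. split_at (T w) p = Some (m, s))"
    and [measurable]: "u \<in> borel_measurable N"
  shows "Measurable.pred N (\<lambda>w. \<exists>s. split_at (T w) p = Some (m, s) \<and> right_side c (u w) s)"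
proof -
  define A where "A = {w \<in> space N. \<exists>s. split_at (T w) p = Some (m, s)}"
  have A[measurable]: "A \<in> sets N"
    using pred_split_at_var[OF *] by (simp add: A_def pred_def)
  \<comment> \<open>A meaningful threshold only on \<open>A\<close>; its measurability is shown on
    the restricted space, and the extension by 0 is harmless because the final predicate includes
    membership in \<open>A\<close>.\<close>
  define h where "h w = snd (the (split_at (T w) p))" for w
  have "h \<in> borel_measurable (restrict_space N A)"
  proof (rule borel_measurableI_le)
    fix a
    have "{w \<in> space (restrict_space N A). h w \<le> a} = {w \<in> space N. \<exists>s\<le>a. split_at (T w) p = Some (m, s)}"
      by (auto simp: space_restrict_space A_def h_def)
    moreover have "{w \<in> space N. \<exists>s\<le>a. split_at (T w) p = Some (m, s)} \<in> sets N"
      using * by (simp add: pred_def)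
    moreover have "{w \<in> space N. \<exists>s\<le>a. split_at (T w) p = Some (m, s)} \<subseteq> A" by (auto simp: A_def)
    ultimately show "{w \<in> space (restrict_space N A). h w \<le> a} \<in> sets (restrict_space N A)"
      by (auto simp: sets_restrict_space_iff)
  qed
  then have [measurable]: "(\<lambda>w. if w \<in> A then h w else 0) \<in> borel_measurable N"
    by (subst measurable_If_restrict_space_iff) auto
  have "Measurable.pred N (\<lambda>w. w \<in> A \<and> right_side c (u w) (if w \<in> A then h w else 0))"
    unfolding right_side_def by measurable
  then show ?thesis
    by (rule measurable_cong[THEN iffD1, rotated]) (auto simp: A_def h_def)
qed

lemma vec_nth_borel_measurable [measurable (raw)]:
  "x \<in> borel_measurable N \<Longrightarrow> (\<lambda>w. (x w :: real ^ 'n) $ m) \<in> borel_measurable N"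
  by (rule borel_measurable_continuous_onI[THEN measurable_compose[rotated]])
    (auto intro!: continuous_intros)

text \<open>Only splits at proper prefixes of \<open>p\<close> are required to be measurable, so the
  lemma applies both to measurable random trees and to split histories.\<close>

lemma pred_in_region:
  fixes T :: "'a \<Rightarrow> 'n::finite rtree"
  assumes "\<And>k m a. k < length p \<Longrightarrow>
      Measurable.pred N (\<lambda>w. \<exists>s\<le>a. split_at (T w) (take k p) = Some (m, s))"
    and [measurable]: "x \<in> borel_measurable N"
  shows "Measurable.pred N (\<lambda>w. x w \<in> region (T w) p)"
proof -
  have [measurable]: "Measurable.pred N (\<lambda>w. \<exists>s. split_at (T w) (take k p) = Some (m, s) \<and> right_side c (x w $ m) s)"
    if "k < length p" for k m c
    using that assms(1) by (intro pred_right_side) auto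
  have "Measurable.pred N (\<lambda>w. \<forall>k\<in>{..<length p}. \<exists>m. \<exists>s. split_at (T w) (take k p) = Some (m, s)
      \<and> right_side (p ! k) (x w $ m) s)"
    by measurable
  then show ?thesis unfolding region_iff by (simp add: Ball_def)
qed

lemma pred_in_region_tree:
  fixes T :: "'a \<Rightarrow> 'n::finite rtree"
  assumes "T \<in> N \<rightarrow>\<^sub>M tree_space" "x \<in> borel_measurable N"
  shows "Measurable.pred N (\<lambda>w. x w \<in> region (T w) p)"
  using assms by (intro pred_in_region pred_split_at)

lemma pred_split_at_None:
  fixes T :: "'a \<Rightarrow> 'n::finite rtree"
  assumes "T \<in> N \<rightarrow>\<^sub>M tree_space"
  shows "Measurable.pred N (\<lambda>w. split_at (T w) p = None)"
proof -
  have *: "split_at t p = None \<longleftrightarrow> \<not> (\<exists>m. \<exists>s. split_at t p = Some (m, s))" for t :: "'n rtree"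
    by (cases "split_at t p") auto
  have [measurable]: "Measurable.pred N (\<lambda>w. \<exists>s. split_at (T w) p = Some (m, s))" for m
    using assms by (intro pred_split_at_var pred_split_at)
  show ?thesis unfolding * by measurable
qed

lemma pred_leaf_of:
  fixes T :: "'a \<Rightarrow> 'n::finite rtree"
  assumes "T \<in> N \<rightarrow>\<^sub>M tree_space" "x \<in> borel_measurable N"
  shows "Measurable.pred N (\<lambda>w. leaf_of (T w) (x w) = p)"
  unfolding leaf_of_iff using pred_in_region_tree[OF assms] pred_split_at_None[OF assms(1)]
  by measurable

text \<open>There are countably many addresses, so the random leaf can be fixed by a countable
  union.\<close>

lemma pred_same_leaf:
  fixes T :: "'a \<Rightarrow> 'n::finite rtree"
  assumes "T \<in> N \<rightarrow>\<^sub>M tree_space" "x \<in> borel_measurable N" "z \<in> borel_measurable N"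
  shows "Measurable.pred N (\<lambda>w. x w \<in> region (T w) (leaf_of (T w) (z w)))"
proof -
  have "(\<lambda>w. x w \<in> region (T w) (leaf_of (T w) (z w)))
     = (\<lambda>w. \<exists>p. leaf_of (T w) (z w) = p \<and> x w \<in> region (T w) p)" by auto
  moreover have [measurable]: "Measurable.pred N (\<lambda>w. leaf_of (T w) (z w) = p)" for p
    using pred_leaf_of assms by blast
  moreover have [measurable]: "Measurable.pred N (\<lambda>w. x w \<in> region (T w) p)" for p
    using pred_in_region_tree assms by blast
  ultimately show ?thesis by (simp only:) measurable
qed

lemma node_count_eq_sum:
  "finite I \<Longrightarrow> real (node_count I x t p) = (\<Sum>i\<in>I. indicat_real (region t p) (x i))"
  unfolding node_count_def by (simp add: indicator_def sum.If_cases Int_def flip: sum.inter_filter)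

lemma tree_weight_measurable:
  fixes T :: "'a \<Rightarrow> 'n::finite rtree"
  assumes T: "T \<in> N \<rightarrow>\<^sub>M tree_space" and I: "finite I" "i \<in> I"
    and x: "\<And>i. i \<in> I \<Longrightarrow> x i \<in> borel_measurable N" and z: "z \<in> borel_measurable N"
  shows "(\<lambda>w. tree_weight I (\<lambda>i. x i w) (T w) (z w) i) \<in> borel_measurable N"
proof -
  have [measurable]: "(\<lambda>w. indicat_real (region (T w) (leaf_of (T w) (z w))) (x i w)) \<in> borel_measurable N"
    if "i \<in> I" for i
  proof -
    have [measurable]: "Measurable.pred N (\<lambda>w. x i w \<in> region (T w) (leaf_of (T w) (z w)))"
      using that assms by (intro pred_same_leaf) auto
    show ?thesis unfolding indicator_def by measurable
  qed
  show ?thesis unfolding tree_weight_def node_count_eq_sum[OF I(1)] using I(2) by measurable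
qed

lemma forest_weight_measurable:
  fixes T :: "nat \<Rightarrow> 'a \<Rightarrow> 'n::finite rtree"
  assumes "\<And>b. b < B \<Longrightarrow> T b \<in> N \<rightarrow>\<^sub>M tree_space" and "finite I" "i \<in> I"
    and "\<And>i. i \<in> I \<Longrightarrow> x i \<in> borel_measurable N" "z \<in> borel_measurable N"
  shows "(\<lambda>w. forest_weight I (\<lambda>i. x i w) B (\<lambda>b. T b w) (z w) i) \<in> borel_measurable N"
  unfolding forest_weight_def using assms
  by (intro borel_measurable_times borel_measurable_sum borel_measurable_const tree_weight_measurable) auto

section \<open>Weighted quantiles\<close>

text \<open>Common form of the forest quantile (forest weights) and of the empirical quantile (equal
  weights).\<close>

definition weighted_quantile :: "real \<Rightarrow> nat set \<Rightarrow> (nat \<Rightarrow> real) \<Rightarrow> (nat \<Rightarrow> real) \<Rightarrow> real" where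
  "weighted_quantile \<alpha> I w y = Inf {v. (\<Sum>i\<in>I. w i * of_bool (y i \<le> v)) \<ge> \<alpha>}"

lemma weighted_cdf_mono:
  fixes w y :: "nat \<Rightarrow> real"
  assumes "\<And>i. i \<in> I \<Longrightarrow> 0 \<le> w i" "u \<le> v"
  shows "(\<Sum>i\<in>I. w i * of_bool (y i \<le> u)) \<le> (\<Sum>i\<in>I. w i * of_bool (y i \<le> v))"
  using assms by (intro sum_mono mult_left_mono) auto

text \<open>The weighted distribution function is a right-continuous step function, so the infimum
  is attained at a data value. Positivity of \<alpha> keeps the set bounded below, and total weight
  at least \<alpha> makes it nonempty.\<close>

lemma weighted_quantile_le_iff:
  assumes I: "finite I" and w: "\<And>i. i \<in> I \<Longrightarrow> 0 \<le> w i" and \<alpha>: "0 < \<alpha>" "\<alpha> \<le> (\<Sum>i\<in>I. w i)"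
  shows "weighted_quantile \<alpha> I w y \<le> c \<longleftrightarrow> \<alpha> \<le> (\<Sum>i\<in>I. w i * of_bool (y i \<le> c))"
proof -
  define G where "G v = (\<Sum>i\<in>I. w i * of_bool (y i \<le> v))" for v
  define C where "C = {y i |i. i \<in> I \<and> \<alpha> \<le> G (y i)}"
  have "C = y ` {i \<in> I. \<alpha> \<le> G (y i)}" by (auto simp: C_def)
  then have C: "finite C" using I by simp
  have G_mono: "u \<le> v \<Longrightarrow> G u \<le> G v" for u v
    unfolding G_def using w by (rule weighted_cdf_mono)
  \<comment> \<open>Lower \<open>v\<close> to the largest data value not exceeding it; the step
    function does not change on the way.\<close>
  have ex: "\<exists>z\<in>C. z \<le> v" if v: "\<alpha> \<le> G v" for v
  proof -
    define D where "D = y ` {i \<in> I. y i \<le> v}"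
    have "D \<noteq> {}"
    proof
      assume "D = {}"
      then have "G v = 0" unfolding G_def D_def by (intro sum.neutral) auto
      then show False using v \<alpha> by simp
    qed
    moreover have fD: "finite D" using I by (simp add: D_def)
    ultimately have M: "Max D \<in> D" by simp
    have "y i \<le> v \<longleftrightarrow> y i \<le> Max D" if "i \<in> I" for i
    proof
      assume "y i \<le> v" then show "y i \<le> Max D" using that fD by (intro Max_ge) (auto simp: D_def)
    next
      assume "y i \<le> Max D" then show "y i \<le> v" using M by (auto simp: D_def)
    qed
    then have "G (Max D) = G v" unfolding G_def by (intro sum.cong) auto
    then have "Max D \<in> C" "Max D \<le> v" using M v by (auto simp: D_def C_def)
    then show ?thesis by blast
  qed
  have "I \<noteq> {}" using \<alpha> by auto
  have "G (Max (y ` I)) = (\<Sum>i\<in>I. w i)"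
    unfolding G_def using I by (intro sum.cong) auto
  then have "C \<noteq> {}" using ex[of "Max (y ` I)"] \<alpha> by auto
  then have Min: "Min C \<in> C" using C by simp
  have "{v. \<alpha> \<le> G v} = {Min C..}"
  proof safe
    fix v assume "\<alpha> \<le> G v"
    then show "Min C \<le> v" using ex C by (meson Min_le order_trans)
  next
    fix v assume "Min C \<le> v"
    then have "G (Min C) \<le> G v" by (rule G_mono)
    then show "\<alpha> \<le> G v" using Min by (auto simp: C_def)
  qed
  then have "weighted_quantile \<alpha> I w y = Min C" "\<alpha> \<le> G c \<longleftrightarrow> Min C \<le> c"
    unfolding weighted_quantile_def G_def by auto
  then show ?thesis by (simp add: G_def)
qed

lemma weighted_quantile_measurable:
  assumes I: "finite I" and w: "\<And>i x. i \<in> I \<Longrightarrow> 0 \<le> w i x" and \<alpha>: "0 < \<alpha>"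
    and [measurable]: "\<And>i. i \<in> I \<Longrightarrow> w i \<in> borel_measurable N"
      "\<And>i. i \<in> I \<Longrightarrow> y i \<in> borel_measurable N"
  shows "(\<lambda>x. weighted_quantile \<alpha> I (\<lambda>i. w i x) (\<lambda>i. y i x)) \<in> borel_measurable N"
proof (rule borel_measurableI_le)
  fix c
  \<comment> \<open>With too little total weight the level is never reached, and the quantile is the
    fixed value of \<open>Inf {}\<close>; measurability is proved by splitting off this
    case.\<close>
  have less: "weighted_quantile \<alpha> I (\<lambda>i. w i x) (\<lambda>i. y i x) = Inf {}" if "(\<Sum>i\<in>I. w i x) < \<alpha>" for x
  proof -
    have "(\<Sum>i\<in>I. w i x * of_bool (y i x \<le> v)) \<le> (\<Sum>i\<in>I. w i x)" for v
      using w by (intro sum_mono) auto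
    then have "(\<Sum>i\<in>I. w i x * of_bool (y i x \<le> v)) < \<alpha>" for v using that by (rule le_less_trans)
    then have "{v. \<alpha> \<le> (\<Sum>i\<in>I. w i x * of_bool (y i x \<le> v))} = {}" by (auto simp: not_le)
    then show ?thesis by (simp only: weighted_quantile_def)
  qed
  have "{x \<in> space N. weighted_quantile \<alpha> I (\<lambda>i. w i x) (\<lambda>i. y i x) \<le> c} =
      {x \<in> space N. if \<alpha> \<le> (\<Sum>i\<in>I. w i x) then \<alpha> \<le> (\<Sum>i\<in>I. w i x * of_bool (y i x \<le> c))
         else (Inf {} :: real) \<le> c}"
  proof (intro Collect_cong conj_cong refl)
    fix x
    show "weighted_quantile \<alpha> I (\<lambda>i. w i x) (\<lambda>i. y i x) \<le> c \<longleftrightarrow>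
      (if \<alpha> \<le> (\<Sum>i\<in>I. w i x) then \<alpha> \<le> (\<Sum>i\<in>I. w i x * of_bool (y i x \<le> c))
         else (Inf {} :: real) \<le> c)"
    proof (cases "\<alpha> \<le> (\<Sum>i\<in>I. w i x)")
      case True
      with weighted_quantile_le_iff[OF I w \<alpha>] show ?thesis by (simp only: if_True)
    next
      case False
      then have "(\<Sum>i\<in>I. w i x) < \<alpha>" by simp
      from less[OF this] False show ?thesis by (simp only: if_False)
    qed
  qed
  also have "\<dots> \<in> sets N" using I by measurable
  finally show "{x \<in> space N. weighted_quantile \<alpha> I (\<lambda>i. w i x) (\<lambda>i. y i x) \<le> c} \<in> sets N" .
qed

lemma empirical_quantile_eq:
  assumes "finite I"
  shows "empirical_quantile \<alpha> I e = weighted_quantile \<alpha> I (\<lambda>_. 1 / real (card I)) e"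
proof -
  have "real (card {i \<in> I. e i \<le> q}) / real (card I) = (\<Sum>i\<in>I. 1 / real (card I) * of_bool (e i \<le> q))" for q
  proof -
    have "(\<Sum>i\<in>I. 1 / real (card I) * of_bool (e i \<le> q)) = 1 / real (card I) * (\<Sum>i\<in>I. of_bool (e i \<le> q))"
      by (simp only: sum_distrib_left)
    also have "(\<Sum>i\<in>I. of_bool (e i \<le> q)) = real (card {i \<in> I. e i \<le> q})"
      using assms by (simp add: of_bool_def sum.If_cases Int_def)
    finally show ?thesis by simp
  qed
  then show ?thesis by (simp add: empirical_quantile_def weighted_quantile_def)
qed

section \<open>Forest weights\<close>

lemma qrf_eq: "qrf \<alpha> I x y B T z = weighted_quantile \<alpha> I (forest_weight I x B T z) y"
  by (simp add: qrf_def weighted_quantile_def)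

lemma tree_weight_nonneg [simp]: "0 \<le> tree_weight I x t z i"
  by (simp add: tree_weight_def)

text \<open>A leaf without training points has weights 0 / 0 = 0, so its weights sum to 0 instead of
  1.\<close>

lemma tree_weight_sum:
  assumes "finite I"
  shows "(\<Sum>i\<in>I. tree_weight I x t z i) = (if node_count I x t (leaf_of t z) = 0 then 0 else 1)"
  using node_count_eq_sum[OF assms, of x t "leaf_of t z"]
  by (auto simp: tree_weight_def simp flip: sum_divide_distrib)

lemma forest_weight_nonneg [simp]: "0 \<le> forest_weight I x B T z i"
  by (simp add: forest_weight_def sum_nonneg)

lemma forest_weight_sum_le: 
  assumes "finite I" "B \<ge> 1"
  shows "(\<Sum>i\<in>I. forest_weight I x B T z i) \<le> 1"
proof -
  have "(\<Sum>i\<in>I. forest_weight I x B T z i) = 1 / real B * (\<Sum>b<B. \<Sum>i\<in>I. tree_weight I x (T b) z i)"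
    unfolding forest_weight_def by (simp add: sum_distrib_left[symmetric] sum.swap[of _ I] del: times_divide_eq_left)
  also have "\<dots> \<le> 1 / real B * (\<Sum>b<B. 1)"
    by (intro mult_left_mono sum_mono) (auto simp: tree_weight_sum assms)
  finally show ?thesis using assms by simp
qed

lemma forest_weight_sum_eq:
  assumes "finite I" "B \<ge> 1" "\<And>b. b < B \<Longrightarrow> node_count I x (T b) (leaf_of (T b) z) > 0"
  shows "(\<Sum>i\<in>I. forest_weight I x B T z i) = 1"
proof -
  have "(\<Sum>i\<in>I. forest_weight I x B T z i) = 1 / real B * (\<Sum>b<B. \<Sum>i\<in>I. tree_weight I x (T b) z i)"
    unfolding forest_weight_def by (simp add: sum_distrib_left[symmetric] sum.swap[of _ I] del: times_divide_eq_left)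
  also have "\<dots> = 1 / real B * (\<Sum>b<B. 1)"
    using assms(3) by (intro arg_cong2[where f="(*)"] sum.cong) (auto simp: tree_weight_sum assms)
  finally show ?thesis using assms by simp
qed

lemma forest_weight_le_1:
  assumes "finite I" "B \<ge> 1" "i \<in> I"
  shows "forest_weight I x B T z i \<le> 1"
proof -
  have "forest_weight I x B T z i \<le> (\<Sum>i\<in>I. forest_weight I x B T z i)"
    using assms by (intro member_le_sum) auto
  then show ?thesis using forest_weight_sum_le[OF assms(1,2), of x T z] by linarith
qed

text \<open>Each weight is at most \<open>1 / k\<close> and the weights sum to at most 1; the sum of
  squares is at most the largest weight times the sum.\<close>

lemma forest_weight_sum_squares_le:
  assumes "finite I" "B \<ge> 1" "0 < k" "\<And>b. b < B \<Longrightarrow> k \<le> real (node_count I x (T b) (leaf_of (T b) z))"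
  shows "(\<Sum>i\<in>I. (forest_weight I x B T z i)\<^sup>2) \<le> 1 / k"
proof -
  have "forest_weight I x B T z i \<le> 1 / k" for i
  proof -
    have "tree_weight I x (T b) z i \<le> 1 / k" if "b < B" for b
      unfolding tree_weight_def using assms(3) assms(4)[OF that] 
      by (intro frac_le) (auto simp: indicator_def)
    then have "forest_weight I x B T z i \<le> 1 / real B * (\<Sum>b<B. 1 / k)"
      unfolding forest_weight_def by (intro mult_left_mono sum_mono) auto
    then show ?thesis using assms(2) by simp
  qed
  then have "(\<Sum>i\<in>I. (forest_weight I x B T z i)\<^sup>2) \<le> (\<Sum>i\<in>I. 1 / k * forest_weight I x B T z i)"
    unfolding power2_eq_square by (intro sum_mono mult_right_mono) auto
  also have "\<dots> = 1 / k * (\<Sum>i\<in>I. forest_weight I x B T z i)" by (simp only: sum_distrib_left)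
  also have "\<dots> \<le> 1 / k * 1"
    using forest_weight_sum_le assms by (intro mult_left_mono) auto
  finally show ?thesis by simp
qed

lemma qrf_measurable:
  fixes T :: "nat \<Rightarrow> 'a \<Rightarrow> 'n::finite rtree"
  assumes "0 < \<alpha>" "\<And>b. b < B \<Longrightarrow> T b \<in> N \<rightarrow>\<^sub>M tree_space" "finite I"
    and "\<And>i. i \<in> I \<Longrightarrow> x i \<in> borel_measurable N" "\<And>i. i \<in> I \<Longrightarrow> y i \<in> borel_measurable N"
    and "z \<in> borel_measurable N"
  shows "(\<lambda>w. qrf \<alpha> I (\<lambda>i. x i w) (\<lambda>i. y i w) B (\<lambda>b. T b w) (z w)) \<in> borel_measurable N"
  unfolding qrf_eq using assms
  by (intro weighted_quantile_measurable forest_weight_measurable) auto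

section \<open>Widths of cells\<close>

text \<open>The factor in direction \<open>m\<close> of the cell, cut down to the interval from
  \<open>-R\<close> to \<open>R\<close>. Splits along other coordinates and missing ancestors impose
  nothing, so it is defined for every address.\<close>

definition cell_side :: "real \<Rightarrow> 'n::finite rtree \<Rightarrow> bool list \<Rightarrow> 'n \<Rightarrow> real set" where
  "cell_side R t p m = {u \<in> {-R..R}. \<forall>k<length p. \<forall>s. split_at t (take k p) = Some (m, s) \<longrightarrow> right_side (p ! k) u s}"

text \<open>Length is taken as Lebesgue measure: additivity at a split is then additivity of the
  measure, whichever endpoints belong to the interval, and measurability in the tree follows from
  measurability of sections.\<close>

definition cell_width :: "real \<Rightarrow> 'n::finite rtree \<Rightarrow> bool list \<Rightarrow> 'n \<Rightarrow> real" where
  "cell_width R t p m = measure lborel (cell_side R t p m)"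

lemma cell_side_interval:
  assumes "u \<in> cell_side R t p m" "v \<in> cell_side R t p m"
  shows "{u..v} \<subseteq> cell_side R t p m"
  using assms by (fastforce simp: cell_side_def right_side_def split: if_splits)

lemma cell_side_borel [measurable]: "cell_side R t p m \<in> sets borel"
proof (intro real_interval_borel_measurable is_interval_1[THEN iffD2] ballI allI impI)
  fix a b x assume "a \<in> cell_side R t p m" "b \<in> cell_side R t p m" "a \<le> x \<and> x \<le> b"
  then show "x \<in> cell_side R t p m" using cell_side_interval[of a R t p m b] by auto
qed

lemma cell_side_subset: "cell_side R t p m \<subseteq> {-R..R}"
  by (auto simp: cell_side_def)

lemma emeasure_cell_side_finite: "emeasure lborel (cell_side R t p m) < \<infinity>"
proof -
  have "emeasure lborel (cell_side R t p m) \<le> emeasure lborel (cbox (-R) R)"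
    using cell_side_subset[of R t p m] by (intro emeasure_mono) (simp_all add: cbox_interval)
  also have "\<dots> < \<infinity>" by (rule emeasure_lborel_cbox_finite)
  finally show ?thesis .
qed

lemma cell_side_fmeasurable: "cell_side R t p m \<in> fmeasurable lborel"
  using emeasure_cell_side_finite[of R t p m] by (intro fmeasurableI) (simp_all add: cell_side_borel)

lemma cell_width_nonneg [simp]: "0 \<le> cell_width R t p m"
  by (simp add: cell_width_def)

lemma cell_width_le:
  assumes "0 \<le> R"
  shows "cell_width R t p m \<le> 2 * R"
proof -
  have "cell_width R t p m \<le> measure lborel (cbox (-R) R)"
    unfolding cell_width_def using cell_side_subset[of R t p m]
    by (intro measure_mono_fmeasurable fmeasurableI emeasure_lborel_cbox_finite) (simp_all add: cbox_interval)
  also have "\<dots> = 2 * R" using assms by (simp add: cbox_interval)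
  finally show ?thesis .
qed

text \<open>The side is an interval that contains both coordinates, hence also the segment between
  them.\<close>

lemma dist_le_cell_width:
  assumes "x \<in> region t p" "x' \<in> region t p" "\<bar>x $ m\<bar> \<le> R" "\<bar>x' $ m\<bar> \<le> R"
  shows "\<bar>x $ m - x' $ m\<bar> \<le> cell_width R t p m"
proof -
  have *: "x $ m \<in> cell_side R t p m" "x' $ m \<in> cell_side R t p m"
    using assms by (fastforce simp: cell_side_def region_iff abs_le_iff)+
  have le: "b - a \<le> cell_width R t p m" if "a \<in> cell_side R t p m" "b \<in> cell_side R t p m" for a b
  proof (cases "a \<le> b")
    case True
    then have "b - a = measure lborel {a..b}" by simp
    also have "\<dots> \<le> cell_width R t p m"
      unfolding cell_width_def using cell_side_interval[OF that]
      by (intro measure_mono_fmeasurable cell_side_fmeasurable) auto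
    finally show ?thesis .
  qed (simp add: order_trans[OF _ cell_width_nonneg])
  show ?thesis using le[OF *] le[OF *(2,1)] by linarith
qed

lemma cell_side_snoc:
  "cell_side R t (p @ [c]) m =
     {u \<in> cell_side R t p m. \<forall>s. split_at t p = Some (m, s) \<longrightarrow> right_side c u s}"
  by (auto simp: cell_side_def All_less_Suc nth_append)

lemma cell_width_snoc_le: "cell_width R t (p @ [c]) m \<le> cell_width R t p m"
  unfolding cell_width_def
  by (intro measure_mono_fmeasurable cell_side_fmeasurable fmeasurableD[OF cell_side_fmeasurable])
    (auto simp: cell_side_snoc)

lemma cell_width_split:
  assumes "split_at t p = Some (m, s)"
  shows "cell_width R t (p @ [True]) m + cell_width R t (p @ [False]) m = cell_width R t p m"
proof -
  have "cell_side R t p m = cell_side R t (p @ [True]) m \<union> cell_side R t (p @ [False]) m"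
    by (auto simp: cell_side_snoc assms right_side_def)
  moreover have "measure lborel (cell_side R t (p @ [True]) m \<union> cell_side R t (p @ [False]) m)
      = cell_width R t (p @ [True]) m + cell_width R t (p @ [False]) m"
    unfolding cell_width_def
    by (intro measure_Un_AE cell_side_fmeasurable AE_I2) (auto simp: cell_side_snoc assms right_side_def)
  ultimately show ?thesis by (simp add: cell_width_def)
qed

text \<open>Three cases are packed into the bracket. At an unsplit address both child counts vanish.
  A split along another coordinate preserves the total count and does not increase the width. A
  split along \<open>m\<close> divides the width, and neither child has more than the fraction
  \<open>1 - g\<close> of the points.\<close>

lemma count_width_split:
  fixes m :: "'n::finite"
  assumes I: "finite I" and bal: "balanced g I x t" "g > 0"
  shows "(\<Sum>c\<in>UNIV. real (node_count I x t (p @ [c])) * cell_width R t (p @ [c]) m)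
    \<le> real (node_count I x t p) * cell_width R t p m *
        (of_bool (split_at t p \<noteq> None) - g * of_bool (\<exists>s. split_at t p = Some (m, s)))"
    (is "?L \<le> _")
proof -
  let ?N = "\<lambda>c. real (node_count I x t (p @ [c]))" and ?w = "\<lambda>c. cell_width R t (p @ [c]) m"
  let ?n = "real (node_count I x t p)" and ?v = "cell_width R t p m"
  have L: "?L = ?N True * ?w True + ?N False * ?w False" by (simp add: UNIV_bool)
  show ?thesis
  proof (cases "split_at t p")
    case None
    then show ?thesis by (simp add: L node_count_unsplit)
  next
    case (Some a)
    obtain m' s where a: "a = (m', s)" by force
    have N: "?N True + ?N False = ?n"
      using node_count_split[OF I, of t p x] Some by (metis of_nat_add option.distinct(1))
    show ?thesis
    proof (cases "m' = m")
      case True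
      have g: "?N c \<ge> g * ?n" for c using balanced_node_count_ge[OF bal, of p] Some by simp
      \<comment> \<open>The upper bound for one child is the lower balance bound for its
        sibling.\<close>
      have "?N c \<le> (1 - g) * ?n" for c
        using g[of "\<not> c"] N by (cases c) (auto simp: algebra_simps)
      then have "?L \<le> (1 - g) * ?n * ?w True + (1 - g) * ?n * ?w False"
        unfolding L by (intro add_mono mult_right_mono) auto
      also have "\<dots> = (1 - g) * ?n * (?w True + ?w False)" by (simp add: algebra_simps)
      also have "?w True + ?w False = ?v" using cell_width_split Some a True by blast
      finally show ?thesis using Some a True by (simp add: algebra_simps)
    next
      case False
      have "?L \<le> ?N True * ?v + ?N False * ?v"
        unfolding L by (intro add_mono mult_left_mono cell_width_snoc_le) auto
      also have "\<dots> = ?n * ?v" unfolding N[symmetric] by (simp add: algebra_simps)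
      finally show ?thesis using Some a False by simp
    qed
  qed
qed

lemma right_side_neg: "right_side (\<not> c) u s \<longleftrightarrow> \<not> right_side c u s"
  by (auto simp: right_side_def)

text \<open>The width is the measure of a section of a measurable subset of the product with the
  line. Only the splits along \<open>m\<close> at proper ancestors enter, so the width is known from
  the split history of \<open>p\<close>.\<close>

lemma cell_width_measurable:
  fixes T :: "'a \<Rightarrow> 'n::finite rtree"
  assumes *: "\<And>k a. k < length p \<Longrightarrow>
      Measurable.pred N (\<lambda>w. \<exists>s\<le>a. split_at (T w) (take k p) = Some (m, s))"
  shows "(\<lambda>w. cell_width R (T w) p m) \<in> borel_measurable N"
proof -
  \<comment> \<open>The condition quantifies over all thresholds; writing it as the absence of a
    threshold with \<open>u\<close> on the opposite side brings it into the existential form of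
    \<open>pred_right_side\<close>.\<close>
  have 1: "Measurable.pred (N \<Otimes>\<^sub>M lborel) (\<lambda>z. \<exists>s. split_at (T (fst z)) (take k p) = Some (m, s)
      \<and> right_side (\<not> p ! k) (snd z) s)" if "k < length p" for k
    using that by (intro pred_right_side measurable_compose[OF measurable_fst *]) auto
  have "Measurable.pred (N \<Otimes>\<^sub>M lborel) (\<lambda>z. snd z \<in> {-R..R} \<and>
    (\<forall>k\<in>{..<length p}. \<not> (\<exists>s. split_at (T (fst z)) (take k p) = Some (m, s)
      \<and> right_side (\<not> p ! k) (snd z) s)))"
    using 1 by measurable
  also have "(\<lambda>z. snd z \<in> {-R..R} \<and>
    (\<forall>k\<in>{..<length p}. \<not> (\<exists>s. split_at (T (fst z)) (take k p) = Some (m, s)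
      \<and> right_side (\<not> p ! k) (snd z) s))) = (\<lambda>z. snd z \<in> cell_side R (T (fst z)) p m)"
    by (auto simp: cell_side_def fun_eq_iff right_side_neg)
  finally have Q: "{z \<in> space (N \<Otimes>\<^sub>M lborel). snd z \<in> cell_side R (T (fst z)) p m} \<in> sets (N \<Otimes>\<^sub>M lborel)"
    by (simp add: pred_def)
  have "Pair w -` {z \<in> space (N \<Otimes>\<^sub>M lborel). snd z \<in> cell_side R (T (fst z)) p m} = cell_side R (T w) p m"
    if "w \<in> space N" for w using that by (auto simp: space_pair_measure)
  then have "(\<lambda>w. emeasure lborel (cell_side R (T w) p m)) \<in> borel_measurable N"
    by (intro measurable_cong[THEN iffD1, OF _ lborel.measurable_emeasure_Pair[OF Q]]) simp
  then show ?thesis unfolding cell_width_def measure_def by measurable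
qed

section \<open>The support of a measure\<close>

lemma closed_measure_support: "closed (measure_support N)"
proof -
  have "- measure_support N = \<Union>{U. open U \<and> emeasure N U = 0}"
    by (auto simp: measure_support_def not_less)
  then show ?thesis unfolding closed_def by auto
qed

text \<open>By second countability the complement of the support is covered by countably many basic
  open null sets.\<close>

lemma AE_measure_support:
  fixes N :: "'a::second_countable_topology measure"
  assumes "sets N = sets borel"
  shows "AE x in N. x \<in> measure_support N"
proof -
  obtain \<B> :: "'a set set" where \<B>: "countable \<B>" "\<And>C. C \<in> \<B> \<Longrightarrow> open C"
      "\<And>S. open S \<Longrightarrow> \<exists>U. U \<subseteq> \<B> \<and> S = \<Union>U"
    by (metis univ_second_countable)
  have "(\<Union>C\<in>{C \<in> \<B>. emeasure N C = 0}. C) \<in> null_sets N"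
    using \<B>(1,2) assms by (intro null_sets_UN') (auto intro!: null_setsI)
  then show ?thesis
  proof (rule AE_I')
    show "{x \<in> space N. x \<notin> measure_support N} \<subseteq> (\<Union>C\<in>{C \<in> \<B>. emeasure N C = 0}. C)"
    proof safe
      fix x assume "x \<notin> measure_support N"
      then obtain U where U: "open U" "x \<in> U" "emeasure N U = 0"
        by (auto simp: measure_support_def not_less)
      then obtain C where C: "C \<in> \<B>" "x \<in> C" "C \<subseteq> U" using \<B>(3)[of U] by blast
      then have "emeasure N C \<le> emeasure N U"
        using assms U by (intro emeasure_mono) auto
      then show "x \<in> (\<Union>C\<in>{C \<in> \<B>. emeasure N C = 0}. C)" using C U by auto
    qed
  qed
qed

section \<open>Comparing the law and the empirical measure of a cell\<close>

definition grid_index :: "real \<Rightarrow> real ^ 'n \<Rightarrow> 'n \<Rightarrow> int" where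
  "grid_index \<delta> x m = \<lfloor>x $ m / \<delta>\<rfloor>"

lemma pred_grid_index [measurable]: "Measurable.pred borel (\<lambda>x::real^'n. grid_index \<delta> x = k)"
  unfolding fun_eq_iff grid_index_def by measurable

lemma grid_slab_borel [measurable]: "{x :: real^'n. grid_index \<delta> x m = k} \<in> sets borel"
proof -
  have "Measurable.pred borel (\<lambda>x::real^'n. grid_index \<delta> x m = k)"
    unfolding grid_index_def by measurable
  then show ?thesis by (simp add: pred_def)
qed

lemma grid_cube_borel [measurable]: "{x :: real^'n. grid_index \<delta> x = k} \<in> sets borel"
  using pred_grid_index by (simp add: pred_def)

lemma region_borel [measurable]: "region t p \<in> sets borel"
proof -
  have "Measurable.pred borel (\<lambda>x. x \<in> region t p)"
    by (intro pred_in_region measurable_const) auto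
  then show ?thesis by (simp add: pred_def)
qed

text \<open>Two points of one cube are separated by a cell only if the threshold of some ancestor
  lies between their coordinates; the cube then belongs to the slab of that threshold.\<close>

lemma region_grid_boundary:
  fixes x x' :: "real ^ 'n::finite"
  assumes "0 < \<delta>" "x \<in> region t p" "x' \<notin> region t p" "grid_index \<delta> x' = grid_index \<delta> x"
  shows "\<exists>j<length p. \<exists>m s. split_at t (take j p) = Some (m, s) \<and> grid_index \<delta> x m = \<lfloor>s / \<delta>\<rfloor>"
proof -
  obtain j m s where j: "j < length p" "split_at t (take j p) = Some (m, s)"
      "right_side (p ! j) (x $ m) s" "\<not> right_side (p ! j) (x' $ m) s"
    using assms(2,3) unfolding region_iff by fastforce
  have eq: "\<lfloor>x' $ m / \<delta>\<rfloor> = \<lfloor>x $ m / \<delta>\<rfloor>"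
    using fun_cong[OF assms(4), of m] by (simp add: grid_index_def)
  have "(x $ m \<le> s \<and> s \<le> x' $ m) \<or> (x' $ m \<le> s \<and> s \<le> x $ m)"
    using j(3,4) by (auto simp: right_side_def split: if_splits)
  then have "\<lfloor>x $ m / \<delta>\<rfloor> = \<lfloor>s / \<delta>\<rfloor>"
  proof
    assume "x $ m \<le> s \<and> s \<le> x' $ m"
    then have "\<lfloor>x $ m / \<delta>\<rfloor> \<le> \<lfloor>s / \<delta>\<rfloor>" "\<lfloor>s / \<delta>\<rfloor> \<le> \<lfloor>x' $ m / \<delta>\<rfloor>"
      using assms(1) by (auto intro!: floor_mono divide_right_mono)
    then show ?thesis using eq by linarith
  next
    assume "x' $ m \<le> s \<and> s \<le> x $ m"
    then have "\<lfloor>x' $ m / \<delta>\<rfloor> \<le> \<lfloor>s / \<delta>\<rfloor>" "\<lfloor>s / \<delta>\<rfloor> \<le> \<lfloor>x $ m / \<delta>\<rfloor>"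
      using assms(1) by (auto intro!: floor_mono divide_right_mono)
    then show ?thesis using eq by linarith
  qed
  then show ?thesis using j by (auto simp: grid_index_def)
qed

text \<open>A deterministic inequality, valid for all points and all trees, hence also for a tree
  grown from these points. Cubes inside the cell are counted by their frequencies; what remains of
  the cell lies in at most one slab per ancestor.\<close>

lemma measure_region_le:
  fixes \<mu> :: "(real ^ 'n::finite) measure" and x :: "nat \<Rightarrow> real ^ 'n"
  assumes \<mu>: "prob_space \<mu>" and [measurable_cong]: "sets \<mu> = sets borel"
    and \<delta>: "0 < \<delta>" and G: "finite G" "AE x in \<mu>. grid_index \<delta> x \<in> G"
    and slab: "\<And>m k. measure \<mu> {x. grid_index \<delta> x m = k} \<le> \<epsilon>" and I: "finite I"
  shows "measure \<mu> (region t p) \<le> real (node_count I x t p) / real (card I)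
    + (\<Sum>k\<in>G. \<bar>(\<Sum>i\<in>I. indicat_real {x. grid_index \<delta> x = k} (x i)) / real (card I)
              - measure \<mu> {x. grid_index \<delta> x = k}\<bar>) + real (length p) * \<epsilon>"
proof -
  interpret prob_space \<mu> by fact
  define C where "C k = {x :: real ^ 'n. grid_index \<delta> x = k}" for k
  \<comment> \<open>The slab of the threshold used by the \<open>j\<close>-th ancestor, empty if
    that ancestor is missing.\<close>
  define S where "S j = {x :: real ^ 'n. case split_at t (take j p) of None \<Rightarrow> False
      | Some (m, s) \<Rightarrow> grid_index \<delta> x m = \<lfloor>s / \<delta>\<rfloor>}" for j
  \<comment> \<open>The cubes contained in the cell: they are disjoint, so their frequencies sum to
    at most the frequency of the cell.\<close>
  define G' where "G' = {k \<in> G. C k \<subseteq> region t p}"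
  define E where "E k = (\<Sum>i\<in>I. indicat_real (C k) (x i)) / real (card I)" for k
  have [measurable]: "C k \<in> sets borel" for k by (simp add: C_def)
  have [measurable]: "S j \<in> sets borel" for j unfolding S_def by (cases "split_at t (take j p)") auto
  have S: "prob (S j) \<le> \<epsilon>" for j
    unfolding S_def using slab order_trans[OF measure_nonneg slab] by (cases "split_at t (take j p)") auto
  have finG': "finite G'" "G' \<subseteq> G" using G by (auto simp: G'_def)
  have "prob (region t p) \<le> prob ((\<Union>k\<in>G'. C k) \<union> (\<Union>j<length p. S j))"
  proof (rule finite_measure_mono_AE)
    show "AE x in \<mu>. x \<in> region t p \<longrightarrow> x \<in> (\<Union>k\<in>G'. C k) \<union> (\<Union>j<length p. S j)"
      using G(2)
    proof eventually_elim
      case (elim x)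
      show ?case
      proof
        assume x: "x \<in> region t p"
        show "x \<in> (\<Union>k\<in>G'. C k) \<union> (\<Union>j<length p. S j)"
        proof (cases "C (grid_index \<delta> x) \<subseteq> region t p")
          case True
          then show ?thesis using elim by (auto simp: G'_def C_def)
        next
          case False
          then obtain x' where "x' \<notin> region t p" "grid_index \<delta> x' = grid_index \<delta> x"
            by (auto simp: C_def)
          from region_grid_boundary[OF \<delta> x this] show ?thesis
            by (fastforce simp: S_def)
        qed
      qed
    qed
  qed (use finG' in measurable)
  also have "\<dots> \<le> prob (\<Union>k\<in>G'. C k) + prob (\<Union>j<length p. S j)"
    using finG' by (intro measure_Un_le) measurable
  also have "prob (\<Union>j<length p. S j) \<le> (\<Sum>j<length p. prob (S j))"
    by (intro finite_measure_subadditive_finite) auto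
  also have "\<dots> \<le> (\<Sum>j<length p. \<epsilon>)" by (intro sum_mono S)
  also have "\<dots> = real (length p) * \<epsilon>" by simp
  also have "prob (\<Union>k\<in>G'. C k) \<le> (\<Sum>k\<in>G'. prob (C k))"
    using finG' by (intro finite_measure_subadditive_finite) auto
  also have "\<dots> \<le> (\<Sum>k\<in>G'. E k + \<bar>E k - prob (C k)\<bar>)"
    by (intro sum_mono) linarith
  also have "\<dots> = (\<Sum>k\<in>G'. E k) + (\<Sum>k\<in>G'. \<bar>E k - prob (C k)\<bar>)" by (rule sum.distrib)
  also have "(\<Sum>k\<in>G'. \<bar>E k - prob (C k)\<bar>) \<le> (\<Sum>k\<in>G. \<bar>E k - prob (C k)\<bar>)"
    using finG' G by (intro sum_mono2) auto
  also have "(\<Sum>k\<in>G'. E k) \<le> real (node_count I x t p) / real (card I)"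
  proof -
    have "(\<Sum>k\<in>G'. E k) = (\<Sum>i\<in>I. \<Sum>k\<in>G'. indicat_real (C k) (x i)) / real (card I)"
      unfolding E_def by (simp add: sum_divide_distrib[symmetric] sum.swap[of _ I])
    also have "(\<Sum>k\<in>G'. indicat_real (C k) u) = indicat_real (\<Union>k\<in>G'. C k) u" for u
      using finG' by (subst indicator_UN_disjoint) (auto simp: disjoint_family_on_def C_def)
    then have "(\<Sum>i\<in>I. \<Sum>k\<in>G'. indicat_real (C k) (x i)) \<le> (\<Sum>i\<in>I. indicat_real (region t p) (x i))"
      by (intro sum_mono) (auto simp: G'_def indicator_def)
    also have "\<dots> = real (node_count I x t p)" by (rule node_count_eq_sum[OF I, symmetric])
    finally show ?thesis by (simp add: divide_right_mono)
  qed
  finally show ?thesis by (simp add: C_def E_def)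
qed

text \<open>Inside the bounding box a slab of thickness \<delta> has volume \<delta> times the
  volume of a face, and the density is at most \<open>c\<close> there. The bound on \<open>f\<close>
  is needed only on a set \<open>A\<close> of full measure, which will be the support.\<close>

lemma grid_slab_le:
  fixes f :: "real ^ 'n::finite \<Rightarrow> real"
  assumes \<mu>: "\<mu> = density lborel (\<lambda>x. ennreal (f x))" and f: "f \<in> borel_measurable borel"
    and A: "AE x in \<mu>. x \<in> A" "A \<in> sets borel" "\<And>x m. x \<in> A \<Longrightarrow> \<bar>x $ m\<bar> \<le> R" "\<And>x. x \<in> A \<Longrightarrow> f x \<le> c"
    and nn: "0 \<le> c" "0 < \<delta>" "0 \<le> R" and fin: "finite_measure \<mu>"
  shows "measure \<mu> {x. grid_index \<delta> x m = k} \<le> c * (\<delta> * (2 * R) ^ (CARD('n) - 1))"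
proof -
  interpret finite_measure \<mu> by fact
  have [measurable_cong]: "sets \<mu> = sets borel" by (simp add: \<mu>)
  note [measurable] = f A(2)
  define Q where "Q = cbox (\<chi> i. if i = m then of_int k * \<delta> else - R) (\<chi> i. if i = m then (of_int k + 1) * \<delta> else R)"
  let ?S = "{x. grid_index \<delta> x m = k}"
  have sub: "x \<in> Q" if "x \<in> ?S" "x \<in> A" for x
  proof -
    have "of_int k \<le> x $ m / \<delta> \<and> x $ m / \<delta> < of_int k + 1"
      using that(1) by (simp add: grid_index_def floor_eq_iff)
    then have "of_int k * \<delta> \<le> x $ m \<and> x $ m \<le> (of_int k + 1) * \<delta>"
      using nn by (simp add: field_simps)
    moreover have "- R \<le> x $ i \<and> x $ i \<le> R" for i using A(3)[OF that(2), of i] by linarith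
    ultimately show ?thesis by (auto simp: Q_def mem_box_cart)
  qed
  have "emeasure \<mu> ?S \<le> emeasure \<mu> (?S \<inter> A)"
    using A(1) by (intro emeasure_mono_AE) auto
  also have "\<dots> = (\<integral>\<^sup>+x\<in>?S \<inter> A. ennreal (f x) \<partial>lborel)"
    unfolding \<mu> by (intro emeasure_density) auto
  also have "\<dots> \<le> (\<integral>\<^sup>+x. ennreal c * indicator Q x \<partial>lborel)"
    using sub A(4) by (intro nn_integral_mono) (auto simp: indicator_def intro!: ennreal_leI)
  also have "\<dots> = ennreal c * emeasure lborel Q"
    by (simp add: nn_integral_cmult_indicator Q_def)
  also have "emeasure lborel Q = ennreal (measure lborel Q)"
    unfolding Q_def by (intro emeasure_eq_ennreal_measure) (simp add: emeasure_lborel_cbox_eq)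
  also have "measure lborel Q = (\<Prod>i\<in>UNIV. if i = m then \<delta> else 2 * R)"
  proof -
    have "Q \<noteq> {}" unfolding Q_def using nn by (auto simp: interval_ne_empty_cart algebra_simps)
    then show ?thesis unfolding Q_def
      by (subst content_cbox_cart) (simp_all add: if_distrib algebra_simps cong: if_cong prod.cong)
  qed
  also have "\<dots> = \<delta> * (2 * R) ^ (CARD('n) - 1)"
    by (subst prod.remove[of _ m]) (auto intro!: prod.cong simp: card_Diff_singleton)
  also have "ennreal c * ennreal (\<delta> * (2 * R) ^ (CARD('n) - 1)) = ennreal (c * (\<delta> * (2 * R) ^ (CARD('n) - 1)))"
    using nn by (simp add: ennreal_mult')
  finally show ?thesis
    using nn by (simp add: emeasure_eq_measure ennreal_le_iff)
qed

lemma finite_grid_index: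
  assumes "0 < \<delta>"
  shows "finite (grid_index \<delta> ` {x :: real ^ 'n::finite. \<forall>m. \<bar>x $ m\<bar> \<le> R})"
proof (rule finite_subset)
  show "grid_index \<delta> ` {x :: real ^ 'n. \<forall>m. \<bar>x $ m\<bar> \<le> R} \<subseteq> Pi\<^sub>E UNIV (\<lambda>_. {\<lfloor>- R / \<delta>\<rfloor>..\<lfloor>R / \<delta>\<rfloor>})"
  proof safe
    fix x :: "real ^ 'n" and m assume "\<forall>m. \<bar>x $ m\<bar> \<le> R"
    then have "- R \<le> x $ m" "x $ m \<le> R" by (auto simp: abs_le_iff) (metis minus_le_iff)
    then have "- R / \<delta> \<le> x $ m / \<delta>" "x $ m / \<delta> \<le> R / \<delta>"
      using assms by (intro divide_right_mono; simp)+
    then show "grid_index \<delta> x m \<in> {\<lfloor>- R / \<delta>\<rfloor>..\<lfloor>R / \<delta>\<rfloor>}"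
      unfolding grid_index_def atLeastAtMost_iff by (intro conjI floor_mono)
  qed auto
qed (auto intro!: finite_PiE)

section \<open>Probabilistic tools\<close>

text \<open>Expresses independence as a product law, the form needed for Fubini.\<close>

lemma (in prob_space) indep_rv_distr:
  assumes "indep_rv M N U N' V"
  shows "distr M (N \<Otimes>\<^sub>M N') (\<lambda>\<omega>. (U \<omega>, V \<omega>)) = distr M N U \<Otimes>\<^sub>M distr M N' V"
proof -
  have [measurable]: "U \<in> M \<rightarrow>\<^sub>M N" "V \<in> M \<rightarrow>\<^sub>M N'"
    and ind: "indep_set {U -` A \<inter> space M |A. A \<in> sets N} {V -` A \<inter> space M |A. A \<in> sets N'}"
    using assms by (auto simp: indep_rv_def)
  interpret U: prob_space "distr M N U" by (rule prob_space_distr) simp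
  interpret V: prob_space "distr M N' V" by (rule prob_space_distr) simp
  show ?thesis
  proof (rule pair_measure_eqI[symmetric])
    fix A C assume "A \<in> sets (distr M N U)" "C \<in> sets (distr M N' V)"
    then have [measurable]: "A \<in> sets N" "C \<in> sets N'" by auto
    have "prob ((U -` A \<inter> space M) \<inter> (V -` C \<inter> space M))
        = prob (U -` A \<inter> space M) * prob (V -` C \<inter> space M)"
      by (intro indep_setD[OF ind]) auto
    moreover have "(\<lambda>\<omega>. (U \<omega>, V \<omega>)) -` (A \<times> C) \<inter> space M = (U -` A \<inter> space M) \<inter> (V -` C \<inter> space M)"
      by auto
    ultimately show "emeasure (distr M N U) A * emeasure (distr M N' V) C
        = emeasure (distr M (N \<Otimes>\<^sub>M N') (\<lambda>\<omega>. (U \<omega>, V \<omega>))) (A \<times> C)"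
      by (simp add: emeasure_distr emeasure_eq_measure ennreal_mult'')
  qed (simp_all add: U.sigma_finite_measure_axioms V.sigma_finite_measure_axioms cong: sets_pair_measure_cong)
qed

lemma (in prob_space) indep_rv_compose:
  assumes "indep_rv M N U N' V" and f: "f \<in> N \<rightarrow>\<^sub>M L" and g: "g \<in> N' \<rightarrow>\<^sub>M L'"
  shows "indep_rv M L (\<lambda>\<omega>. f (U \<omega>)) L' (\<lambda>\<omega>. g (V \<omega>))"
proof -
  have UV: "U \<in> M \<rightarrow>\<^sub>M N" "V \<in> M \<rightarrow>\<^sub>M N'"
    and ind: "indep_set {U -` A \<inter> space M |A. A \<in> sets N} {V -` A \<inter> space M |A. A \<in> sets N'}"
    using assms by (auto simp: indep_rv_def)
  have *: "{(\<lambda>\<omega>. h (W \<omega>)) -` A \<inter> space M |A. A \<in> sets R} \<subseteq> {W -` A \<inter> space M |A. A \<in> sets Q}"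
    if h: "h \<in> Q \<rightarrow>\<^sub>M R" and W: "W \<in> M \<rightarrow>\<^sub>M Q" for h W R Q
  proof safe
    fix A assume "A \<in> sets R"
    then have "h -` A \<inter> space Q \<in> sets Q" using h by (rule measurable_sets[rotated])
    moreover have "(\<lambda>\<omega>. h (W \<omega>)) -` A \<inter> space M = W -` (h -` A \<inter> space Q) \<inter> space M"
      using measurable_space[OF W] by auto
    ultimately show "\<exists>C. (\<lambda>\<omega>. h (W \<omega>)) -` A \<inter> space M = W -` C \<inter> space M \<and> C \<in> sets Q"
      by (intro exI[of _ "h -` A \<inter> space Q"] conjI)
  qed
  have "indep_set {(\<lambda>\<omega>. f (U \<omega>)) -` A \<inter> space M |A. A \<in> sets L} {(\<lambda>\<omega>. g (V \<omega>)) -` A \<inter> space M |A. A \<in> sets L'}"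
    using ind unfolding indep_set_def
    by (rule indep_sets_mono_sets) (use *[OF f UV(1)] *[OF g UV(2)] in \<open>simp split: bool.split\<close>)
  then show ?thesis using measurable_compose[OF UV(1) f] measurable_compose[OF UV(2) g]
    by (simp add: indep_rv_def)
qed

text \<open>Independence supplies the forest randomness against the pair of training data and a
  further point, whereas the forest is a function of training data and randomness. The regrouping
  makes the forest one factor and the further point the other.\<close>

lemma pair_measure_rotate:
  assumes A: "prob_space A" and B: "prob_space B" and C: "prob_space C"
  shows "distr (A \<Otimes>\<^sub>M (B \<Otimes>\<^sub>M C)) ((B \<Otimes>\<^sub>M A) \<Otimes>\<^sub>M C) (\<lambda>(a, b, c). ((b, a), c)) = (B \<Otimes>\<^sub>M A) \<Otimes>\<^sub>M C"
proof -
  interpret A: prob_space A by fact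
  interpret B: prob_space B by fact
  interpret C: prob_space C by fact
  interpret BA: pair_prob_space B A ..
  interpret BC: pair_prob_space B C ..
  show ?thesis
  proof (rule pair_measure_eqI[symmetric])
    fix Z W assume [measurable]: "Z \<in> sets (B \<Otimes>\<^sub>M A)" "W \<in> sets C"
    have "emeasure (distr (A \<Otimes>\<^sub>M (B \<Otimes>\<^sub>M C)) ((B \<Otimes>\<^sub>M A) \<Otimes>\<^sub>M C) (\<lambda>(a, b, c). ((b, a), c))) (Z \<times> W)
       = (\<integral>\<^sup>+z. indicator (Z \<times> W) z \<partial>distr (A \<Otimes>\<^sub>M (B \<Otimes>\<^sub>M C)) ((B \<Otimes>\<^sub>M A) \<Otimes>\<^sub>M C) (\<lambda>(a, b, c). ((b, a), c)))"
      by simp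
    also have "\<dots> = (\<integral>\<^sup>+(a,b,c). indicator Z (b, a) * indicator W c \<partial>(A \<Otimes>\<^sub>M (B \<Otimes>\<^sub>M C)))"
      by (subst nn_integral_distr) (simp_all add: case_prod_unfold indicator_times)
    also have "\<dots> = (\<integral>\<^sup>+a. \<integral>\<^sup>+b. \<integral>\<^sup>+c. indicator Z (b, a) * indicator W c \<partial>C \<partial>B \<partial>A)"
    proof -
      have "(\<integral>\<^sup>+(a,b,c). indicator Z (b, a) * indicator W c \<partial>(A \<Otimes>\<^sub>M (B \<Otimes>\<^sub>M C)))
        = (\<integral>\<^sup>+a. \<integral>\<^sup>+z. indicator Z (fst z, a) * indicator W (snd z) \<partial>(B \<Otimes>\<^sub>M C) \<partial>A)"
        by (subst BC.nn_integral_fst[symmetric]) (simp_all add: case_prod_beta)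
      also have "(\<integral>\<^sup>+z. indicator Z (fst z, a) * indicator W (snd z) \<partial>(B \<Otimes>\<^sub>M C))
        = (\<integral>\<^sup>+b. \<integral>\<^sup>+c. indicator Z (b, a) * indicator W c \<partial>C \<partial>B)" if "a \<in> space A" for a
        using that by (subst C.nn_integral_fst[symmetric]) simp_all
      then have "(\<integral>\<^sup>+a. \<integral>\<^sup>+z. indicator Z (fst z, a) * indicator W (snd z) \<partial>(B \<Otimes>\<^sub>M C) \<partial>A)
        = (\<integral>\<^sup>+a. \<integral>\<^sup>+b. \<integral>\<^sup>+c. indicator Z (b, a) * indicator W c \<partial>C \<partial>B \<partial>A)"
        by (intro nn_integral_cong)
      finally show ?thesis .
    qed
    also have "\<dots> = (\<integral>\<^sup>+a. \<integral>\<^sup>+b. indicator Z (b, a) * emeasure C W \<partial>B \<partial>A)"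
      by (intro nn_integral_cong) (simp add: nn_integral_cmult)
    also have "\<dots> = (\<integral>\<^sup>+a. (\<integral>\<^sup>+b. indicator Z (b, a) \<partial>B) * emeasure C W \<partial>A)"
      by (intro nn_integral_cong nn_integral_multc) measurable
    also have "\<dots> = (\<integral>\<^sup>+a. (\<integral>\<^sup>+b. indicator Z (b, a) \<partial>B) \<partial>A) * emeasure C W"
      by (intro nn_integral_multc) measurable
    also have "(\<integral>\<^sup>+a. (\<integral>\<^sup>+b. indicator Z (b, a) \<partial>B) \<partial>A) = emeasure (B \<Otimes>\<^sub>M A) Z"
      by (subst BA.nn_integral_snd) simp_all
    finally show "emeasure (B \<Otimes>\<^sub>M A) Z * emeasure C W
      = emeasure (distr (A \<Otimes>\<^sub>M (B \<Otimes>\<^sub>M C)) ((B \<Otimes>\<^sub>M A) \<Otimes>\<^sub>M C) (\<lambda>(a, b, c). ((b, a), c))) (Z \<times> W)" ..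
  qed (simp_all add: BA.sigma_finite_measure_axioms C.sigma_finite_measure_axioms)
qed

lemma (in prob_space) expectation_square_orthogonal_sum:
  fixes f :: "'i \<Rightarrow> 'a \<Rightarrow> real"
  assumes I: "finite I" and [measurable]: "\<And>i. i \<in> I \<Longrightarrow> f i \<in> borel_measurable M"
    and bd: "\<And>i x. i \<in> I \<Longrightarrow> x \<in> space M \<Longrightarrow> \<bar>f i x\<bar> \<le> c"
    and orth: "\<And>i j. i \<in> I \<Longrightarrow> j \<in> I \<Longrightarrow> i \<noteq> j \<Longrightarrow> expectation (\<lambda>x. f i x * f j x) = 0"
  shows "expectation (\<lambda>x. (\<Sum>i\<in>I. f i x)\<^sup>2) = (\<Sum>i\<in>I. expectation (\<lambda>x. (f i x)\<^sup>2))"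
proof -
  have int: "integrable M (\<lambda>x. f i x * f j x)" if "i \<in> I" "j \<in> I" for i j
  proof (rule integrable_const_bound[where B="c * c"])
    show "AE x in M. norm (f i x * f j x) \<le> c * c"
      using bd[OF that(1)] bd[OF that(2)] by (intro AE_I2) (auto simp: abs_mult intro!: mult_mono')
  qed (use that in measurable)
  have "expectation (\<lambda>x. (\<Sum>i\<in>I. f i x)\<^sup>2) = expectation (\<lambda>x. \<Sum>i\<in>I. \<Sum>j\<in>I. f i x * f j x)"
    by (simp add: power2_eq_square sum_product)
  also have "\<dots> = (\<Sum>i\<in>I. \<Sum>j\<in>I. expectation (\<lambda>x. f i x * f j x))"
  proof (subst Bochner_Integration.integral_sum)
    show "integrable M (\<lambda>x. \<Sum>j\<in>I. f i x * f j x)" if "i \<in> I" for i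
      using int that by (intro Bochner_Integration.integrable_sum)
    show "(\<Sum>i\<in>I. expectation (\<lambda>x. \<Sum>j\<in>I. f i x * f j x))
        = (\<Sum>i\<in>I. \<Sum>j\<in>I. expectation (\<lambda>x. f i x * f j x))"
      using int by (intro sum.cong refl Bochner_Integration.integral_sum)
  qed
  also have "\<dots> = (\<Sum>i\<in>I. \<Sum>j\<in>I. if i = j then expectation (\<lambda>x. (f i x)\<^sup>2) else 0)"
    using orth by (intro sum.cong refl) (auto simp: power2_eq_square)
  also have "\<dots> = (\<Sum>i\<in>I. expectation (\<lambda>x. (f i x)\<^sup>2))" using I by simp
  finally show ?thesis .
qed

text \<open>Nonnegativity of the variance of \<open>\<bar>f\<bar>\<close>.\<close>

lemma (in prob_space) expectation_abs_le_sqrt: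
  fixes f :: "'a \<Rightarrow> real"
  assumes [measurable]: "f \<in> borel_measurable M" and sq: "integrable M (\<lambda>x. (f x)\<^sup>2)"
  shows "expectation (\<lambda>x. \<bar>f x\<bar>) \<le> sqrt (expectation (\<lambda>x. (f x)\<^sup>2))"
proof -
  have int: "integrable M f" using square_integrable_imp_integrable[OF _ sq] by simp
  have "0 \<le> variance (\<lambda>x. \<bar>f x\<bar>)" by (rule variance_positive)
  also have "\<dots> = expectation (\<lambda>x. (f x)\<^sup>2) - (expectation (\<lambda>x. \<bar>f x\<bar>))\<^sup>2"
    using int sq by (subst variance_eq) auto
  finally show ?thesis by (intro real_le_rsqrt) simp
qed

text \<open>The centred indicators are bounded by 1 and pairwise uncorrelated, so their sum has
  second moment at most the number of terms. The rate is the same for every set \<open>A\<close>, so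
  finitely many grid cubes can be summed.\<close>

lemma (in prob_space) expectation_empirical_deviation:
  assumes I: "finite I" "I \<noteq> {}" and ind: "indep_vars (\<lambda>_. N) Z I"
    and law: "\<And>i. i \<in> I \<Longrightarrow> distr M N (Z i) = P" and A: "A \<in> sets N"
  shows "expectation (\<lambda>\<omega>. \<bar>(\<Sum>i\<in>I. indicat_real A (Z i \<omega>)) / real (card I) - measure P A\<bar>)
    \<le> 1 / sqrt (real (card I))"
proof -
  define n where "n = real (card I)"
  have n: "n > 0" using I by (auto simp: n_def card_gt_0_iff)
  have Z[measurable]: "Z i \<in> M \<rightarrow>\<^sub>M N" if "i \<in> I" for i using ind that by (auto simp: indep_vars_def)
  note [measurable] = A
  define \<xi> where "\<xi> i \<omega> = indicat_real A (Z i \<omega>) - measure P A" for i \<omega>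
  obtain i0 where i0: "i0 \<in> I" using I by auto
  interpret P: prob_space P using law[OF i0] prob_space_distr[OF Z[OF i0]] by simp
  have p: "0 \<le> measure P A" "measure P A \<le> 1" by auto
  have \<xi>[measurable]: "\<xi> i \<in> borel_measurable M" if "i \<in> I" for i using that unfolding \<xi>_def by measurable
  have bd: "\<bar>\<xi> i \<omega>\<bar> \<le> 1" for i \<omega> using p by (auto simp: \<xi>_def indicator_def)
  have int: "integrable M (\<xi> i)" if "i \<in> I" for i
    using that bd by (intro integrable_const_bound[where B=1]) auto
  have mean: "expectation (\<xi> i) = 0" if "i \<in> I" for i
  proof -
    have "expectation (\<lambda>\<omega>. indicat_real A (Z i \<omega>)) = (\<integral>z. indicat_real A z \<partial>distr M N (Z i))"
      using that by (subst integral_distr) auto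
    also have "\<dots> = measure P A" using that A sets.sets_into_space[OF A] law[OF that, symmetric]
      by (simp add: Int_absorb2)
    moreover have "integrable M (\<lambda>\<omega>. indicat_real A (Z i \<omega>))"
      using that by (intro integrable_const_bound[where B=1]) (auto simp: indicator_def)
    ultimately show ?thesis unfolding \<xi>_def by (simp add: prob_space)
  qed
  have "expectation (\<lambda>\<omega>. (\<Sum>i\<in>I. \<xi> i \<omega>)\<^sup>2) = (\<Sum>i\<in>I. expectation (\<lambda>\<omega>. (\<xi> i \<omega>)\<^sup>2))"
  proof (rule expectation_square_orthogonal_sum[where c=1])
    fix i j assume ij: "i \<in> I" "j \<in> I" "i \<noteq> j"
    have "indep_vars (\<lambda>_. borel) (\<lambda>i \<omega>. indicat_real A (Z i \<omega>) - measure P A) {i, j}"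
      using ij by (intro indep_vars_compose2[OF indep_vars_subset[OF ind]]) auto
    then have iv: "indep_vars (\<lambda>_. borel) \<xi> {i, j}" by (simp only: \<xi>_def[abs_def])
    have "expectation (\<lambda>\<omega>. \<Prod>k\<in>{i, j}. \<xi> k \<omega>) = (\<Prod>k\<in>{i, j}. expectation (\<xi> k))"
      using ij int by (intro indep_vars_lebesgue_integral iv) auto
    then show "expectation (\<lambda>\<omega>. \<xi> i \<omega> * \<xi> j \<omega>) = 0" using ij mean by simp
  qed (use I bd in auto)
  also have "\<dots> \<le> (\<Sum>i\<in>I. expectation (\<lambda>_. 1))"
    using bd by (intro sum_mono integral_mono integrable_const_bound[where B=1])
      (auto simp: abs_square_le_1)
  also have "\<dots> = n" by (simp add: n_def prob_space)
  finally have sq: "expectation (\<lambda>\<omega>. (\<Sum>i\<in>I. \<xi> i \<omega>)\<^sup>2) \<le> n" .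
  have "\<bar>\<Sum>i\<in>I. \<xi> i \<omega>\<bar> \<le> n" for \<omega>
  proof -
    have "\<bar>\<Sum>i\<in>I. \<xi> i \<omega>\<bar> \<le> (\<Sum>i\<in>I. \<bar>\<xi> i \<omega>\<bar>)" by (rule sum_abs)
    also have "\<dots> \<le> (\<Sum>i\<in>I. 1)" by (intro sum_mono bd)
    finally show ?thesis by (simp add: n_def)
  qed
  then have "(\<Sum>i\<in>I. \<xi> i \<omega>)\<^sup>2 \<le> n\<^sup>2" for \<omega>
    using n abs_le_square_iff[of "\<Sum>i\<in>I. \<xi> i \<omega>" n] by simp
  then have "integrable M (\<lambda>\<omega>. (\<Sum>i\<in>I. \<xi> i \<omega>)\<^sup>2)"
    using n by (intro integrable_const_bound[where B="n\<^sup>2"]) simp_all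
  then have "expectation (\<lambda>\<omega>. \<bar>\<Sum>i\<in>I. \<xi> i \<omega>\<bar>) \<le> sqrt n"
    using sq by (intro order_trans[OF expectation_abs_le_sqrt]) auto
  moreover have "(\<Sum>i\<in>I. indicat_real A (Z i \<omega>)) / n - measure P A = (\<Sum>i\<in>I. \<xi> i \<omega>) / n" for \<omega>
    using n by (simp add: \<xi>_def sum_subtractf n_def field_simps)
  ultimately have "expectation (\<lambda>\<omega>. \<bar>(\<Sum>i\<in>I. indicat_real A (Z i \<omega>)) / n - measure P A\<bar>) \<le> sqrt n / n"
    using n by (simp add: abs_div divide_right_mono)
  also have "\<dots> = 1 / sqrt n" using n by (simp add: real_div_sqrt field_simps)
  finally show ?thesis by (simp add: n_def)
qed

text \<open>Dominated convergence for indicators. It turns the almost sure conditions on leaf counts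
  into vanishing probabilities.\<close>

lemma (in prob_space) AE_eventually_imp_prob_tendsto_0:
  assumes [measurable]: "\<And>n. Measurable.pred M (P n)" and ae: "AE \<omega> in M. \<forall>\<^sub>F n in sequentially. \<not> P n \<omega>"
  shows "(\<lambda>n. prob {\<omega> \<in> space M. P n \<omega>}) \<longlonglongrightarrow> 0"
proof -
  have "(\<lambda>n. expectation (\<lambda>\<omega>. of_bool (P n \<omega>) :: real)) \<longlonglongrightarrow> expectation (\<lambda>_. 0)"
  proof (rule integral_dominated_convergence[where w="\<lambda>_. 1"])
    show "AE \<omega> in M. (\<lambda>n. of_bool (P n \<omega>) :: real) \<longlonglongrightarrow> 0"
      using ae by eventually_elim (auto intro!: tendsto_eventually elim: eventually_mono)
  qed auto
  moreover have "expectation (\<lambda>\<omega>. of_bool (P n \<omega>) :: real) = prob {\<omega> \<in> space M. P n \<omega>}" for n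
  proof -
    have "expectation (\<lambda>\<omega>. of_bool (P n \<omega>) :: real) = expectation (indicator {\<omega> \<in> space M. P n \<omega>})"
      by (intro Bochner_Integration.integral_cong) (auto simp: indicator_def)
    then show ?thesis by simp
  qed
  ultimately show ?thesis by simp
qed

lemma (in prob_space) markov_tendsto_0:
  fixes U :: "nat \<Rightarrow> 'a \<Rightarrow> real"
  assumes [measurable]: "\<And>n. U n \<in> borel_measurable M" and int: "\<And>n. integrable M (U n)"
    and nn: "\<And>n \<omega>. 0 \<le> U n \<omega>" and lim: "(\<lambda>n. expectation (U n)) \<longlonglongrightarrow> 0" and e: "0 < e"
  shows "(\<lambda>n. prob {\<omega> \<in> space M. U n \<omega> \<ge> e}) \<longlonglongrightarrow> 0"
proof (rule tendsto_sandwich[of "\<lambda>_. 0"])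
  show "(\<lambda>n. expectation (U n) / e) \<longlonglongrightarrow> 0" using tendsto_divide[OF lim tendsto_const, of e] e by simp
  show "\<forall>\<^sub>F n in sequentially. prob {\<omega> \<in> space M. e \<le> U n \<omega>} \<le> expectation (U n) / e"
    using integral_Markov_inequality_measure[OF int sets.empty_sets, where c=e] nn e
    by (intro always_eventually allI) simp
qed auto

lemma (in prob_space) prob_tendsto_0_Un:
  assumes [measurable]: "\<And>n. Measurable.pred M (P n)" "\<And>n. Measurable.pred M (Q n)" "\<And>n. Measurable.pred M (R n)"
    and "(\<lambda>n. prob {\<omega> \<in> space M. P n \<omega>}) \<longlonglongrightarrow> 0" "(\<lambda>n. prob {\<omega> \<in> space M. Q n \<omega>}) \<longlonglongrightarrow> 0"
    and imp: "\<And>n. AE \<omega> in M. R n \<omega> \<longrightarrow> P n \<omega> \<or> Q n \<omega>"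
  shows "(\<lambda>n. prob {\<omega> \<in> space M. R n \<omega>}) \<longlonglongrightarrow> 0"
proof (rule tendsto_sandwich[of "\<lambda>_. 0"])
  show "(\<lambda>n. prob {\<omega> \<in> space M. P n \<omega>} + prob {\<omega> \<in> space M. Q n \<omega>}) \<longlonglongrightarrow> 0"
    using tendsto_add[OF assms(4,5)] by simp
  have "prob {\<omega> \<in> space M. R n \<omega>} \<le> prob {\<omega> \<in> space M. P n \<omega>} + prob {\<omega> \<in> space M. Q n \<omega>}" for n
  proof -
    have "prob {\<omega> \<in> space M. R n \<omega>} \<le> prob ({\<omega> \<in> space M. P n \<omega>} \<union> {\<omega> \<in> space M. Q n \<omega>})"
      using imp[of n] by (intro finite_measure_mono_AE) auto
    also have "\<dots> \<le> prob {\<omega> \<in> space M. P n \<omega>} + prob {\<omega> \<in> space M. Q n \<omega>}"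
      by (intro measure_Un_le) auto
    finally show ?thesis .
  qed
  then show "\<forall>\<^sub>F n in sequentially. prob {\<omega> \<in> space M. R n \<omega>}
      \<le> prob {\<omega> \<in> space M. P n \<omega>} + prob {\<omega> \<in> space M. Q n \<omega>}" by simp
qed auto

lemma (in prob_space) distr_restrict_eq_PiM:
  assumes ind: "indep_vars (\<lambda>_. N) Z I" and law: "\<And>i. i \<in> I \<Longrightarrow> distr M N (Z i) = P"
  shows "distr M (Pi\<^sub>M I (\<lambda>_. N)) (\<lambda>\<omega>. \<lambda>i\<in>I. Z i \<omega>) = Pi\<^sub>M I (\<lambda>_. P)"
\<comment> \<open>The training set can be empty, for instance at \<open>n = 0\<close>, so the empty
  product is treated as well.\<close>
proof (cases "I = {}")
  case True
  show ?thesis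
  proof (rule measure_eqI)
    fix A assume "A \<in> sets (distr M (Pi\<^sub>M I (\<lambda>_. N)) (\<lambda>\<omega>. \<lambda>i\<in>I. Z i \<omega>))"
    then have A: "A \<subseteq> {\<lambda>_. undefined}" by (simp add: True PiM_empty)
    have [measurable]: "(\<lambda>_. \<lambda>_. undefined) \<in> M \<rightarrow>\<^sub>M count_space {\<lambda>_. undefined}" by simp
    consider "A = {}" | "A = {\<lambda>_. undefined}" using A by blast
    then show "emeasure (distr M (Pi\<^sub>M I (\<lambda>_. N)) (\<lambda>\<omega>. \<lambda>i\<in>I. Z i \<omega>)) A = emeasure (Pi\<^sub>M I (\<lambda>_. P)) A"
      by cases (simp_all add: True PiM_empty restrict_def emeasure_distr emeasure_space_1)
  qed (simp add: True PiM_empty)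
next
  case False
  have "distr M (Pi\<^sub>M I (\<lambda>_. N)) (\<lambda>\<omega>. \<lambda>i\<in>I. Z i \<omega>) = Pi\<^sub>M I (\<lambda>i. distr M N (Z i))"
    using ind by (subst indep_vars_iff_distr_eq_PiM'[symmetric, OF False]) (auto simp: indep_vars_def)
  also have "\<dots> = Pi\<^sub>M I (\<lambda>_. P)" using law by (intro PiM_cong) auto
  finally show ?thesis .
qed

text \<open>Meant for the training indices \<open>I\<close> and one calibration index
  \<open>i\<close>. The law on \<open>insert i I\<close> is a product, and splitting off the
  coordinate \<open>i\<close> leaves the law of the training data times the law of one pair.\<close>

lemma (in prob_space) distr_restrict_pair_eq_PiM:
  assumes ind: "indep_vars (\<lambda>_. N) Z (insert i I)" and I: "finite I" "i \<notin> I"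
    and law: "\<And>j. j \<in> insert i I \<Longrightarrow> distr M N (Z j) = P"
  shows "distr M (Pi\<^sub>M I (\<lambda>_. N) \<Otimes>\<^sub>M N) (\<lambda>\<omega>. (\<lambda>j\<in>I. Z j \<omega>, Z i \<omega>)) = Pi\<^sub>M I (\<lambda>_. P) \<Otimes>\<^sub>M P"
proof -
  have Z[measurable]: "Z j \<in> M \<rightarrow>\<^sub>M N" if "j \<in> insert i I" for j using ind that by (auto simp: indep_vars_def)
  interpret P: prob_space P using law[of i] prob_space_distr[OF Z[of i]] by simp
  have sP[measurable_cong]: "sets P = sets N" using law[of i] by auto
  interpret Pi: product_prob_space "\<lambda>_. P" "insert i I" ..
  interpret PiI: product_prob_space "\<lambda>_. P" I ..
  have sPi[measurable_cong]: "sets (Pi\<^sub>M J (\<lambda>_. P)) = sets (Pi\<^sub>M J (\<lambda>_. N))" for J :: "'b set"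
    by (intro sets_PiM_cong refl sP)
  let ?L = "Pi\<^sub>M I (\<lambda>_. P)" and ?E = "Pi\<^sub>M (insert i I) (\<lambda>_. P)"
  let ?f = "\<lambda>d. (restrict d I, d i)"
  have f[measurable]: "?f \<in> Pi\<^sub>M (insert i I) (\<lambda>_. N) \<rightarrow>\<^sub>M Pi\<^sub>M I (\<lambda>_. N) \<Otimes>\<^sub>M N"
    by (intro measurable_Pair measurable_restrict_subset measurable_component_singleton) auto
  have "distr M (Pi\<^sub>M I (\<lambda>_. N) \<Otimes>\<^sub>M N) (\<lambda>\<omega>. (\<lambda>j\<in>I. Z j \<omega>, Z i \<omega>))
      = distr (distr M (Pi\<^sub>M (insert i I) (\<lambda>_. N)) (\<lambda>\<omega>. \<lambda>j\<in>insert i I. Z j \<omega>)) (Pi\<^sub>M I (\<lambda>_. N) \<Otimes>\<^sub>M N) ?f"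
  proof (subst distr_distr[OF f])
    show "(\<lambda>\<omega>. \<lambda>j\<in>insert i I. Z j \<omega>) \<in> M \<rightarrow>\<^sub>M Pi\<^sub>M (insert i I) (\<lambda>_. N)"
      by (intro measurable_restrict Z)
    have "?f \<circ> (\<lambda>\<omega>. \<lambda>j\<in>insert i I. Z j \<omega>) = (\<lambda>\<omega>. (\<lambda>j\<in>I. Z j \<omega>, Z i \<omega>))"
      by (auto simp: restrict_def fun_eq_iff)
    then show "distr M (Pi\<^sub>M I (\<lambda>_. N) \<Otimes>\<^sub>M N) (\<lambda>\<omega>. (\<lambda>j\<in>I. Z j \<omega>, Z i \<omega>))
      = distr M (Pi\<^sub>M I (\<lambda>_. N) \<Otimes>\<^sub>M N) (?f \<circ> (\<lambda>\<omega>. \<lambda>j\<in>insert i I. Z j \<omega>))" by simp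
  qed
  also have "\<dots> = distr ?E (Pi\<^sub>M I (\<lambda>_. N) \<Otimes>\<^sub>M N) ?f"
    using distr_restrict_eq_PiM[OF ind law] by simp
  also have "\<dots> = distr (distr (P \<Otimes>\<^sub>M ?L) ?E (\<lambda>(x, d). d(i := x))) (Pi\<^sub>M I (\<lambda>_. N) \<Otimes>\<^sub>M N) ?f"
    using distr_pair_PiM_eq_PiM[of I "\<lambda>_. P" i] P.prob_space_axioms by simp
  also have "\<dots> = distr (P \<Otimes>\<^sub>M ?L) (Pi\<^sub>M I (\<lambda>_. N) \<Otimes>\<^sub>M N) (\<lambda>(x, d). (d, x))"
  proof (subst distr_distr)
    show "(\<lambda>(x, d). d(i := x)) \<in> P \<Otimes>\<^sub>M ?L \<rightarrow>\<^sub>M ?E"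
      unfolding case_prod_unfold by (rule measurable_fun_upd[where J=I]) simp_all
    show "distr (P \<Otimes>\<^sub>M ?L) (Pi\<^sub>M I (\<lambda>_. N) \<Otimes>\<^sub>M N) (?f \<circ> (\<lambda>(x, d). d(i := x)))
        = distr (P \<Otimes>\<^sub>M ?L) (Pi\<^sub>M I (\<lambda>_. N) \<Otimes>\<^sub>M N) (\<lambda>(x, d). (d, x))"
    proof (intro distr_cong refl)
      fix z assume "z \<in> space (P \<Otimes>\<^sub>M ?L)"
      then have "snd z \<in> extensional I" by (auto simp: space_pair_measure space_PiM PiE_def)
      then have "restrict ((snd z)(i := fst z)) I = snd z"
        using I by (auto simp: restrict_def extensional_def fun_eq_iff)
      then show "(?f \<circ> (\<lambda>(x, d). d(i := x))) z = (case z of (x, d) \<Rightarrow> (d, x))"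
        by (simp add: case_prod_unfold)
    qed
  qed measurable
  also have "\<dots> = distr (P \<Otimes>\<^sub>M ?L) (?L \<Otimes>\<^sub>M P) (\<lambda>(x, d). (d, x))"
    by (intro distr_cong refl sets_pair_measure_cong) (simp_all add: sP sPi)
  also have "\<dots> = ?L \<Otimes>\<^sub>M P"
  proof -
    interpret pair_sigma_finite ?L P ..
    show ?thesis by (rule distr_pair_swap[symmetric])
  qed
  finally show ?thesis .
qed

section \<open>The forest setting\<close>

text \<open>The records \<open>train\<close>, \<open>sample\<close> and \<open>\<Theta>\<close> are
  parameters with defining equations, so that their laws can be named and the theorem instantiates
  the locale directly.\<close>

locale forest_setting = prob_space M for M :: "'w measure" +
  fixes X :: "'w \<Rightarrow> real ^ 'n::finite" and Y :: "'w \<Rightarrow> real"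
    and Xs :: "nat \<Rightarrow> 'w \<Rightarrow> real ^ 'n" and Ys :: "nat \<Rightarrow> 'w \<Rightarrow> real"
    and K :: "real ^ 'n \<Rightarrow> real measure" and \<alpha> :: real
    and I1 I2 :: "nat \<Rightarrow> nat set" and S :: "'c measure" and B :: "nat \<Rightarrow> nat"
    and \<theta> :: "nat \<Rightarrow> nat \<Rightarrow> 'w \<Rightarrow> 'c"
    and grow :: "nat \<Rightarrow> 'c \<Rightarrow> (nat \<Rightarrow> (real ^ 'n) \<times> real) \<Rightarrow> 'n rtree"
    and T :: "nat \<Rightarrow> nat \<Rightarrow> 'w \<Rightarrow> 'n rtree"
    and train sample :: "nat \<Rightarrow> 'w \<Rightarrow> nat \<Rightarrow> (real ^ 'n) \<times> real"
    and \<Theta> :: "nat \<Rightarrow> 'w \<Rightarrow> nat \<Rightarrow> 'c"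
    and trainM sampleM :: "nat \<Rightarrow> (nat \<Rightarrow> (real ^ 'n) \<times> real) measure"
    and \<Theta>M :: "nat \<Rightarrow> (nat \<Rightarrow> 'c) measure"
    and \<X> :: "(real ^ 'n) set"
  assumes alpha: "0 < \<alpha>" "\<alpha> < 1"
    and split: "\<And>n. I1 n \<union> I2 n = {1..n}" "\<And>n. I1 n \<inter> I2 n = {}"
    and calibration_size: "filterlim (\<lambda>n. card (I2 n)) at_top sequentially"
    and train_eq: "\<And>n \<omega>. train n \<omega> = (\<lambda>i\<in>I1 n. (Xs i \<omega>, Ys i \<omega>))"
      "\<And>n. trainM n = Pi\<^sub>M (I1 n) (\<lambda>_. borel)"
    and sample_eq: "\<And>n \<omega>. sample n \<omega> = (\<lambda>i\<in>{1..n}. (Xs i \<omega>, Ys i \<omega>))"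
      "\<And>n. sampleM n = Pi\<^sub>M {1..n} (\<lambda>_. borel)"
    and Theta_eq: "\<And>n \<omega>. \<Theta> n \<omega> = (\<lambda>b\<in>{..<B n}. \<theta> n b \<omega>)"
      "\<And>n. \<Theta>M n = Pi\<^sub>M {..<B n} (\<lambda>_. S)"
    and iid: "indep_vars (\<lambda>_. borel) (\<lambda>i \<omega>. (Xs i \<omega>, Ys i \<omega>)) {1..}"
      "\<And>i. i \<ge> 1 \<Longrightarrow>
         distr M borel (\<lambda>\<omega>. (Xs i \<omega>, Ys i \<omega>)) = distr M borel (\<lambda>\<omega>. (X \<omega>, Y \<omega>))"
    and fresh: "\<And>n. indep_rv M borel (\<lambda>\<omega>. (X \<omega>, Y \<omega>))
                  (sampleM n \<Otimes>\<^sub>M \<Theta>M n) (\<lambda>\<omega>. (sample n \<omega>, \<Theta> n \<omega>))"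
    and cond_dist: "is_regular_cond_dist M X Y K"
    and support: "\<X> = measure_support (distr M borel X)"
    and B_pos: "\<And>n. B n \<ge> 1"
    and grow: "\<And>n. (\<lambda>(t, d). grow n t d) \<in> S \<Otimes>\<^sub>M trainM n \<rightarrow>\<^sub>M tree_space"
    and T_eq: "\<And>n b \<omega>. T n b \<omega> = grow n (\<theta> n b \<omega>) (train n \<omega>)"
    and support_bounded: "bounded \<X>"
    and X_density: "\<exists>f c1 c2. distributed M lborel X (\<lambda>x. ennreal (f x)) \<and> 0 < c1 \<and>
                      (\<forall>x\<in>\<X>. c1 \<le> f x \<and> f x \<le> c2)"
    and leaf_max: "AE \<omega> in M.
        (\<lambda>n. real (Max {node_count (I1 n) (\<lambda>i. Xs i \<omega>) (T n b \<omega>) l |b l.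
                          b < B n \<and> l \<in> leaves (T n b \<omega>)})) \<in> o(\<lambda>n. real (card (I1 n)))"
    and leaf_min: "AE \<omega> in M.
        filterlim (\<lambda>n. Min {node_count (I1 n) (\<lambda>i. Xs i \<omega>) (T n b \<omega>) l |b l.
                              b < B n \<and> l \<in> leaves (T n b \<omega>)}) at_top sequentially"
    and split_variable: "\<exists>C0>0. \<forall>n. \<forall>b<B n. \<forall>p m. AE \<omega> in M. split_at (T n b \<omega>) p \<noteq> None \<longrightarrow>
        real_cond_exp M (split_history M (trainM n) (train n) (T n b) p)
          (indicat_real {\<omega> \<in> space M. \<exists>s. split_at (T n b \<omega>) p = Some (m, s)}) \<omega> \<ge> C0"
    and split_balance: "\<exists>\<gamma>>0. \<gamma> \<le> 1 / 2 \<and> (\<forall>n. \<forall>b<B n. AE \<omega> in M. \<forall>p c.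
        split_at (T n b \<omega>) p \<noteq> None \<longrightarrow>
          real (node_count (I1 n) (\<lambda>i. Xs i \<omega>) (T n b \<omega>) (p @ [c]))
            / real (node_count (I1 n) (\<lambda>i. Xs i \<omega>) (T n b \<omega>) p) \<ge> \<gamma>)"
    and lipschitz: "\<exists>C>0. \<forall>x\<in>\<X>. \<forall>x'\<in>\<X>.
        (SUP y. \<bar>cdf (K x) y - cdf (K x') y\<bar>) \<le> C * (\<Sum>j\<in>UNIV. \<bar>x $ j - x' $ j\<bar>)"
    and cdf_strict: "\<forall>x\<in>\<X>. strict_mono (cdf (K x))"
    and honest_randomness: "\<And>n. indep_rv M (\<Theta>M n) (\<Theta> n) (sampleM n) (sample n)"
    and honest_splits: "\<And>n t d d'. t \<in> space S \<Longrightarrow> d \<in> space (trainM n) \<Longrightarrow> d' \<in> space (trainM n)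
        \<Longrightarrow> (\<And>i. i \<in> I1 n \<Longrightarrow> fst (d i) = fst (d' i)) \<Longrightarrow> grow n t d = grow n t d'"
    and Y_density: "\<forall>x\<in>\<X>. \<exists>h. continuous_on UNIV h \<and> (\<forall>y. 0 \<le> h y) \<and>
        K x = density lborel (\<lambda>y. ennreal (h y))"
begin

definition "P = distr M borel (\<lambda>\<omega>. (X \<omega>, Y \<omega>))"
definition "\<mu> = distr M borel X"
definition "\<Theta>L n = distr M (\<Theta>M n) (\<Theta> n)"
definition "trainL n = Pi\<^sub>M (I1 n) (\<lambda>_. P)"

lemma I_subset: "I1 n \<subseteq> {1..n}" "I2 n \<subseteq> {1..n}" and finite_I [simp]: "finite (I1 n)" "finite (I2 n)"
proof -
  show "I1 n \<subseteq> {1..n}" "I2 n \<subseteq> {1..n}" using split(1)[of n] by auto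
  then show "finite (I1 n)" "finite (I2 n)" by (auto intro: finite_subset)
qed

lemma I_ge_1: "i \<in> I1 n \<Longrightarrow> i \<ge> 1" "i \<in> I2 n \<Longrightarrow> i \<ge> 1"
  using I_subset[of n] by auto

lemma fst_snd_borel: "fst \<in> borel_measurable (borel :: ((real ^ 'n) \<times> real) measure)"
  "snd \<in> borel_measurable (borel :: ((real ^ 'n) \<times> real) measure)"
  by (simp_all flip: borel_prod)

lemma XY_measurable [measurable]: "(\<lambda>\<omega>. (X \<omega>, Y \<omega>)) \<in> borel_measurable M"
  using fresh by (simp add: indep_rv_def)

lemma X_measurable [measurable]: "X \<in> borel_measurable M" and Y_measurable [measurable]: "Y \<in> borel_measurable M"
  using measurable_compose[OF XY_measurable fst_snd_borel(1)] measurable_compose[OF XY_measurable fst_snd_borel(2)]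
  by simp_all

lemma XYs_measurable [measurable]: "i \<ge> 1 \<Longrightarrow> (\<lambda>\<omega>. (Xs i \<omega>, Ys i \<omega>)) \<in> borel_measurable M"
  using iid(1) by (auto simp: indep_vars_def)

lemma Xs_measurable [measurable]: "i \<ge> 1 \<Longrightarrow> Xs i \<in> borel_measurable M"
  and Ys_measurable [measurable]: "i \<ge> 1 \<Longrightarrow> Ys i \<in> borel_measurable M"
  using measurable_compose[OF XYs_measurable fst_snd_borel(1)] measurable_compose[OF XYs_measurable fst_snd_borel(2)]
  by simp_all

lemma sample_measurable [measurable]: "sample n \<in> M \<rightarrow>\<^sub>M sampleM n"
  and Theta_measurable [measurable]: "\<Theta> n \<in> M \<rightarrow>\<^sub>M \<Theta>M n"
  using honest_randomness[of n] by (auto simp: indep_rv_def)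

lemma restrict_train [measurable]: "(\<lambda>d. restrict d (I1 n)) \<in> sampleM n \<rightarrow>\<^sub>M trainM n"
  unfolding sample_eq train_eq using I_subset by (intro measurable_restrict_subset)

lemma restrict_sample: "restrict (sample n \<omega>) (I1 n) = train n \<omega>"
  using I_subset(1)[of n] by (auto simp: sample_eq train_eq fun_eq_iff restrict_def)

lemma train_measurable [measurable]: "train n \<in> M \<rightarrow>\<^sub>M trainM n"
  using measurable_compose[OF sample_measurable restrict_train] by (simp add: restrict_sample)

lemma prob_space_P: "prob_space P" and sets_P [measurable_cong, simp]: "sets P = sets borel"
  by (auto simp: P_def intro!: prob_space_distr)

lemma prob_space_mu: "prob_space \<mu>" and sets_mu [measurable_cong, simp]: "sets \<mu> = sets borel"
  by (auto simp: \<mu>_def intro!: prob_space_distr)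

lemma prob_space_ThetaL: "prob_space (\<Theta>L n)" and sets_ThetaL [measurable_cong, simp]: "sets (\<Theta>L n) = sets (\<Theta>M n)"
  by (auto simp: \<Theta>L_def intro!: prob_space_distr)

lemma prob_space_trainL: "prob_space (trainL n)" 
  unfolding trainL_def by (intro prob_space_PiM prob_space_P)

lemma sets_trainL [measurable_cong, simp]: "sets (trainL n) = sets (trainM n)"
  unfolding trainL_def train_eq by (intro sets_PiM_cong refl sets_P)

section \<open>Joint laws of the training data, the forest randomness and one further
  covariate\<close>

lemma indep_XYs: "J \<subseteq> {1..} \<Longrightarrow> indep_vars (\<lambda>_. borel) (\<lambda>i \<omega>. (Xs i \<omega>, Ys i \<omega>)) J"
  using iid(1) by (rule indep_vars_subset)

lemma distr_XYs: "i \<ge> 1 \<Longrightarrow> distr M borel (\<lambda>\<omega>. (Xs i \<omega>, Ys i \<omega>)) = P"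
  using iid(2) by (simp add: P_def)

lemma distr_fst_P: "distr P borel fst = \<mu>"
  unfolding P_def \<mu>_def by (subst distr_distr) (auto simp: comp_def fst_snd_borel)

lemma distr_Xs: "i \<ge> 1 \<Longrightarrow> distr M borel (Xs i) = \<mu>"
  using distr_distr[OF fst_snd_borel(1) XYs_measurable, of i]
  by (simp add: distr_XYs distr_fst_P comp_def)

lemma distr_train: "distr M (trainM n) (train n) = trainL n"
  unfolding train_eq trainL_def using I_ge_1[of _ n]
  by (intro distr_restrict_eq_PiM indep_XYs distr_XYs) auto

lemma prob_space_forestL: "prob_space (trainL n \<Otimes>\<^sub>M \<Theta>L n)"
  and distr_forest: "distr M (trainM n \<Otimes>\<^sub>M \<Theta>M n) (\<lambda>\<omega>. (train n \<omega>, \<Theta> n \<omega>)) = trainL n \<Otimes>\<^sub>M \<Theta>L n"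
proof -
  interpret Th: prob_space "\<Theta>L n" by (rule prob_space_ThetaL)
  interpret tr: prob_space "trainL n" by (rule prob_space_trainL)
  interpret A: pair_prob_space "trainL n" "\<Theta>L n" ..
  show "prob_space (trainL n \<Otimes>\<^sub>M \<Theta>L n)" by (rule A.prob_space_axioms)
  have "indep_rv M (\<Theta>M n) (\<lambda>\<omega>. \<Theta> n \<omega>) (trainM n) (\<lambda>\<omega>. restrict (sample n \<omega>) (I1 n))"
    by (rule indep_rv_compose[OF honest_randomness measurable_ident_sets[OF refl] restrict_train])
  from indep_rv_distr[OF this]
  have 1: "distr M (\<Theta>M n \<Otimes>\<^sub>M trainM n) (\<lambda>\<omega>. (\<Theta> n \<omega>, train n \<omega>)) = \<Theta>L n \<Otimes>\<^sub>M trainL n"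
    by (simp add: restrict_sample distr_train \<Theta>L_def)
    have "trainL n \<Otimes>\<^sub>M \<Theta>L n = distr (\<Theta>L n \<Otimes>\<^sub>M trainL n) (trainL n \<Otimes>\<^sub>M \<Theta>L n) (\<lambda>(x, y). (y, x))"
      by (rule A.distr_pair_swap)
    also have "\<dots> = distr (\<Theta>L n \<Otimes>\<^sub>M trainL n) (trainM n \<Otimes>\<^sub>M \<Theta>M n) (\<lambda>(x, y). (y, x))"
      by (intro distr_cong refl sets_pair_measure_cong) auto
    also have "\<dots> = distr M (trainM n \<Otimes>\<^sub>M \<Theta>M n) (\<lambda>\<omega>. (train n \<omega>, \<Theta> n \<omega>))"
      unfolding 1[symmetric] by (subst distr_distr) (auto simp: comp_def)
    finally show "distr M (trainM n \<Otimes>\<^sub>M \<Theta>M n) (\<lambda>\<omega>. (train n \<omega>, \<Theta> n \<omega>)) = trainL n \<Otimes>\<^sub>M \<Theta>L n" ..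
qed

text \<open>The test point is independent of sample and randomness together, hence of the forest as
  one block.\<close>

lemma distr_forest_X: "distr M ((trainM n \<Otimes>\<^sub>M \<Theta>M n) \<Otimes>\<^sub>M borel) (\<lambda>\<omega>. ((train n \<omega>, \<Theta> n \<omega>), X \<omega>))
    = (trainL n \<Otimes>\<^sub>M \<Theta>L n) \<Otimes>\<^sub>M \<mu>"
proof -
  interpret mu: prob_space \<mu> by (rule prob_space_mu)
  interpret LD: prob_space "trainL n \<Otimes>\<^sub>M \<Theta>L n" by (rule prob_space_forestL)
  interpret B: pair_prob_space "trainL n \<Otimes>\<^sub>M \<Theta>L n" \<mu> ..
  have "indep_rv M borel (\<lambda>\<omega>. fst (X \<omega>, Y \<omega>)) (trainM n \<Otimes>\<^sub>M \<Theta>M n)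
      (\<lambda>\<omega>. (\<lambda>z. (restrict (fst z) (I1 n), snd z)) (sample n \<omega>, \<Theta> n \<omega>))"
    by (intro indep_rv_compose[OF fresh] fst_snd_borel) measurable
  from indep_rv_distr[OF this]
  have 3: "distr M (borel \<Otimes>\<^sub>M (trainM n \<Otimes>\<^sub>M \<Theta>M n)) (\<lambda>\<omega>. (X \<omega>, (train n \<omega>, \<Theta> n \<omega>)))
      = \<mu> \<Otimes>\<^sub>M (trainL n \<Otimes>\<^sub>M \<Theta>L n)"
    by (simp add: restrict_sample distr_forest \<mu>_def)
  have "(trainL n \<Otimes>\<^sub>M \<Theta>L n) \<Otimes>\<^sub>M \<mu>
      = distr (\<mu> \<Otimes>\<^sub>M (trainL n \<Otimes>\<^sub>M \<Theta>L n)) ((trainL n \<Otimes>\<^sub>M \<Theta>L n) \<Otimes>\<^sub>M \<mu>) (\<lambda>(x, y). (y, x))"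
    by (rule B.distr_pair_swap)
  also have "\<dots> = distr (\<mu> \<Otimes>\<^sub>M (trainL n \<Otimes>\<^sub>M \<Theta>L n)) ((trainM n \<Otimes>\<^sub>M \<Theta>M n) \<Otimes>\<^sub>M borel) (\<lambda>(x, y). (y, x))"
    by (intro distr_cong refl sets_pair_measure_cong) auto
  also have "\<dots> = distr M ((trainM n \<Otimes>\<^sub>M \<Theta>M n) \<Otimes>\<^sub>M borel) (\<lambda>\<omega>. ((train n \<omega>, \<Theta> n \<omega>), X \<omega>))"
    unfolding 3[symmetric] by (subst distr_distr) (auto simp: comp_def)
  finally show ?thesis ..
qed

text \<open>The randomness is independent of the whole sample, hence of training data and
  calibration point jointly, and these two are independent of each other. The result is the very law
  found for \<open>X\<close>, so any probability statement about the forest at \<open>X\<close>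
  holds at each calibration covariate.\<close>

lemma distr_forest_Xs:
  assumes i: "i \<in> I2 n"
  shows "distr M ((trainM n \<Otimes>\<^sub>M \<Theta>M n) \<Otimes>\<^sub>M borel) (\<lambda>\<omega>. ((train n \<omega>, \<Theta> n \<omega>), Xs i \<omega>))
    = (trainL n \<Otimes>\<^sub>M \<Theta>L n) \<Otimes>\<^sub>M \<mu>"
proof -
  have i': "i \<notin> I1 n" "i \<in> {1..n}" "i \<ge> 1" using split[of n] i by auto
  interpret mu: prob_space \<mu> by (rule prob_space_mu)
  interpret P: prob_space P by (rule prob_space_P)
  interpret tr: prob_space "trainL n" by (rule prob_space_trainL)
  have 1: "distr M (trainM n \<Otimes>\<^sub>M borel) (\<lambda>\<omega>. (train n \<omega>, (Xs i \<omega>, Ys i \<omega>))) = trainL n \<Otimes>\<^sub>M P"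
    unfolding train_eq trainL_def using i' I_ge_1[of _ n]
    by (intro distr_restrict_pair_eq_PiM indep_XYs distr_XYs) auto
  have 2: "distr M (trainM n \<Otimes>\<^sub>M borel) (\<lambda>\<omega>. (train n \<omega>, Xs i \<omega>)) = trainL n \<Otimes>\<^sub>M \<mu>"
  proof -
    have "distr M (trainM n \<Otimes>\<^sub>M borel) (\<lambda>\<omega>. (train n \<omega>, Xs i \<omega>))
       = distr (trainL n \<Otimes>\<^sub>M P) (trainM n \<Otimes>\<^sub>M borel) (\<lambda>(d, z). (d, fst z))"
      unfolding 1[symmetric] using i' fst_snd_borel by (subst distr_distr) (auto simp: comp_def)
    also have "\<dots> = distr (trainL n) (trainL n) (\<lambda>d. d) \<Otimes>\<^sub>M distr P borel fst"
      using fst_snd_borel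
      by (subst pair_measure_distr)
        (auto simp: distr_fst_P intro!: distr_cong sets_pair_measure_cong prob_space_imp_sigma_finite prob_space_mu)
    also have "\<dots> = trainL n \<Otimes>\<^sub>M \<mu>" by (simp add: distr_fst_P distr_id)
    finally show ?thesis .
  qed
  have "(\<lambda>d. d i) \<in> sampleM n \<rightarrow>\<^sub>M borel"
    unfolding sample_eq using i' by (intro measurable_component_singleton)
  then have "(\<lambda>d. fst (d i)) \<in> sampleM n \<rightarrow>\<^sub>M borel" using fst_snd_borel(1) by (rule measurable_compose)
  then have "indep_rv M (\<Theta>M n) (\<lambda>\<omega>. \<Theta> n \<omega>) (trainM n \<Otimes>\<^sub>M borel)
      (\<lambda>\<omega>. (\<lambda>d. (restrict d (I1 n), fst (d i))) (sample n \<omega>))"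
    by (intro indep_rv_compose[OF honest_randomness measurable_ident_sets[OF refl]] measurable_Pair restrict_train)
  moreover have "fst (sample n \<omega> i) = Xs i \<omega>" for \<omega> using i' by (simp add: sample_eq)
  ultimately have 3: "distr M (\<Theta>M n \<Otimes>\<^sub>M (trainM n \<Otimes>\<^sub>M borel)) (\<lambda>\<omega>. (\<Theta> n \<omega>, (train n \<omega>, Xs i \<omega>)))
      = \<Theta>L n \<Otimes>\<^sub>M (trainL n \<Otimes>\<^sub>M \<mu>)"
    using indep_rv_distr by (fastforce simp: restrict_sample 2 \<Theta>L_def)
  have "(trainL n \<Otimes>\<^sub>M \<Theta>L n) \<Otimes>\<^sub>M \<mu>
    = distr (\<Theta>L n \<Otimes>\<^sub>M (trainL n \<Otimes>\<^sub>M \<mu>)) ((trainL n \<Otimes>\<^sub>M \<Theta>L n) \<Otimes>\<^sub>M \<mu>) (\<lambda>(a, b, c). ((b, a), c))"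
    by (intro pair_measure_rotate[symmetric] prob_space_ThetaL prob_space_trainL prob_space_mu)
  also have "\<dots> = distr (\<Theta>L n \<Otimes>\<^sub>M (trainL n \<Otimes>\<^sub>M \<mu>)) ((trainM n \<Otimes>\<^sub>M \<Theta>M n) \<Otimes>\<^sub>M borel) (\<lambda>(a, b, c). ((b, a), c))"
    by (intro distr_cong refl sets_pair_measure_cong) auto
  also have "\<dots> = distr M ((trainM n \<Otimes>\<^sub>M \<Theta>M n) \<Otimes>\<^sub>M borel) (\<lambda>\<omega>. ((train n \<omega>, \<Theta> n \<omega>), Xs i \<omega>))"
    unfolding 3[symmetric] using i' by (subst distr_distr) (auto simp: comp_def)
  finally show ?thesis ..
qed

end

lemma finite_bool_lists: "finite {p :: bool list. length p = J}"
  using finite_lists_length_eq[of "UNIV :: bool set" J] by simp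

lemma sum_bool_lists_Suc:
  fixes f :: "bool list \<Rightarrow> 'a::comm_monoid_add"
  shows "(\<Sum>p | length p = Suc J. f p) = (\<Sum>p | length p = J. \<Sum>c\<in>UNIV. f (p @ [c]))"
proof -
  have "(\<lambda>(p, c). p @ [c]) ` ({p. length p = J} \<times> UNIV) = {p :: bool list. length p = Suc J}"
  proof safe
    fix p :: "bool list" assume p: "length p = Suc J"
    then have "p = butlast p @ [last p]" by (cases p rule: rev_cases) auto
    then show "p \<in> (\<lambda>(p, c). p @ [c]) ` ({p. length p = J} \<times> UNIV)"
      using p by (intro image_eqI[of _ _ "(butlast p, last p)"]) auto
  qed simp
  moreover have "inj_on (\<lambda>(p, c). p @ [c]) ({p. length p = J} \<times> (UNIV :: bool set))"
    by (auto simp: inj_on_def)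
  ultimately have "(\<Sum>p | length p = Suc J. f p)
      = (\<Sum>z\<in>{p. length p = J} \<times> UNIV. f (case z of (p, c) \<Rightarrow> p @ [c]))"
    by (metis (no_types, lifting) sum.reindex_cong)
  then show ?thesis by (simp add: sum.cartesian_product case_prod_unfold)
qed

context forest_setting
begin

section \<open>Trees as functions of the training data and the forest randomness\<close>

lemma Theta_component_measurable: "b < B n \<Longrightarrow> (\<lambda>h. h b) \<in> \<Theta>M n \<rightarrow>\<^sub>M S"
  unfolding Theta_eq(2) by (rule measurable_component_singleton) simp

lemma theta_measurable [measurable]: "b < B n \<Longrightarrow> \<theta> n b \<in> M \<rightarrow>\<^sub>M S"
  using measurable_compose[OF Theta_measurable Theta_component_measurable, of b n] by (simp add: Theta_eq(1))

lemma grow_measurable: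
  "f \<in> N \<rightarrow>\<^sub>M S \<Longrightarrow> g \<in> N \<rightarrow>\<^sub>M trainM n \<Longrightarrow> (\<lambda>z. grow n (f z) (g z)) \<in> N \<rightarrow>\<^sub>M tree_space"
  using measurable_compose[OF measurable_Pair grow[of n]] by simp

lemma T_measurable [measurable]: "b < B n \<Longrightarrow> T n b \<in> M \<rightarrow>\<^sub>M tree_space"
  using grow_measurable[OF theta_measurable train_measurable] by (simp add: T_eq[abs_def])

text \<open>The random tree factored through training data and randomness, so that expectations over
  the forest become integrals over a product law.\<close>

definition tree_of :: "nat \<Rightarrow> nat \<Rightarrow> (nat \<Rightarrow> (real ^ 'n) \<times> real) \<times> (nat \<Rightarrow> 'c) \<Rightarrow> 'n rtree" where
  "tree_of n b D = grow n (snd D b) (fst D)"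

lemma tree_of_measurable [measurable]:
  assumes b: "b < B n"
  shows "tree_of n b \<in> trainM n \<Otimes>\<^sub>M \<Theta>M n \<rightarrow>\<^sub>M tree_space"
proof -
  have "(\<lambda>D. snd D b) \<in> trainM n \<Otimes>\<^sub>M \<Theta>M n \<rightarrow>\<^sub>M S"
    by (rule measurable_compose[OF measurable_snd Theta_component_measurable[OF b]])
  then show ?thesis unfolding tree_of_def[abs_def] by (rule grow_measurable[OF _ measurable_fst])
qed

lemma tree_of_eq: "b < B n \<Longrightarrow> tree_of n b (train n \<omega>, \<Theta> n \<omega>) = T n b \<omega>"
  by (simp add: tree_of_def T_eq Theta_eq(1))

abbreviation cell_count :: "nat \<Rightarrow> nat \<Rightarrow> bool list \<Rightarrow> 'w \<Rightarrow> real" where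
  "cell_count n b p \<omega> \<equiv> real (node_count (I1 n) (\<lambda>i. Xs i \<omega>) (T n b \<omega>) p)"

lemma cell_count_le: "cell_count n b p \<omega> \<le> real (card (I1 n))"
  unfolding node_count_def by (intro of_nat_mono card_mono) auto

lemma cell_count_eq: "cell_count n b p \<omega> = (\<Sum>i\<in>I1 n. indicat_real (region (T n b \<omega>) p) (Xs i \<omega>))"
  by (intro node_count_eq_sum) simp

lemma cell_count_measurable [measurable]:
  "b < B n \<Longrightarrow> cell_count n b p \<in> borel_measurable M"
proof -
  assume b: "b < B n"
  have [measurable]: "Measurable.pred M (\<lambda>\<omega>. Xs i \<omega> \<in> region (T n b \<omega>) p)" if "i \<in> I1 n" for i
    using b I_ge_1 that by (intro pred_in_region_tree) auto
  show ?thesis unfolding cell_count_eq indicator_def by measurable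
qed

lemma cell_width_T_measurable [measurable]:
  "b < B n \<Longrightarrow> (\<lambda>\<omega>. cell_width R (T n b \<omega>) p m) \<in> borel_measurable M"
  by (intro cell_width_measurable pred_split_at) auto

section \<open>Decay of the cell widths in mean\<close>

text \<open>The history of \<open>p\<close> determines the training points and the ancestors'
  splits, hence count and width of the cell \<open>p\<close>, and whether \<open>p\<close> is split.
  The coordinate chosen at \<open>p\<close> is left open, and this is where the conditional split
  probability acts.\<close>

lemma split_history_measurability:
  fixes p :: "bool list"
  assumes b: "b < B n"
  defines "H \<equiv> split_history M (trainM n) (train n) (T n b) p"
  shows "subalgebra M H"
    and "train n \<in> H \<rightarrow>\<^sub>M trainM n"
    and "\<And>k m a. k < length p \<Longrightarrow>
      Measurable.pred H (\<lambda>\<omega>. \<exists>s\<le>a. split_at (T n b \<omega>) (take k p) = Some (m, s))"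
    and "Measurable.pred H (\<lambda>\<omega>. split_at (T n b \<omega>) p \<noteq> None)"
proof -
  define G where "G = {train n -` A \<inter> space M |A. A \<in> sets (trainM n)}
      \<union> {{\<omega> \<in> space M. \<exists>s\<le>a. split_at (T n b \<omega>) (take k p) = Some (m, s)} |k m a. k < length p}
      \<union> {{\<omega> \<in> space M. split_at (T n b \<omega>) p \<noteq> None}}"
  have H: "H = sigma (space M) G" by (simp add: H_def split_history_def G_def)
  have GP: "G \<subseteq> Pow (space M)" by (auto simp: G_def)
  then have sp: "space H = space M" and sets: "sets H = sigma_sets (space M) G"
    unfolding H by (simp_all add: space_measure_of_conv)
  have "Measurable.pred M (\<lambda>\<omega>. split_at (T n b \<omega>) p \<noteq> None)"
    using pred_split_at_None[OF T_measurable[OF b]] by measurable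
  then have GM: "G \<subseteq> sets M"
    using measurable_sets[OF train_measurable] pred_split_at[OF T_measurable[OF b]]
    unfolding G_def pred_def by blast
  then show "subalgebra M H"
    unfolding subalgebra_def sp sets using sets.sigma_sets_subset by auto
  have GH: "A \<in> G \<Longrightarrow> A \<in> sets H" for A unfolding sets by auto
  show "train n \<in> H \<rightarrow>\<^sub>M trainM n"
  proof (rule measurableI)
    show "train n -` A \<inter> space H \<in> sets H" if "A \<in> sets (trainM n)" for A
      using that by (intro GH) (auto simp: G_def sp)
  qed (use measurable_space[OF train_measurable] in \<open>auto simp: sp\<close>)
  show "Measurable.pred H (\<lambda>\<omega>. \<exists>s\<le>a. split_at (T n b \<omega>) (take k p) = Some (m, s))" if "k < length p" for k m a
    using that unfolding pred_def sp G_def by (intro GH[unfolded G_def]) blast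
  show "Measurable.pred H (\<lambda>\<omega>. split_at (T n b \<omega>) p \<noteq> None)"
    unfolding pred_def sp by (intro GH) (auto simp: G_def)
qed

lemma AE_balanced: "\<exists>\<gamma>>0. \<gamma> \<le> 1 / 2 \<and>
  (AE \<omega> in M. \<forall>n. \<forall>b<B n. balanced \<gamma> (I1 n) (\<lambda>i. Xs i \<omega>) (T n b \<omega>))"
proof -
  obtain \<gamma> where \<gamma>: "\<gamma> > 0" "\<gamma> \<le> 1 / 2" and *: "\<And>n b. b < B n \<Longrightarrow> AE \<omega> in M. \<forall>p c.
        split_at (T n b \<omega>) p \<noteq> None \<longrightarrow>
          real (node_count (I1 n) (\<lambda>i. Xs i \<omega>) (T n b \<omega>) (p @ [c]))
            / real (node_count (I1 n) (\<lambda>i. Xs i \<omega>) (T n b \<omega>) p) \<ge> \<gamma>"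
    using split_balance by blast
  have "AE \<omega> in M. b < B n \<longrightarrow> balanced \<gamma> (I1 n) (\<lambda>i. Xs i \<omega>) (T n b \<omega>)" for n b
  proof (cases "b < B n")
    case True
    from *[OF this] show ?thesis by eventually_elim (simp add: balanced_def)
  qed simp
  then have "AE \<omega> in M. \<forall>n b. b < B n \<longrightarrow> balanced \<gamma> (I1 n) (\<lambda>i. Xs i \<omega>) (T n b \<omega>)"
    by (simp add: AE_all_countable)
  with \<gamma> show ?thesis by (intro exI[of _ \<gamma>]) auto
qed

text \<open>The conditional probability of splitting along \<open>m\<close> turns the deterministic contraction at
  \<open>m\<close>-splits into a contraction in mean at every level of the tree.\<close>

lemma count_width_step:
  assumes b: "b < B n" and R: "0 \<le> R"
    and bal: "AE \<omega> in M. balanced \<gamma> (I1 n) (\<lambda>i. Xs i \<omega>) (T n b \<omega>)" and \<gamma>: "0 < \<gamma>" "\<gamma> \<le> 1 / 2"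
    and C: "0 < C" "C \<le> 1"
    and cond: "AE \<omega> in M. split_at (T n b \<omega>) p \<noteq> None \<longrightarrow>
        real_cond_exp M (split_history M (trainM n) (train n) (T n b) p)
          (indicat_real {\<omega> \<in> space M. \<exists>s. split_at (T n b \<omega>) p = Some (m, s)}) \<omega> \<ge> C"
  shows "(\<Sum>c\<in>UNIV. expectation (\<lambda>\<omega>. cell_count n b (p @ [c]) \<omega> * cell_width R (T n b \<omega>) (p @ [c]) m))
     \<le> (1 - \<gamma> * C) * expectation (\<lambda>\<omega>. cell_count n b p \<omega> * cell_width R (T n b \<omega>) p m)"
proof -
  define H where "H = split_history M (trainM n) (train n) (T n b) p"
  define q where "q p \<omega> = cell_count n b p \<omega> * cell_width R (T n b \<omega>) p m" for p \<omega>
  define A where "A = {\<omega> \<in> space M. \<exists>s. split_at (T n b \<omega>) p = Some (m, s)}"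
  define f where "f \<omega> = q p \<omega> * of_bool (split_at (T n b \<omega>) p \<noteq> None)" for \<omega>
  note Hm = split_history_measurability[OF b, where p = p, folded H_def]
  interpret H: sigma_finite_subalgebra M H
    by (intro finite_measure_subalgebra_is_sigma_finite finite_measure_subalgebra.intro
        finite_measure_subalgebra_axioms.intro Hm finite_measure_axioms)
  have A[measurable]: "A \<in> sets M"
    using pred_split_at_var[OF pred_split_at[OF T_measurable[OF b]]] by (simp add: A_def pred_def)
  have XsH: "Xs i \<in> borel_measurable H" if "i \<in> I1 n" for i
  proof -
    have "(\<lambda>d. d i) \<in> trainM n \<rightarrow>\<^sub>M borel"
      unfolding train_eq using that by (intro measurable_component_singleton)
    from measurable_compose[OF Hm(2) this] have "(\<lambda>\<omega>. train n \<omega> i) \<in> borel_measurable H" .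
    from measurable_compose[OF this fst_snd_borel(1)] show ?thesis using that by (simp add: train_eq)
  qed
  have fH: "f \<in> borel_measurable H"
  proof -
    have [measurable]: "Measurable.pred H (\<lambda>\<omega>. Xs i \<omega> \<in> region (T n b \<omega>) p)" if "i \<in> I1 n" for i
      using that Hm(3) XsH by (intro pred_in_region)
    have [measurable]: "(\<lambda>\<omega>. cell_width R (T n b \<omega>) p m) \<in> borel_measurable H"
      using Hm(3) by (intro cell_width_measurable)
    note Hm(4)[measurable]
    show ?thesis unfolding f_def q_def cell_count_eq indicator_def by measurable
  qed
  have [measurable]: "q p \<in> borel_measurable M" for p unfolding q_def using b by measurable
  have fM[measurable]: "f \<in> borel_measurable M" using measurable_from_subalg[OF Hm(1) fH] .
  have q: "0 \<le> q p \<omega>" "q p \<omega> \<le> real (card (I1 n)) * (2 * R)" for p \<omega>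
    unfolding q_def using R by (auto intro!: mult_mono cell_count_le cell_width_le)
  have intq: "integrable M (q p)" for p
    using q by (intro integrable_const_bound[where B="real (card (I1 n)) * (2 * R)"]) auto
  have f: "0 \<le> f \<omega>" "f \<omega> \<le> q p \<omega>" for \<omega> using q by (auto simp: f_def)
  have intf: "integrable M f" using f q order_trans[OF f(2) q(2)]
    by (intro integrable_const_bound[where B="real (card (I1 n)) * (2 * R)"]) auto
  have intfA: "integrable M (\<lambda>\<omega>. f \<omega> * indicat_real A \<omega>)"
    using integrable_real_mult_indicator[OF A intf] .
  \<comment> \<open>As \<open>f\<close> is known from the history, it can be pulled out of the
    conditional expectation of the event that the split is along \<open>m\<close>.\<close>
  note ce = H.real_cond_exp_intg[OF intfA fH]
  have "C * expectation f = expectation (\<lambda>\<omega>. C * f \<omega>)" by simp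
  also have "\<dots> \<le> expectation (\<lambda>\<omega>. f \<omega> * real_cond_exp M H (indicat_real A) \<omega>)"
  proof (rule integral_mono_AE)
    show "AE \<omega> in M. C * f \<omega> \<le> f \<omega> * real_cond_exp M H (indicat_real A) \<omega>"
      using cond unfolding H_def[symmetric] A_def[symmetric]
    proof eventually_elim
      case (elim \<omega>)
      show ?case
      proof (cases "split_at (T n b \<omega>) p = None")
        case True then show ?thesis by (simp add: f_def)
      next
        case False
        then have "C \<le> real_cond_exp M H (indicat_real A) \<omega>" using elim by blast
        from mult_right_mono[OF this f(1)[of \<omega>]] show ?thesis by (simp add: mult.commute)
      qed
    qed
  qed (use intf ce in auto)
  also have "\<dots> = expectation (\<lambda>\<omega>. f \<omega> * indicat_real A \<omega>)" by (rule ce(2)) simp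
  finally have low: "C * expectation f \<le> expectation (\<lambda>\<omega>. f \<omega> * indicat_real A \<omega>)" .
  have "(\<Sum>c\<in>UNIV. expectation (q (p @ [c]))) = expectation (\<lambda>\<omega>. \<Sum>c\<in>UNIV. q (p @ [c]) \<omega>)"
    using intq by (intro Bochner_Integration.integral_sum[symmetric])
  also have "\<dots> \<le> expectation (\<lambda>\<omega>. f \<omega> - \<gamma> * (f \<omega> * indicat_real A \<omega>))"
  proof (rule integral_mono_AE)
    show "AE \<omega> in M. (\<Sum>c\<in>UNIV. q (p @ [c]) \<omega>) \<le> f \<omega> - \<gamma> * (f \<omega> * indicat_real A \<omega>)"
      using bal AE_space
    proof eventually_elim
      case (elim \<omega>)
      have "f \<omega> - \<gamma> * (f \<omega> * indicat_real A \<omega>) = q p \<omega> * (of_bool (split_at (T n b \<omega>) p \<noteq> None)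
         - \<gamma> * of_bool (\<exists>s. split_at (T n b \<omega>) p = Some (m, s)))"
        using elim(2) by (auto simp: f_def A_def indicator_def algebra_simps)
      then show ?case
        using count_width_split[OF finite_I(1) elim(1) \<gamma>(1), of p R m] by (simp add: q_def)
    qed
  qed (use intq intf intfA in auto)
  also have "\<dots> = expectation f - \<gamma> * expectation (\<lambda>\<omega>. f \<omega> * indicat_real A \<omega>)"
    using intf intfA by simp
  also have "\<dots> \<le> expectation f - \<gamma> * (C * expectation f)"
    using low \<gamma> by (intro diff_left_mono mult_left_mono) auto
  also have "\<dots> = (1 - \<gamma> * C) * expectation f" by (simp add: algebra_simps)
  also have "\<dots> \<le> (1 - \<gamma> * C) * expectation (q p)"
  proof (intro mult_left_mono integral_mono intf intq f)
    have "\<gamma> * C \<le> 1 * 1" using \<gamma> C by (intro mult_mono) auto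
    then show "0 \<le> 1 - \<gamma> * C" by simp
  qed
  finally show ?thesis by (simp only: q_def[abs_def])
qed

text \<open>One rate serves all sample sizes, trees, directions and depths. The induction on the
  depth starts from the root, which has all training points and width \<open>2 * R\<close>.\<close>

lemma count_width_decay:
  "\<exists>\<rho>. 0 \<le> \<rho> \<and> \<rho> < 1 \<and> (\<forall>n b R m J. b < B n \<longrightarrow> 0 \<le> R \<longrightarrow>
     (\<Sum>p | length p = J. expectation (\<lambda>\<omega>. cell_count n b p \<omega> * cell_width R (T n b \<omega>) p m))
       \<le> \<rho> ^ J * (real (card (I1 n)) * (2 * R)))"
proof -
  obtain \<gamma> where \<gamma>: "\<gamma> > 0" "\<gamma> \<le> 1 / 2"
    and bal: "AE \<omega> in M. \<forall>n. \<forall>b<B n. balanced \<gamma> (I1 n) (\<lambda>i. Xs i \<omega>) (T n b \<omega>)"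
    using AE_balanced by blast
  obtain C0 where C0: "C0 > 0" and sv: "\<And>n b p m. b < B n \<Longrightarrow> AE \<omega> in M. split_at (T n b \<omega>) p \<noteq> None \<longrightarrow>
        real_cond_exp M (split_history M (trainM n) (train n) (T n b) p)
          (indicat_real {\<omega> \<in> space M. \<exists>s. split_at (T n b \<omega>) p = Some (m, s)}) \<omega> \<ge> C0"
    using split_variable by blast
  \<comment> \<open>Only positivity of \<open>C0\<close> is assumed; the truncation keeps the rate
    \<rho> nonnegative.\<close>
  define C where "C = min C0 1"
  define \<rho> where "\<rho> = 1 - \<gamma> * C"
  have C: "0 < C" "C \<le> 1" using C0 by (auto simp: C_def)
  have "\<gamma> * C \<le> 1 * 1" "0 < \<gamma> * C" using \<gamma> C by (intro mult_mono mult_pos_pos; simp)+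
  then have \<rho>: "0 \<le> \<rho>" "\<rho> < 1" by (auto simp: \<rho>_def)
  have "(\<Sum>p | length p = J. expectation (\<lambda>\<omega>. cell_count n b p \<omega> * cell_width R (T n b \<omega>) p m))
       \<le> \<rho> ^ J * (real (card (I1 n)) * (2 * R))" if b: "b < B n" and R: "0 \<le> R" for n b R m J
  proof (induction J)
    case 0
    have "expectation (\<lambda>\<omega>. cell_count n b [] \<omega> * cell_width R (T n b \<omega>) [] m)
       \<le> expectation (\<lambda>\<omega>. real (card (I1 n)) * (2 * R))"
    proof (rule integral_mono)
      show "integrable M (\<lambda>\<omega>. cell_count n b [] \<omega> * cell_width R (T n b \<omega>) [] m)"
        using b R by (intro integrable_const_bound[where B="real (card (I1 n)) * (2 * R)"])
          (auto intro!: mult_mono cell_width_le)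
    qed (use R in \<open>auto intro!: mult_mono cell_width_le\<close>)
    then show ?case by (simp add: prob_space)
  next
    case (Suc J)
    have bal': "AE \<omega> in M. balanced \<gamma> (I1 n) (\<lambda>i. Xs i \<omega>) (T n b \<omega>)"
      using bal by eventually_elim (use b in auto)
    have "(\<Sum>p | length p = Suc J. expectation (\<lambda>\<omega>. cell_count n b p \<omega> * cell_width R (T n b \<omega>) p m))
      = (\<Sum>p | length p = J. \<Sum>c\<in>UNIV. expectation (\<lambda>\<omega>. cell_count n b (p @ [c]) \<omega> * cell_width R (T n b \<omega>) (p @ [c]) m))"
      by (rule sum_bool_lists_Suc)
    also have "\<dots> \<le> (\<Sum>p | length p = J. \<rho> * expectation (\<lambda>\<omega>. cell_count n b p \<omega> * cell_width R (T n b \<omega>) p m))"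
    proof (rule sum_mono)
      fix p :: "bool list"
      have "AE \<omega> in M. split_at (T n b \<omega>) p \<noteq> None \<longrightarrow>
        real_cond_exp M (split_history M (trainM n) (train n) (T n b) p)
          (indicat_real {\<omega> \<in> space M. \<exists>s. split_at (T n b \<omega>) p = Some (m, s)}) \<omega> \<ge> C"
        using sv[OF b, of p m] by eventually_elim (auto simp: C_def)
      from count_width_step[OF b R bal' \<gamma> C this]
      show "(\<Sum>c\<in>UNIV. expectation (\<lambda>\<omega>. cell_count n b (p @ [c]) \<omega> * cell_width R (T n b \<omega>) (p @ [c]) m))
        \<le> \<rho> * expectation (\<lambda>\<omega>. cell_count n b p \<omega> * cell_width R (T n b \<omega>) p m)"
        unfolding \<rho>_def .
    qed
    also have "\<dots> = \<rho> * (\<Sum>p | length p = J. expectation (\<lambda>\<omega>. cell_count n b p \<omega> * cell_width R (T n b \<omega>) p m))"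
      by (simp add: sum_distrib_left)
    also have "\<dots> \<le> \<rho> * (\<rho> ^ J * (real (card (I1 n)) * (2 * R)))"
      using Suc \<rho> by (intro mult_left_mono)
    finally show ?case by (simp add: mult.assoc)
  qed
  then show ?thesis using \<rho> by blast
qed

end

text \<open>Finiteness is what allows \<open>Max\<close> and \<open>Min\<close> over the leaves to
  be read as bounds.\<close>

lemma finite_leaf_values:
  fixes f :: "nat \<Rightarrow> bool list \<Rightarrow> nat" and t :: "nat \<Rightarrow> 'n::finite rtree"
  shows "finite {f b l |b l. b < B \<and> l \<in> leaves (t b)}"
proof -
  have "{f b l |b l. b < B \<and> l \<in> leaves (t b)} = (\<lambda>(b, l). f b l) ` (SIGMA b:{..<B}. leaves (t b))"
    by force
  then show ?thesis by (simp add: finite_leaves)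
qed

context forest_setting
begin

section \<open>The size of the leaf of the test point\<close>

lemma AE_leaf_count_ge: "AE \<omega> in M. \<forall>k. \<forall>\<^sub>F n in sequentially. \<forall>b<B n. \<forall>l\<in>leaves (T n b \<omega>).
    k \<le> node_count (I1 n) (\<lambda>i. Xs i \<omega>) (T n b \<omega>) l"
  using leaf_min
proof eventually_elim
  case (elim \<omega>)
  show ?case
  proof
    fix k
    have "\<forall>\<^sub>F n in sequentially. k \<le> Min {node_count (I1 n) (\<lambda>i. Xs i \<omega>) (T n b \<omega>) l |b l.
                              b < B n \<and> l \<in> leaves (T n b \<omega>)}"
      using elim by (simp add: filterlim_at_top)
    then show "\<forall>\<^sub>F n in sequentially. \<forall>b<B n. \<forall>l\<in>leaves (T n b \<omega>).
        k \<le> node_count (I1 n) (\<lambda>i. Xs i \<omega>) (T n b \<omega>) l"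
    proof eventually_elim
      case (elim n)
      show ?case
      proof (intro allI impI ballI)
        fix b l assume "b < B n" "l \<in> leaves (T n b \<omega>)"
        then have "Min {node_count (I1 n) (\<lambda>i. Xs i \<omega>) (T n b \<omega>) l |b l. b < B n \<and> l \<in> leaves (T n b \<omega>)}
            \<le> node_count (I1 n) (\<lambda>i. Xs i \<omega>) (T n b \<omega>) l"
          by (intro Min_le finite_leaf_values) auto
        with elim show "k \<le> node_count (I1 n) (\<lambda>i. Xs i \<omega>) (T n b \<omega>) l" by linarith
      qed
    qed
  qed
qed

text \<open>No leaf holds more than all training points, so divergence of the minimal leaf count
  forces the training set to grow.\<close>

lemma train_size: "filterlim (\<lambda>n. card (I1 n)) at_top sequentially"
proof -
  \<comment> \<open>The claim is deterministic, so a single outcome outside the null set is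
    enough.\<close>
  have "ae_filter M \<noteq> bot" by (simp add: ae_filter_eq_bot_iff emeasure_space_1)
  then obtain \<omega> where *: "\<And>k. \<forall>\<^sub>F n in sequentially. \<forall>b<B n. \<forall>l\<in>leaves (T n b \<omega>).
    k \<le> node_count (I1 n) (\<lambda>i. Xs i \<omega>) (T n b \<omega>) l"
    using eventually_happens'[OF _ AE_leaf_count_ge] by blast
  show ?thesis unfolding filterlim_at_top
  proof
    fix k
    show "\<forall>\<^sub>F n in sequentially. k \<le> card (I1 n)"
      using *[of k]
    proof eventually_elim
      case (elim n)
      have "0 < B n" using B_pos[of n] by simp
      then have "k \<le> node_count (I1 n) (\<lambda>i. Xs i \<omega>) (T n 0 \<omega>) (leaf_of (T n 0 \<omega>) 0)"
        using elim leaf_of_in_leaves by blast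
      also have "\<dots> \<le> card (I1 n)" unfolding node_count_def by (intro card_mono) auto
      finally show ?case .
    qed
  qed
qed

lemma AE_leaves_deep: "AE \<omega> in M. \<forall>J. \<forall>\<^sub>F n in sequentially. \<forall>b<B n. \<forall>l\<in>leaves (T n b \<omega>). J \<le> length l"
proof -
  obtain \<gamma> where \<gamma>: "\<gamma> > 0" "\<gamma> \<le> 1 / 2"
    and bal: "AE \<omega> in M. \<forall>n. \<forall>b<B n. balanced \<gamma> (I1 n) (\<lambda>i. Xs i \<omega>) (T n b \<omega>)"
    using AE_balanced by blast
  show ?thesis
    using bal leaf_max
  proof eventually_elim
    case (elim \<omega>)
    show ?case
    proof
      fix J
      have "\<forall>\<^sub>F n in sequentially. norm (real (Max {node_count (I1 n) (\<lambda>i. Xs i \<omega>) (T n b \<omega>) l |b l.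
                          b < B n \<and> l \<in> leaves (T n b \<omega>)})) \<le> \<gamma> ^ J / 2 * norm (real (card (I1 n)))"
        by (rule landau_o.smallD[OF elim(2)]) (use \<gamma> in simp)
      moreover have "\<forall>\<^sub>F n in sequentially. 1 \<le> card (I1 n)"
        using train_size unfolding filterlim_at_top by blast
      ultimately show "\<forall>\<^sub>F n in sequentially. \<forall>b<B n. \<forall>l\<in>leaves (T n b \<omega>). J \<le> length l"
      proof eventually_elim
        case el: (elim n)
        show ?case
        proof (intro allI impI ballI)
          fix b l assume b: "b < B n" and l: "l \<in> leaves (T n b \<omega>)"
          let ?N = "node_count (I1 n) (\<lambda>i. Xs i \<omega>) (T n b \<omega>) l"
          have "?N \<le> Max {node_count (I1 n) (\<lambda>i. Xs i \<omega>) (T n b \<omega>) l |b l.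
                          b < B n \<and> l \<in> leaves (T n b \<omega>)}"
            using b l by (intro Max_ge finite_leaf_values) auto
          then have "real ?N \<le> \<gamma> ^ J / 2 * real (card (I1 n))"
            using el(1) by simp
          moreover have "\<gamma> ^ length l * real (card (I1 n)) \<le> real ?N"
            using elim(1) b l \<gamma> by (intro balanced_node_count_power) (auto simp: leaves_def)
          ultimately have "\<gamma> ^ length l * real (card (I1 n)) \<le> \<gamma> ^ J / 2 * real (card (I1 n))" by linarith
          then have "\<gamma> ^ length l \<le> \<gamma> ^ J / 2" using el(2) by simp
          \<comment> \<open>The factor 1/2 in the smallness constant serves this strict inequality,
            which contradicts a leaf shorter than \<open>J\<close>.\<close>
          also have "\<dots> < \<gamma> ^ J" using \<gamma> by simp
          finally have lt: "\<gamma> ^ length l < \<gamma> ^ J" .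
          show "J \<le> length l"
          proof (rule ccontr)
            assume "\<not> J \<le> length l"
            then have "\<gamma> ^ J \<le> \<gamma> ^ length l" using \<gamma> by (intro power_decreasing) auto
            then show False using lt by simp
          qed
        qed
      qed
    qed
  qed
qed

section \<open>A common bound for the coordinates of the support, and thin slabs\<close>

definition "R = (SOME R. 0 \<le> R \<and> (\<forall>x\<in>\<X>. \<forall>m. \<bar>x $ m\<bar> \<le> R))"

lemma R_nonneg: "0 \<le> R" and abs_le_R: "x \<in> \<X> \<Longrightarrow> \<bar>x $ m\<bar> \<le> R"
proof -
  obtain r where r: "\<And>x. x \<in> \<X> \<Longrightarrow> norm x \<le> r"
    using support_bounded unfolding bounded_iff by blast
  have "\<bar>x $ m\<bar> \<le> max r 0" if "x \<in> \<X>" for x m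
    using component_le_norm_cart[of x m] r[OF that] by linarith
  then have "\<exists>R. 0 \<le> R \<and> (\<forall>x\<in>\<X>. \<forall>m. \<bar>x $ m\<bar> \<le> R)" by (intro exI[of _ "max r 0"]) auto
  from someI_ex[OF this, folded R_def] show "0 \<le> R" "x \<in> \<X> \<Longrightarrow> \<bar>x $ m\<bar> \<le> R" by auto
qed

lemma support_borel [measurable]: "\<X> \<in> sets borel"
  unfolding support by (intro borel_closed closed_measure_support)

lemma AE_mu_support: "AE x in \<mu>. x \<in> \<X>"
  unfolding support \<mu>_def[symmetric] by (rule AE_measure_support) simp

lemma AE_X_support: "AE \<omega> in M. X \<omega> \<in> \<X>"
  using AE_mu_support unfolding \<mu>_def by (subst (asm) AE_distr_iff) auto

lemma AE_Xs_support: "AE \<omega> in M. \<forall>i\<ge>1. Xs i \<omega> \<in> \<X>"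
proof -
  have "AE \<omega> in M. i \<ge> 1 \<longrightarrow> Xs i \<omega> \<in> \<X>" for i
  proof (cases "i \<ge> 1")
    case True
    have "AE x in distr M borel (Xs i). x \<in> \<X>" by (simp only: distr_Xs[OF True] AE_mu_support)
    then show ?thesis using True by (subst (asm) AE_distr_iff) auto
  qed simp
  then show ?thesis by (simp add: AE_all_countable)
qed

lemma small_slabs:
  assumes "0 < \<epsilon>"
  shows "\<exists>\<delta>>0. \<forall>m k. measure \<mu> {x. grid_index \<delta> x m = k} \<le> \<epsilon>"
proof -
  obtain f c1 c2 where f: "distributed M lborel X (\<lambda>x. ennreal (f x))" "\<And>x. x \<in> \<X> \<Longrightarrow> f x \<le> c2"
    using X_density by blast
  \<comment> \<open>The positive part of \<open>f\<close>: it gives the same density and is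
    nonnegative also off the support.\<close>
  define g where "g x = enn2real (ennreal (f x))" for x
  define c where "c = max c2 0"
  define a where "a = c * (2 * R) ^ (CARD('n) - 1)"
  \<comment> \<open>Makes the slab bound \<open>a * \<delta>\<close> at most \<epsilon>; the summand
    1 avoids a division by zero when \<open>a = 0\<close>.\<close>
  define \<delta> where "\<delta> = \<epsilon> / (a + 1)"
  have a: "0 \<le> a" using R_nonneg by (simp add: a_def c_def)
  have \<delta>: "0 < \<delta>" using a assms by (simp add: \<delta>_def)
  have "\<mu> = distr M lborel X" unfolding \<mu>_def by (intro distr_cong) auto
  also have "\<dots> = density lborel (\<lambda>x. ennreal (f x))" using f(1) by (simp add: distributed_def)
  also have "(\<lambda>x. ennreal (f x)) = (\<lambda>x. ennreal (g x))" by (simp add: g_def)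
  finally have \<mu>: "\<mu> = density lborel (\<lambda>x. ennreal (g x))" .
  have "(\<lambda>x. ennreal (f x)) \<in> borel_measurable lborel" using f(1) by (simp add: distributed_def)
  then have g: "g \<in> borel_measurable borel" unfolding g_def by measurable
  have gc: "g x \<le> c" if "x \<in> \<X>" for x
    using f(2)[OF that] by (cases "0 \<le> f x") (simp_all add: g_def c_def ennreal_neg)
  interpret mu: prob_space \<mu> by (rule prob_space_mu)
  have "measure \<mu> {x. grid_index \<delta> x m = k} \<le> \<epsilon>" for m k
  proof -
    have "measure \<mu> {x. grid_index \<delta> x m = k} \<le> c * (\<delta> * (2 * R) ^ (CARD('n) - 1))"
      by (rule grid_slab_le[OF \<mu> g AE_mu_support])
        (use abs_le_R gc \<delta> R_nonneg mu.finite_measure_axioms in \<open>auto simp: c_def\<close>)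
    also have "\<dots> = a / (a + 1) * \<epsilon>" by (simp add: a_def \<delta>_def)
    also have "\<dots> \<le> 1 * \<epsilon>" using a assms by (intro mult_right_mono) auto
    finally show ?thesis by simp
  qed
  then show ?thesis using \<delta> by blast
qed

text \<open>Fubini: \<open>X\<close> is independent of the forest, so for a fixed tree the mean of
  the indicator is the probability of the cell under the law of \<open>X\<close>. This is the true
  probability that has to be compared with the frequency.\<close>

lemma expectation_cell_X:
  assumes b: "b < B n"
  shows "expectation (\<lambda>\<omega>. indicat_real (region (T n b \<omega>) p) (X \<omega>) * cell_width R (T n b \<omega>) p m)
    = expectation (\<lambda>\<omega>. measure \<mu> (region (T n b \<omega>) p) * cell_width R (T n b \<omega>) p m)"
    and "(\<lambda>\<omega>. measure \<mu> (region (T n b \<omega>) p)) \<in> borel_measurable M"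
proof -
  let ?W = "trainM n \<Otimes>\<^sub>M \<Theta>M n" and ?L = "trainL n \<Otimes>\<^sub>M \<Theta>L n"
  interpret mu: prob_space \<mu> by (rule prob_space_mu)
  interpret LD: prob_space ?L by (rule prob_space_forestL)
  interpret LM: pair_prob_space ?L \<mu> ..
  define w where "w D = cell_width R (tree_of n b D) p m" for D
  define r where "r D = region (tree_of n b D) p" for D
  have sL[measurable_cong]: "sets ?L = sets ?W" by (intro sets_pair_measure_cong) auto
  have w[measurable]: "w \<in> borel_measurable ?W"
    unfolding w_def using b by (intro cell_width_measurable pred_split_at) auto
  have pr: "Measurable.pred (?W \<Otimes>\<^sub>M borel) (\<lambda>z. snd z \<in> r (fst z))"
    unfolding r_def using b by (intro pred_in_region_tree measurable_compose[OF measurable_fst tree_of_measurable]) auto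
  have ind[measurable]: "(\<lambda>z. indicat_real (r (fst z)) (snd z)) \<in> borel_measurable (?W \<Otimes>\<^sub>M borel)"
    using pr unfolding indicator_def by measurable
  have meas_r[measurable]: "(\<lambda>D. measure \<mu> (r D)) \<in> borel_measurable ?W"
  proof -
    have Q: "{z \<in> space (?W \<Otimes>\<^sub>M borel). snd z \<in> r (fst z)} \<in> sets (?W \<Otimes>\<^sub>M \<mu>)"
      using pr sets_pair_measure_cong[OF refl sets_mu, of ?W] by (simp add: pred_def)
    have "Pair D -` {z \<in> space (?W \<Otimes>\<^sub>M borel). snd z \<in> r (fst z)} = r D" if "D \<in> space ?W" for D
      using that by (auto simp: space_pair_measure)
    then have "(\<lambda>D. emeasure \<mu> (r D)) \<in> borel_measurable ?W"
      by (intro measurable_cong[THEN iffD1, OF _ mu.measurable_emeasure_Pair[OF Q]]) simp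
    then show ?thesis unfolding measure_def by measurable
  qed
  have w_bd: "0 \<le> w D" "w D \<le> 2 * R" for D by (auto simp: w_def intro: cell_width_le R_nonneg)
  have int: "integrable (?L \<Otimes>\<^sub>M \<mu>) (\<lambda>z. indicat_real (r (fst z)) (snd z) * w (fst z))"
  proof (rule LM.P.integrable_const_bound[where B="1 * (2 * R)"])
    show "AE z in ?L \<Otimes>\<^sub>M \<mu>. norm (indicat_real (r (fst z)) (snd z) * w (fst z)) \<le> 1 * (2 * R)"
      using w_bd by (intro AE_I2) (auto simp: abs_mult indicator_def R_nonneg)
  qed measurable
  have "expectation (\<lambda>\<omega>. indicat_real (region (T n b \<omega>) p) (X \<omega>) * cell_width R (T n b \<omega>) p m)
    = expectation (\<lambda>\<omega>. (\<lambda>z. indicat_real (r (fst z)) (snd z) * w (fst z)) ((train n \<omega>, \<Theta> n \<omega>), X \<omega>))"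
    using b by (simp add: r_def w_def tree_of_eq)
  also have "\<dots> = integral\<^sup>L (?L \<Otimes>\<^sub>M \<mu>) (\<lambda>z. indicat_real (r (fst z)) (snd z) * w (fst z))"
    unfolding distr_forest_X[symmetric] by (intro integral_distr[symmetric]) measurable
  also have "\<dots> = (\<integral>D. (\<integral>x. indicat_real (r D) x * w D \<partial>\<mu>) \<partial>?L)"
    using LM.integral_fst'[OF int] by simp
  also have "\<dots> = (\<integral>D. measure \<mu> (r D) * w D \<partial>?L)"
    by (simp add: r_def)
  also have "\<dots> = expectation (\<lambda>\<omega>. (\<lambda>D. measure \<mu> (r D) * w D) (train n \<omega>, \<Theta> n \<omega>))"
    unfolding distr_forest[symmetric] by (intro integral_distr) measurable
  also have "\<dots> = expectation (\<lambda>\<omega>. measure \<mu> (region (T n b \<omega>) p) * cell_width R (T n b \<omega>) p m)"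
    using b by (simp add: r_def w_def tree_of_eq)
  finally show "expectation (\<lambda>\<omega>. indicat_real (region (T n b \<omega>) p) (X \<omega>) * cell_width R (T n b \<omega>) p m)
    = expectation (\<lambda>\<omega>. measure \<mu> (region (T n b \<omega>) p) * cell_width R (T n b \<omega>) p m)" .
  have "(\<lambda>\<omega>. (\<lambda>D. measure \<mu> (r D)) (train n \<omega>, \<Theta> n \<omega>)) \<in> borel_measurable M"
    by measurable
  then show "(\<lambda>\<omega>. measure \<mu> (region (T n b \<omega>) p)) \<in> borel_measurable M"
    using b by (simp add: r_def tree_of_eq)
qed

text \<open>The cells of depth \<open>J\<close> of one tree are disjoint, so at most one address
  contributes: the depth \<open>J\<close> ancestor of the leaf of \<open>X\<close>, with the sum of
  its side widths. If the leaf of \<open>X\<close> is less deep, the tree contributes 0, so the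
  quantity controls the leaf only in deep trees.\<close>

definition mean_width :: "nat \<Rightarrow> nat \<Rightarrow> 'w \<Rightarrow> real" where
  "mean_width J n \<omega> = 1 / real (B n) * (\<Sum>b<B n. \<Sum>m\<in>UNIV. \<Sum>p | length p = J.
      indicat_real (region (T n b \<omega>) p) (X \<omega>) * cell_width R (T n b \<omega>) p m)"

lemma cell_X_measurable [measurable]:
  assumes "b < B n"
  shows "(\<lambda>\<omega>. indicat_real (region (T n b \<omega>) p) (X \<omega>)) \<in> borel_measurable M"
proof -
  have [measurable]: "Measurable.pred M (\<lambda>\<omega>. X \<omega> \<in> region (T n b \<omega>) p)"
    using assms by (intro pred_in_region_tree) auto
  show ?thesis unfolding indicator_def by measurable
qed

lemma cell_X_integrable:
  assumes b: "b < B n"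
  shows "integrable M (\<lambda>\<omega>. indicat_real (region (T n b \<omega>) p) (X \<omega>) * cell_width R (T n b \<omega>) p m)"
proof (rule integrable_const_bound[where B="2 * R"])
  show "AE \<omega> in M. norm (indicat_real (region (T n b \<omega>) p) (X \<omega>) * cell_width R (T n b \<omega>) p m) \<le> 2 * R"
    using cell_width_le[OF R_nonneg] R_nonneg by (intro AE_I2) (auto simp: indicator_def)
qed (use b in measurable)

lemma mean_width_measurable [measurable]: "mean_width J n \<in> borel_measurable M"
  unfolding mean_width_def[abs_def] by measurable

lemma mean_width_nonneg: "0 \<le> mean_width J n \<omega>"
  unfolding mean_width_def by (intro mult_nonneg_nonneg sum_nonneg) auto

lemma mean_width_integrable: "integrable M (mean_width J n)"
  unfolding mean_width_def[abs_def] using cell_X_integrable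
  by (intro integrable_mult_right Bochner_Integration.integrable_sum) auto

lemma expectation_mean_width:
  "expectation (mean_width J n) = 1 / real (B n) * (\<Sum>b<B n. \<Sum>m\<in>UNIV. \<Sum>p | length p = J.
      expectation (\<lambda>\<omega>. measure \<mu> (region (T n b \<omega>) p) * cell_width R (T n b \<omega>) p m))"
proof -
  have "expectation (mean_width J n) = 1 / real (B n) * (\<Sum>b<B n. \<Sum>m\<in>UNIV. \<Sum>p | length p = J.
      expectation (\<lambda>\<omega>. indicat_real (region (T n b \<omega>) p) (X \<omega>) * cell_width R (T n b \<omega>) p m))"
    unfolding mean_width_def[abs_def] using cell_X_integrable
    by (simp add: Bochner_Integration.integral_sum Bochner_Integration.integrable_sum del: times_divide_eq_left)
  then show ?thesis by (simp add: expectation_cell_X(1))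
qed

end

lemma card_bool_lists: "card {p :: bool list. length p = J} = 2 ^ J"
  using card_lists_length_eq[of "UNIV :: bool set" J] by simp

context forest_setting
begin

text \<open>Replacing the probability of the cell by its frequency costs the deviations on all cubes
  of the grid and one slab per ancestor, each multiplied by the largest possible width
  \<open>2 * R\<close>.\<close>

lemma expectation_cell_le:
  assumes b: "b < B n" and n: "1 \<le> card (I1 n)" and \<delta>: "0 < \<delta>"
    and slab: "\<And>m k. measure \<mu> {x. grid_index \<delta> x m = k} \<le> \<epsilon>"
  defines "G \<equiv> grid_index \<delta> ` {x :: real ^ 'n. \<forall>m. \<bar>x $ m\<bar> \<le> R}"
  shows "expectation (\<lambda>\<omega>. measure \<mu> (region (T n b \<omega>) p) * cell_width R (T n b \<omega>) p m)
    \<le> expectation (\<lambda>\<omega>. cell_count n b p \<omega> * cell_width R (T n b \<omega>) p m) / real (card (I1 n))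
      + 2 * R * (real (card G) / sqrt (real (card (I1 n))) + real (length p) * \<epsilon>)"
proof -
  let ?n = "real (card (I1 n))"
  define Q where "Q k = {x :: real ^ 'n. grid_index \<delta> x = k}" for k
  define \<Delta> where "\<Delta> k \<omega> = \<bar>(\<Sum>i\<in>I1 n. indicat_real (Q k) (Xs i \<omega>)) / ?n - measure \<mu> (Q k)\<bar>" for k \<omega>
  interpret mu: prob_space \<mu> by (rule prob_space_mu)
  have [measurable]: "Q k \<in> sets borel" for k by (simp add: Q_def)
  have finG: "finite G" unfolding G_def by (rule finite_grid_index[OF \<delta>])
  have AE_G: "AE x in \<mu>. grid_index \<delta> x \<in> G"
    using AE_mu_support by eventually_elim (auto simp: G_def abs_le_R)
  have I1: "Xs i \<in> borel_measurable M" if "i \<in> I1 n" for i using I_ge_1 that by auto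
  have \<Delta>m[measurable]: "\<Delta> k \<in> borel_measurable M" for k
    unfolding \<Delta>_def using I1 by measurable
  have \<Delta>_bd: "\<Delta> k \<omega> \<le> 2" for k \<omega>
  proof -
    have "(\<Sum>i\<in>I1 n. indicat_real (Q k) (Xs i \<omega>)) \<le> (\<Sum>i\<in>I1 n. 1)"
      by (intro sum_mono) (auto simp: indicator_def)
    then have "(\<Sum>i\<in>I1 n. indicat_real (Q k) (Xs i \<omega>)) / ?n \<le> 1" using n by simp
    moreover have "0 \<le> (\<Sum>i\<in>I1 n. indicat_real (Q k) (Xs i \<omega>)) / ?n" by (simp add: sum_nonneg)
    moreover have "0 \<le> measure \<mu> (Q k)" "measure \<mu> (Q k) \<le> 1" by auto
    ultimately show ?thesis unfolding \<Delta>_def by linarith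
  qed
  have int\<Delta>: "integrable M (\<Delta> k)" for k
    using \<Delta>_bd by (intro integrable_const_bound[where B=2]) (auto simp: \<Delta>_def)
  have E\<Delta>: "expectation (\<Delta> k) \<le> 1 / sqrt ?n" for k
  proof -
    have ind: "indep_vars (\<lambda>_. borel) (\<lambda>i \<omega>. fst (Xs i \<omega>, Ys i \<omega>)) (I1 n)"
      using I_subset(1)[of n] by (intro indep_vars_compose2[OF indep_XYs] fst_snd_borel) auto
    show ?thesis unfolding \<Delta>_def
      using n I_ge_1 by (intro expectation_empirical_deviation[where N=borel]) (use ind distr_Xs in auto)
  qed
  have cw: "0 \<le> cell_width R (T n b \<omega>) p m" "cell_width R (T n b \<omega>) p m \<le> 2 * R" for \<omega>
    using cell_width_le[OF R_nonneg] by auto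
  have intc: "integrable M (\<lambda>\<omega>. cell_count n b p \<omega> * cell_width R (T n b \<omega>) p m)"
    using b cw R_nonneg by (intro integrable_const_bound[where B="?n * (2 * R)"])
      (auto intro!: mult_mono cell_count_le simp: abs_mult)
  have "measure \<mu> (region (T n b \<omega>) p) * cell_width R (T n b \<omega>) p m
      \<le> cell_count n b p \<omega> * cell_width R (T n b \<omega>) p m / ?n + 2 * R * ((\<Sum>k\<in>G. \<Delta> k \<omega>) + real (length p) * \<epsilon>)" for \<omega>
  proof -
    have "0 \<le> \<epsilon>" using order_trans[OF measure_nonneg slab] .
    then have nn: "0 \<le> (\<Sum>k\<in>G. \<Delta> k \<omega>) + real (length p) * \<epsilon>"
      by (intro add_nonneg_nonneg sum_nonneg mult_nonneg_nonneg) (auto simp: \<Delta>_def)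
    have "measure \<mu> (region (T n b \<omega>) p) \<le> cell_count n b p \<omega> / ?n + (\<Sum>k\<in>G. \<Delta> k \<omega>) + real (length p) * \<epsilon>"
      unfolding \<Delta>_def Q_def
      by (intro measure_region_le[OF prob_space_mu sets_mu \<delta> finG AE_G]) (auto intro: slab)
    then have "measure \<mu> (region (T n b \<omega>) p) * cell_width R (T n b \<omega>) p m
      \<le> (cell_count n b p \<omega> / ?n + ((\<Sum>k\<in>G. \<Delta> k \<omega>) + real (length p) * \<epsilon>)) * cell_width R (T n b \<omega>) p m"
      using cw by (intro mult_right_mono) auto
    also have "\<dots> = cell_count n b p \<omega> * cell_width R (T n b \<omega>) p m / ?n
        + cell_width R (T n b \<omega>) p m * ((\<Sum>k\<in>G. \<Delta> k \<omega>) + real (length p) * \<epsilon>)"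
      by (simp add: algebra_simps)
    also have "\<dots> \<le> cell_count n b p \<omega> * cell_width R (T n b \<omega>) p m / ?n
        + 2 * R * ((\<Sum>k\<in>G. \<Delta> k \<omega>) + real (length p) * \<epsilon>)"
      using cw nn by (intro add_left_mono mult_right_mono) auto
    finally show ?thesis .
  qed
  then have "expectation (\<lambda>\<omega>. measure \<mu> (region (T n b \<omega>) p) * cell_width R (T n b \<omega>) p m)
    \<le> expectation (\<lambda>\<omega>. cell_count n b p \<omega> * cell_width R (T n b \<omega>) p m / ?n
        + 2 * R * ((\<Sum>k\<in>G. \<Delta> k \<omega>) + real (length p) * \<epsilon>))"
  proof (intro integral_mono)
    show "integrable M (\<lambda>\<omega>. measure \<mu> (region (T n b \<omega>) p) * cell_width R (T n b \<omega>) p m)"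
    proof (rule integrable_const_bound)
      have "measure \<mu> (region (T n b \<omega>) p) * cell_width R (T n b \<omega>) p m \<le> 1 * (2 * R)" for \<omega>
        using cw by (intro mult_mono) auto
      then show "AE \<omega> in M. norm (measure \<mu> (region (T n b \<omega>) p) * cell_width R (T n b \<omega>) p m) \<le> 1 * (2 * R)"
        using cw by (intro AE_I2) (simp add: abs_mult)
    qed (use expectation_cell_X(2)[OF b] b in measurable)
    show "integrable M (\<lambda>\<omega>. cell_count n b p \<omega> * cell_width R (T n b \<omega>) p m / ?n
        + 2 * R * ((\<Sum>k\<in>G. \<Delta> k \<omega>) + real (length p) * \<epsilon>))"
      using intc int\<Delta> by simp
  qed
  also have "\<dots> = expectation (\<lambda>\<omega>. cell_count n b p \<omega> * cell_width R (T n b \<omega>) p m) / ?n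
        + 2 * R * ((\<Sum>k\<in>G. expectation (\<Delta> k)) + real (length p) * \<epsilon>)"
    using intc int\<Delta> by (simp add: Bochner_Integration.integral_sum prob_space)
  also have "(\<Sum>k\<in>G. expectation (\<Delta> k)) \<le> (\<Sum>k\<in>G. 1 / sqrt ?n)" by (intro sum_mono E\<Delta>)
  also have "\<dots> = real (card G) / sqrt ?n" by simp
  finally show ?thesis using R_nonneg by (simp add: mult_left_mono)
qed

text \<open>The depth comes first, to make the frequency part small. The number of cells is then
  fixed, so a slab error and a mesh can be chosen against it, and finally the deviation on the
  finite grid vanishes as the training set grows.\<close>

lemma mean_width_small:
  assumes \<eta>: "0 < \<eta>"
  shows "\<exists>J. \<forall>\<^sub>F n in sequentially. expectation (mean_width J n) \<le> \<eta>"
proof -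
  obtain \<rho> where \<rho>: "0 \<le> \<rho>" "\<rho> < 1"
    and decay: "\<And>n b m J. b < B n \<Longrightarrow>
     (\<Sum>p | length p = J. expectation (\<lambda>\<omega>. cell_count n b p \<omega> * cell_width R (T n b \<omega>) p m))
       \<le> \<rho> ^ J * (real (card (I1 n)) * (2 * R))"
    using count_width_decay R_nonneg by blast
  let ?\<nu> = "real CARD('n)"
  have "(\<lambda>J. ?\<nu> * (\<rho> ^ J * (2 * R))) \<longlonglongrightarrow> ?\<nu> * (0 * (2 * R))"
    using \<rho> by (intro tendsto_intros LIMSEQ_power_zero) auto
  then have "\<forall>\<^sub>F J in sequentially. ?\<nu> * (\<rho> ^ J * (2 * R)) < \<eta> / 2"
    by (rule order_tendstoD) (use \<eta> in simp)
  then obtain J where J: "?\<nu> * (\<rho> ^ J * (2 * R)) < \<eta> / 2"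
    by (auto dest: eventually_happens)
  \<comment> \<open>The factor of the slab error in the final bound: directions, times cells, times
    largest width, times ancestors per cell.\<close>
  define a where "a = ?\<nu> * 2 ^ J * (2 * R) * real J"
  have a: "0 \<le> a" using R_nonneg by (simp add: a_def)
  define \<epsilon> where "\<epsilon> = \<eta> / 2 / (a + 1)"
  have \<epsilon>: "0 < \<epsilon>" using a \<eta> by (simp add: \<epsilon>_def)
  have a\<epsilon>: "a * \<epsilon> < \<eta> / 2" using a \<eta> by (simp add: \<epsilon>_def field_simps)
  obtain \<delta> where \<delta>: "0 < \<delta>" "\<And>m k. measure \<mu> {x. grid_index \<delta> x m = k} \<le> \<epsilon>"
    using small_slabs[OF \<epsilon>] by blast
  define g where "g = real (card (grid_index \<delta> ` {x :: real ^ 'n. \<forall>m. \<bar>x $ m\<bar> \<le> R}))"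
  define bound where "bound n = ?\<nu> * (\<rho> ^ J * (2 * R) + 2 ^ J * (2 * R * (g / sqrt (real (card (I1 n))) + real J * \<epsilon>)))" for n
  have "(\<lambda>n. g / sqrt (real (card (I1 n)))) \<longlonglongrightarrow> 0"
    by (intro real_tendsto_divide_at_top[OF tendsto_const] filterlim_compose[OF sqrt_at_top]
        filterlim_compose[OF filterlim_real_sequentially] train_size)
  then have "bound \<longlonglongrightarrow> ?\<nu> * (\<rho> ^ J * (2 * R) + 2 ^ J * (2 * R * (0 + real J * \<epsilon>)))"
    unfolding bound_def by (intro tendsto_intros)
  moreover have "?\<nu> * (\<rho> ^ J * (2 * R) + 2 ^ J * (2 * R * (0 + real J * \<epsilon>))) < \<eta>"
  proof -
    have "?\<nu> * (\<rho> ^ J * (2 * R) + 2 ^ J * (2 * R * (0 + real J * \<epsilon>))) = ?\<nu> * (\<rho> ^ J * (2 * R)) + a * \<epsilon>"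
      by (simp add: a_def algebra_simps)
    then show ?thesis using J a\<epsilon> by linarith
  qed
  ultimately have "\<forall>\<^sub>F n in sequentially. bound n < \<eta>" by (rule order_tendstoD)
  moreover have "\<forall>\<^sub>F n in sequentially. 1 \<le> card (I1 n)"
    using train_size unfolding filterlim_at_top by blast
  ultimately have "\<forall>\<^sub>F n in sequentially. expectation (mean_width J n) \<le> \<eta>"
  proof eventually_elim
    case (elim n)
    let ?n = "real (card (I1 n))"
    have cancel: "a * (x * c) / x = a * c" if "0 < x" for a x c :: real using that by simp
    define e where "e = 2 * R * (g / sqrt ?n + real J * \<epsilon>)"
    have "(\<Sum>p | length p = J. expectation (\<lambda>\<omega>. measure \<mu> (region (T n b \<omega>) p) * cell_width R (T n b \<omega>) p m))
        \<le> \<rho> ^ J * (2 * R) + 2 ^ J * e" if b: "b < B n" for b m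
    proof -
      have "(\<Sum>p | length p = J. expectation (\<lambda>\<omega>. measure \<mu> (region (T n b \<omega>) p) * cell_width R (T n b \<omega>) p m))
        \<le> (\<Sum>p | length p = J. expectation (\<lambda>\<omega>. cell_count n b p \<omega> * cell_width R (T n b \<omega>) p m) / ?n + e)"
        using expectation_cell_le[OF b elim(2) \<delta>] by (intro sum_mono) (auto simp: e_def g_def)
      also have "\<dots> = (\<Sum>p | length p = J. expectation (\<lambda>\<omega>. cell_count n b p \<omega> * cell_width R (T n b \<omega>) p m)) / ?n + 2 ^ J * e"
        by (simp add: sum.distrib card_bool_lists sum_divide_distrib)
      also have "\<dots> \<le> \<rho> ^ J * (?n * (2 * R)) / ?n + 2 ^ J * e"
        by (intro add_right_mono divide_right_mono decay[OF b]) simp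
      also have "\<rho> ^ J * (?n * (2 * R)) / ?n = \<rho> ^ J * (2 * R)"
        by (rule cancel) (use elim(2) in linarith)
      finally show ?thesis .
    qed
    then have "expectation (mean_width J n) \<le> 1 / real (B n) * (\<Sum>b<B n. \<Sum>m\<in>(UNIV::'n set). \<rho> ^ J * (2 * R) + 2 ^ J * e)"
      unfolding expectation_mean_width by (intro mult_left_mono sum_mono) auto
    also have "\<dots> = bound n" using B_pos[of n] by (simp add: bound_def e_def)
    finally show ?case using elim by simp
  qed
  then show ?thesis by blast
qed

section \<open>From cell widths to the bias at the test point\<close>

abbreviation weight :: "nat \<Rightarrow> 'w \<Rightarrow> real ^ 'n \<Rightarrow> nat \<Rightarrow> real" where
  "weight n \<omega> x i \<equiv> forest_weight (I1 n) (\<lambda>i. Xs i \<omega>) (B n) (\<lambda>b. T n b \<omega>) x i"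

text \<open>The weighted l1-distance from the test point to the training points used for it; times
  the Lipschitz constant it bounds the bias.\<close>

definition leaf_spread :: "nat \<Rightarrow> 'w \<Rightarrow> real" where
  "leaf_spread n \<omega> = (\<Sum>i\<in>I1 n. weight n \<omega> (X \<omega>) i * (\<Sum>m\<in>UNIV. \<bar>Xs i \<omega> $ m - X \<omega> $ m\<bar>))"

lemma weight_measurable [measurable]:
  "i \<in> I1 n \<Longrightarrow> (\<lambda>\<omega>. weight n \<omega> (X \<omega>) i) \<in> borel_measurable M"
  using I_ge_1(1) by (intro forest_weight_measurable) auto

lemma leaf_spread_measurable [measurable]: "leaf_spread n \<in> borel_measurable M"
  unfolding leaf_spread_def[abs_def] using I_ge_1(1)[of _ n] by measurable

text \<open>A training point has positive weight in a tree only if it shares the leaf of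
  \<open>X\<close>, hence also every ancestor of that leaf.\<close>

lemma leaf_spread_le_mean_width:
  assumes X: "X \<omega> \<in> \<X>" and Xs: "\<And>i. i \<ge> 1 \<Longrightarrow> Xs i \<omega> \<in> \<X>"
    and deep: "\<And>b. b < B n \<Longrightarrow> J \<le> length (leaf_of (T n b \<omega>) (X \<omega>))"
  shows "leaf_spread n \<omega> \<le> mean_width J n \<omega>"
proof -
  let ?d = "\<lambda>i. \<Sum>m\<in>UNIV. \<bar>Xs i \<omega> $ m - X \<omega> $ m\<bar>"
  let ?tw = "\<lambda>b i. tree_weight (I1 n) (\<lambda>i. Xs i \<omega>) (T n b \<omega>) (X \<omega>) i"
  have "(\<Sum>i\<in>I1 n. ?tw b i * ?d i) \<le> (\<Sum>m\<in>UNIV. \<Sum>p | length p = J.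
      indicat_real (region (T n b \<omega>) p) (X \<omega>) * cell_width R (T n b \<omega>) p m)" if b: "b < B n" for b
  proof -
    let ?t = "T n b \<omega>"
    define l where "l = leaf_of ?t (X \<omega>)"
    \<comment> \<open>The ancestor at depth \<open>J\<close>. By assumption the leaf is at least
      that deep, so \<open>p\<close> has length exactly \<open>J\<close> and occurs in the
      sum.\<close>
    define p where "p = take J l"
    define W where "W = (\<Sum>m\<in>UNIV. cell_width R ?t p m)"
    have Xl: "X \<omega> \<in> region ?t l" unfolding l_def by (rule in_region_leaf_of)
    then have Xp: "X \<omega> \<in> region ?t p" using region_take unfolding p_def by blast
    have W: "0 \<le> W" by (simp add: W_def sum_nonneg)
    have "(\<Sum>i\<in>I1 n. ?tw b i * ?d i) \<le> (\<Sum>i\<in>I1 n. ?tw b i * W)"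
    proof (rule sum_mono)
      fix i assume i: "i \<in> I1 n"
      show "?tw b i * ?d i \<le> ?tw b i * W"
      proof (cases "Xs i \<omega> \<in> region ?t l")
        case True
        then have "Xs i \<omega> \<in> region ?t p" using region_take unfolding p_def by blast
        then have "?d i \<le> W" unfolding W_def
          using Xp X Xs I_ge_1(1)[OF i] by (intro sum_mono dist_le_cell_width abs_le_R) auto
        then show ?thesis by (intro mult_left_mono) auto
      qed (simp add: tree_weight_def l_def)
    qed
    also have "\<dots> = (\<Sum>i\<in>I1 n. ?tw b i) * W" by (simp add: sum_distrib_right)
    also have "\<dots> \<le> 1 * W" using W by (intro mult_right_mono) (auto simp: tree_weight_sum)
    also have "\<dots> \<le> (\<Sum>m\<in>UNIV. \<Sum>p | length p = J.
      indicat_real (region ?t p) (X \<omega>) * cell_width R ?t p m)"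
    proof -
      have len: "length p = J" using deep[OF b] by (simp add: p_def l_def)
      have "cell_width R ?t p m \<le> (\<Sum>p | length p = J. indicat_real (region ?t p) (X \<omega>) * cell_width R ?t p m)" for m
        using member_le_sum[of p "{p. length p = J}" "\<lambda>p. indicat_real (region ?t p) (X \<omega>) * cell_width R ?t p m"]
          finite_bool_lists len Xp by simp
      then show ?thesis unfolding W_def by (simp add: sum_mono)
    qed
    finally show ?thesis .
  qed
  then have *: "(\<Sum>b<B n. \<Sum>i\<in>I1 n. ?tw b i * ?d i) \<le> (\<Sum>b<B n. \<Sum>m\<in>UNIV. \<Sum>p | length p = J.
      indicat_real (region (T n b \<omega>) p) (X \<omega>) * cell_width R (T n b \<omega>) p m)"
    by (intro sum_mono) auto
  have "leaf_spread n \<omega> = 1 / real (B n) * (\<Sum>i\<in>I1 n. \<Sum>b<B n. ?tw b i * ?d i)"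
  proof -
    have "(\<Sum>i\<in>I. (c * (\<Sum>b<N. w b i)) * d i) = c * (\<Sum>i\<in>I. \<Sum>b<N. w b i * d i)"
      for I :: "nat set" and N :: nat and c :: real and w d
      by (simp add: sum_distrib_left sum_distrib_right mult.assoc)
    then show ?thesis unfolding leaf_spread_def forest_weight_def .
  qed
  also have "(\<Sum>i\<in>I1 n. \<Sum>b<B n. ?tw b i * ?d i) = (\<Sum>b<B n. \<Sum>i\<in>I1 n. ?tw b i * ?d i)"
    by (rule sum.swap)
  finally show ?thesis unfolding mean_width_def using * by (simp only: mult_left_mono zero_le_divide_1_iff of_nat_0_le_iff)
qed

lemma leaf_spread_tendsto_0:
  assumes e: "0 < e"
  shows "(\<lambda>n. prob {\<omega> \<in> space M. e \<le> leaf_spread n \<omega>}) \<longlonglongrightarrow> 0"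
proof (rule LIMSEQ_I)
  fix r :: real assume r: "0 < r"
  \<comment> \<open>With this mean, the Markov inequality at level \<open>e\<close> leaves
    \<open>r / 4\<close>; shallow leaves cost another \<open>r / 4\<close>.\<close>
  obtain J where J: "\<forall>\<^sub>F n in sequentially. expectation (mean_width J n) \<le> e * (r / 4)"
    using mean_width_small[of "e * (r / 4)"] e r by auto
  \<comment> \<open>Some leaf of \<open>X\<close> is shallower than \<open>J\<close>. Listing the
    finitely many short addresses makes the event visibly measurable.\<close>
  define bad where "bad n \<omega> \<longleftrightarrow> (\<exists>b\<in>{..<B n}. \<exists>j\<in>{..<J}. \<exists>l\<in>{l. length l = j}. leaf_of (T n b \<omega>) (X \<omega>) = l)" for n \<omega>
  have bad[measurable]: "Measurable.pred M (bad n)" for n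
  proof -
    have [measurable]: "Measurable.pred M (\<lambda>\<omega>. leaf_of (T n b \<omega>) (X \<omega>) = l)" if "b \<in> {..<B n}" for b l
      using that by (intro pred_leaf_of) auto
    show ?thesis unfolding bad_def[abs_def]
      by (intro pred_intros_finite finite_bool_lists) auto
  qed
  have bad_iff: "\<not> bad n \<omega> \<longleftrightarrow> (\<forall>b<B n. J \<le> length (leaf_of (T n b \<omega>) (X \<omega>)))" for n \<omega>
    by (auto simp: bad_def not_less)
  have "(\<lambda>n. prob {\<omega> \<in> space M. bad n \<omega>}) \<longlonglongrightarrow> 0"
  proof (rule AE_eventually_imp_prob_tendsto_0[OF bad])
    show "AE \<omega> in M. \<forall>\<^sub>F n in sequentially. \<not> bad n \<omega>"
      using AE_leaves_deep
    proof eventually_elim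
      case (elim \<omega>)
      from elim[rule_format, of J] show ?case
        by eventually_elim (auto simp: bad_iff leaf_of_in_leaves)
    qed
  qed
  then have "\<forall>\<^sub>F n in sequentially. prob {\<omega> \<in> space M. bad n \<omega>} < r / 4"
    by (rule order_tendstoD) (use r in simp)
  with J have "\<forall>\<^sub>F n in sequentially. prob {\<omega> \<in> space M. e \<le> leaf_spread n \<omega>} < r"
  proof eventually_elim
    case (elim n)
    have "prob {\<omega> \<in> space M. e \<le> leaf_spread n \<omega>}
        \<le> prob ({\<omega> \<in> space M. e \<le> mean_width J n \<omega>} \<union> {\<omega> \<in> space M. bad n \<omega>})"
    proof (rule finite_measure_mono_AE)
      show "AE \<omega> in M. \<omega> \<in> {\<omega> \<in> space M. e \<le> leaf_spread n \<omega>} \<longrightarrow>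
        \<omega> \<in> {\<omega> \<in> space M. e \<le> mean_width J n \<omega>} \<union> {\<omega> \<in> space M. bad n \<omega>}"
        using AE_X_support AE_Xs_support
      proof eventually_elim
        case (elim \<omega>)
        then show ?case
          using leaf_spread_le_mean_width[of \<omega> n J] bad_iff[of n \<omega>] by fastforce
      qed
    qed measurable
    also have "\<dots> \<le> prob {\<omega> \<in> space M. e \<le> mean_width J n \<omega>} + prob {\<omega> \<in> space M. bad n \<omega>}"
      by (intro measure_Un_le) measurable
    also have "prob {\<omega> \<in> space M. e \<le> mean_width J n \<omega>} \<le> expectation (mean_width J n) / e"
      using integral_Markov_inequality_measure[OF mean_width_integrable sets.empty_sets, where c=e] mean_width_nonneg e
      by simp
    also have "\<dots> \<le> e * (r / 4) / e" using elim(1) e by (intro divide_right_mono) auto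
    finally show ?case using elim(2) e r by simp
  qed
  then show "\<exists>no. \<forall>n\<ge>no. norm (prob {\<omega> \<in> space M. e \<le> leaf_spread n \<omega>} - 0) < r"
    by (simp add: eventually_sequentially)
qed

end

lemma forest_weight_cong:
  assumes "i \<in> I" "\<And>j. j \<in> I \<Longrightarrow> x j = x' j" "\<And>b. b < B \<Longrightarrow> T b = T' b"
  shows "forest_weight I x B T z i = forest_weight I x' B T' z i"
proof -
  have "tree_weight I x (T b) z i = tree_weight I x' (T' b) z i" if "b < B" for b
  proof -
    have "{j \<in> I. x j \<in> A} = {j \<in> I. x' j \<in> A}" for A using assms(2) by auto
    then show ?thesis using assms(1,2) assms(3)[OF that] by (simp add: tree_weight_def node_count_def)
  qed
  then show ?thesis by (simp add: forest_weight_def)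
qed

context forest_setting
begin

section \<open>Conditional quantiles and the stochastic error of the forest\<close>

definition quantile :: "real \<Rightarrow> real ^ 'n \<Rightarrow> real" where
  "quantile \<beta> x = Inf {y. \<beta> \<le> cdf (K x) y}"

lemma K_measurable [measurable]: "K \<in> borel \<rightarrow>\<^sub>M prob_algebra borel"
  using cond_dist by (simp add: is_regular_cond_dist_def)

lemma K_real_distribution: "real_distribution (K x)"
proof -
  have "K x \<in> space (prob_algebra borel)" by (rule measurable_space[OF K_measurable]) simp
  then show ?thesis
    by (auto simp: space_prob_algebra real_distribution_def real_distribution_axioms_def)
qed

text \<open>Joint measurability in the point and the threshold, from the kernel property applied to
  a measurable family of half-lines.\<close>

lemma cdf_K_measurable:
  assumes [measurable]: "f \<in> borel_measurable N" "g \<in> borel_measurable N"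
  shows "(\<lambda>w. cdf (K (f w)) (g w)) \<in> borel_measurable N"
proof -
  have "(\<lambda>w. measure (K (f w)) {..g w}) \<in> borel_measurable N"
  proof (rule measure_measurable_subprob_algebra2)
    have "{z \<in> space (N \<Otimes>\<^sub>M borel). snd z \<le> g (fst z)} \<in> sets (N \<Otimes>\<^sub>M borel)" by measurable
    also have "{z \<in> space (N \<Otimes>\<^sub>M borel). snd z \<le> g (fst z)} = (SIGMA w:space N. {..g w})"
      by (auto simp: space_pair_measure)
    finally show "(SIGMA w:space N. {..g w}) \<in> sets (N \<Otimes>\<^sub>M borel)" .
    show "(\<lambda>w. K (f w)) \<in> N \<rightarrow>\<^sub>M subprob_algebra borel"
      by (rule measurable_prob_algebraD) measurable
  qed
  then show ?thesis by (simp add: cdf_def)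
qed

lemma cdf_K_bounds: "0 \<le> cdf (K x) y" "cdf (K x) y \<le> 1"
proof -
  interpret Kx: real_distribution "K x" by (rule K_real_distribution)
  show "0 \<le> cdf (K x) y" "cdf (K x) y \<le> 1" by (rule Kx.cdf_nonneg Kx.cdf_bounded_prob)+
qed

lemma cdf_K_mono: "y \<le> z \<Longrightarrow> cdf (K x) y \<le> cdf (K x) z"
proof -
  interpret Kx: real_distribution "K x" by (rule K_real_distribution)
  show "y \<le> z \<Longrightarrow> cdf (K x) y \<le> cdf (K x) z" by (rule Kx.cdf_nondecreasing)
qed

lemma quantile_le_iff:
  assumes "0 < \<beta>" "\<beta> < 1"
  shows "quantile \<beta> x \<le> y \<longleftrightarrow> \<beta> \<le> cdf (K x) y"
proof -
  interpret Kx: real_distribution "K x" by (rule K_real_distribution)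
  interpret r: right_continuous_mono "cdf (K x)" 0 1
    by (intro right_continuous_mono.intro monoI Kx.cdf_nondecreasing Kx.cdf_is_right_cont
        Kx.cdf_lim_at_top_prob Kx.cdf_lim_at_bot)
  show ?thesis unfolding quantile_def by (rule r.pseudoinverse[OF assms, symmetric])
qed

lemma quantile_measurable [measurable]:
  assumes "0 < \<beta>" "\<beta> < 1"
  shows "quantile \<beta> \<in> borel_measurable borel"
proof (rule borel_measurableI_le)
  fix c
  have "(\<lambda>x. cdf (K x) c) \<in> borel_measurable borel" by (rule cdf_K_measurable) auto
  then have "{x \<in> space borel. \<beta> \<le> cdf (K x) c} \<in> sets borel" by measurable
  then show "{x \<in> space borel. quantile \<beta> x \<le> c} \<in> sets borel"
    by (simp add: quantile_le_iff[OF assms])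
qed

lemma isCont_cdf_K:
  assumes "x \<in> \<X>"
  shows "isCont (cdf (K x)) y"
proof -
  interpret Kx: real_distribution "K x" by (rule K_real_distribution)
  obtain h where h: "continuous_on UNIV h" "K x = density lborel (\<lambda>y. ennreal (h y))"
    using Y_density assms by blast
  then have [measurable]: "h \<in> borel_measurable borel" by (intro borel_measurable_continuous_onI)
  have "emeasure (K x) {y} = (\<integral>\<^sup>+z\<in>{y}. ennreal (h z) \<partial>lborel)"
    unfolding h(2) by (intro emeasure_density) auto
  also have "\<dots> = 0"
    by (subst nn_integral_0_iff_AE) (auto intro!: AE_I'[of "{y}"] simp: indicator_def)
  finally show ?thesis by (simp add: Kx.isCont_cdf measure_def)
qed

text \<open>To the left of the quantile the distribution function is below \<beta>; continuity,
  which comes from the density, carries this bound to the quantile itself.\<close>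

lemma cdf_quantile:
  assumes \<beta>: "0 < \<beta>" "\<beta> < 1" and x: "x \<in> \<X>"
  shows "cdf (K x) (quantile \<beta> x) = \<beta>"
proof (rule antisym)
  show "\<beta> \<le> cdf (K x) (quantile \<beta> x)" using quantile_le_iff[OF \<beta>, of x "quantile \<beta> x"] by simp
  have "(cdf (K x) \<longlongrightarrow> cdf (K x) (quantile \<beta> x)) (at_left (quantile \<beta> x))"
    using isCont_cdf_K[OF x] unfolding isCont_def
    by (rule tendsto_mono[OF at_le[OF subset_UNIV]])
  moreover have "\<forall>\<^sub>F y in at_left (quantile \<beta> x). cdf (K x) y \<le> \<beta>"
    unfolding eventually_at_left_field
  proof (intro exI[of _ "quantile \<beta> x - 1"] conjI allI impI)
    fix y assume "y < quantile \<beta> x"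
    then show "cdf (K x) y \<le> \<beta>" using quantile_le_iff[OF \<beta>, of x y] by linarith
  qed simp
  ultimately show "cdf (K x) (quantile \<beta> x) \<le> \<beta>"
    by (intro tendsto_upperbound) auto
qed

text \<open>A supremum of reals dominates its members once the family is bounded, and two
  distribution functions differ by at most 1.\<close>

lemma cdf_K_lipschitz:
  "\<exists>C>0. \<forall>x\<in>\<X>. \<forall>x'\<in>\<X>. \<forall>y. \<bar>cdf (K x) y - cdf (K x') y\<bar> \<le> C * (\<Sum>m\<in>UNIV. \<bar>x $ m - x' $ m\<bar>)"
proof -
  obtain C where C: "C > 0" "\<And>x x'. x \<in> \<X> \<Longrightarrow> x' \<in> \<X> \<Longrightarrow>
        (SUP y. \<bar>cdf (K x) y - cdf (K x') y\<bar>) \<le> C * (\<Sum>j\<in>UNIV. \<bar>x $ j - x' $ j\<bar>)"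
    using lipschitz by blast
  have "\<bar>cdf (K x) y - cdf (K x') y\<bar> \<le> (SUP y. \<bar>cdf (K x) y - cdf (K x') y\<bar>)" for x x' y
  proof (rule cSUP_upper)
    show "bdd_above (range (\<lambda>y. \<bar>cdf (K x) y - cdf (K x') y\<bar>))"
    proof (rule bdd_aboveI[of _ 1])
      fix r assume "r \<in> range (\<lambda>y. \<bar>cdf (K x) y - cdf (K x') y\<bar>)"
      then obtain y where "r = \<bar>cdf (K x) y - cdf (K x') y\<bar>" by auto
      then show "r \<le> 1" using cdf_K_bounds[of x y] cdf_K_bounds[of x' y] by linarith
    qed
  qed simp
  then show ?thesis using C by (meson order_trans)
qed

text \<open>The defining property of the conditional law: given the covariate, the centred indicator
  of the response has mean 0, also after multiplication by a bounded function of the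
  covariate.\<close>

lemma integral_cond_centred:
  fixes h :: "real ^ 'n \<Rightarrow> real"
  assumes h[measurable]: "h \<in> borel_measurable borel" and bd: "\<And>x. \<bar>h x\<bar> \<le> a"
  shows "(\<integral>z. h (fst z) * (of_bool (snd z \<le> c) - cdf (K (fst z)) c) \<partial>P) = 0"
proof -
  interpret mu: prob_space \<mu> by (rule prob_space_mu)
  have Kc[measurable]: "(\<lambda>x. cdf (K x) c) \<in> borel_measurable borel" by (rule cdf_K_measurable) auto
  \<comment> \<open>Restricting the probability to the event \<open>Y \<le> c\<close> and pushing it
    forward by \<open>X\<close> gives the law of \<open>X\<close> with density
    \<open>cdf (K x) c\<close>, which is the conditional law read on rectangles.\<close>
  define \<nu> where "\<nu> = density M (\<lambda>\<omega>. ennreal (of_bool (Y \<omega> \<le> c)))"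
  have dens: "distr \<nu> borel X = density \<mu> (\<lambda>x. ennreal (cdf (K x) c))"
  proof (rule measure_eqI)
    fix A assume "A \<in> sets (distr \<nu> borel X)"
    then have A[measurable]: "A \<in> sets borel" by simp
    have "emeasure (distr \<nu> borel X) A = emeasure \<nu> (X -` A \<inter> space M)"
      by (simp add: emeasure_distr \<nu>_def)
    also have "\<dots> = (\<integral>\<^sup>+\<omega>\<in>X -` A \<inter> space M. ennreal (of_bool (Y \<omega> \<le> c)) \<partial>M)"
      unfolding \<nu>_def by (intro emeasure_density) measurable
    also have "\<dots> = (\<integral>\<^sup>+\<omega>. indicator {\<omega> \<in> space M. X \<omega> \<in> A \<and> Y \<omega> \<in> {..c}} \<omega> \<partial>M)"
      by (intro nn_integral_cong) (auto simp: indicator_def)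
    also have "\<dots> = emeasure M {\<omega> \<in> space M. X \<omega> \<in> A \<and> Y \<omega> \<in> {..c}}" by simp
    also have "\<dots> = (\<integral>\<^sup>+x\<in>A. emeasure (K x) {..c} \<partial>\<mu>)"
      using cond_dist[unfolded is_regular_cond_dist_def, THEN conjunct2, rule_format, OF A, of "{..c}"]
      by (simp add: \<mu>_def)
    also have "\<dots> = (\<integral>\<^sup>+x\<in>A. ennreal (cdf (K x) c) \<partial>\<mu>)"
    proof -
      have "emeasure (K x) {..c} = ennreal (cdf (K x) c)" for x
      proof -
        interpret Kx: real_distribution "K x" by (rule K_real_distribution)
        show ?thesis by (simp add: cdf_def Kx.emeasure_eq_measure)
      qed
      then show ?thesis by simp
    qed
    also have "\<dots> = emeasure (density \<mu> (\<lambda>x. ennreal (cdf (K x) c))) A"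
      by (intro emeasure_density[symmetric]) auto
    finally show "emeasure (distr \<nu> borel X) A = emeasure (density \<mu> (\<lambda>x. ennreal (cdf (K x) c))) A" .
  qed simp
  have a: "0 \<le> a" using order_trans[OF abs_ge_zero bd] .
  have int1: "integrable M (\<lambda>\<omega>. h (X \<omega>) * of_bool (Y \<omega> \<le> c))"
    using bd a by (intro integrable_const_bound[where B=a]) (auto simp: abs_mult)
  have int2: "integrable M (\<lambda>\<omega>. h (X \<omega>) * cdf (K (X \<omega>)) c)"
  proof (rule integrable_const_bound[where B="a * 1"])
    show "AE \<omega> in M. norm (h (X \<omega>) * cdf (K (X \<omega>)) c) \<le> a * 1"
      using bd a cdf_K_bounds unfolding real_norm_def abs_mult by (intro AE_I2 mult_mono) auto
  qed (use cdf_K_measurable in measurable)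
  have "expectation (\<lambda>\<omega>. h (X \<omega>) * of_bool (Y \<omega> \<le> c)) = (\<integral>\<omega>. h (X \<omega>) \<partial>\<nu>)"
    unfolding \<nu>_def by (subst integral_density) (auto simp: mult.commute)
  also have "\<dots> = (\<integral>x. h x \<partial>distr \<nu> borel X)"
    by (subst integral_distr) (auto simp: \<nu>_def)
  also have "\<dots> = (\<integral>x. cdf (K x) c * h x \<partial>\<mu>)"
    unfolding dens by (subst integral_density) (auto simp: cdf_K_bounds)
  also have "\<dots> = expectation (\<lambda>\<omega>. h (X \<omega>) * cdf (K (X \<omega>)) c)"
    unfolding \<mu>_def by (subst integral_distr) (auto simp: mult.commute)
  finally have eq: "expectation (\<lambda>\<omega>. h (X \<omega>) * of_bool (Y \<omega> \<le> c)) = expectation (\<lambda>\<omega>. h (X \<omega>) * cdf (K (X \<omega>)) c)" .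
  have meas: "(\<lambda>z. h (fst z) * (of_bool (snd z \<le> c) - cdf (K (fst z)) c)) \<in> borel_measurable (borel :: ((real ^ 'n) \<times> real) measure)"
    using fst_snd_borel cdf_K_measurable[OF fst_snd_borel(1), of "\<lambda>_. c"] by measurable
  have "(\<integral>z. h (fst z) * (of_bool (snd z \<le> c) - cdf (K (fst z)) c) \<partial>P)
      = expectation (\<lambda>\<omega>. h (X \<omega>) * (of_bool (Y \<omega> \<le> c) - cdf (K (X \<omega>)) c))"
    unfolding P_def using meas by (subst integral_distr) auto
  also have "\<dots> = expectation (\<lambda>\<omega>. h (X \<omega>) * of_bool (Y \<omega> \<le> c)) - expectation (\<lambda>\<omega>. h (X \<omega>) * cdf (K (X \<omega>)) c)"
    using int1 int2 by (simp add: right_diff_distrib)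
  finally show ?thesis using eq by simp
qed

definition weight_of ::
    "nat \<Rightarrow> (nat \<Rightarrow> (real ^ 'n) \<times> real) \<times> (nat \<Rightarrow> 'c) \<Rightarrow> real ^ 'n \<Rightarrow> nat \<Rightarrow> real" where
  "weight_of n D x i = forest_weight (I1 n) (\<lambda>i. fst (fst D i)) (B n) (\<lambda>b. tree_of n b D) x i"

lemma train_apply: "i \<in> I1 n \<Longrightarrow> train n \<omega> i = (Xs i \<omega>, Ys i \<omega>)"
  by (simp add: train_eq(1))

lemma weight_of_eq: "i \<in> I1 n \<Longrightarrow> weight_of n (train n \<omega>, \<Theta> n \<omega>) x i = weight n \<omega> x i"
  unfolding weight_of_def by (intro forest_weight_cong) (auto simp: train_apply tree_of_eq)

lemma train_component_measurable:
  assumes "i \<in> I1 n"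
  shows "(\<lambda>d. d i) \<in> trainM n \<rightarrow>\<^sub>M borel" "(\<lambda>d. fst (d i)) \<in> trainM n \<rightarrow>\<^sub>M borel" "(\<lambda>d. snd (d i)) \<in> trainM n \<rightarrow>\<^sub>M borel"
proof -
  show *: "(\<lambda>d. d i) \<in> trainM n \<rightarrow>\<^sub>M borel"
    unfolding train_eq(2) using assms by (rule measurable_component_singleton)
  show "(\<lambda>d. fst (d i)) \<in> trainM n \<rightarrow>\<^sub>M borel" "(\<lambda>d. snd (d i)) \<in> trainM n \<rightarrow>\<^sub>M borel"
    by (rule measurable_compose[OF * fst_snd_borel(1)] measurable_compose[OF * fst_snd_borel(2)])+
qed

lemma weight_of_measurable [measurable]:
  assumes i: "i \<in> I1 n"
  shows "(\<lambda>z. weight_of n (fst z) (snd z) i) \<in> borel_measurable ((trainM n \<Otimes>\<^sub>M \<Theta>M n) \<Otimes>\<^sub>M borel)"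
  unfolding weight_of_def
proof (intro forest_weight_measurable i finite_I)
  show "(\<lambda>z. tree_of n b (fst z)) \<in> (trainM n \<Otimes>\<^sub>M \<Theta>M n) \<Otimes>\<^sub>M borel \<rightarrow>\<^sub>M tree_space" if "b < B n" for b
    by (rule measurable_compose[OF measurable_fst tree_of_measurable[OF that]])
  show "(\<lambda>z. fst (fst (fst z) j)) \<in> borel_measurable ((trainM n \<Otimes>\<^sub>M \<Theta>M n) \<Otimes>\<^sub>M borel)" if "j \<in> I1 n" for j
    by (rule measurable_compose[OF measurable_compose[OF measurable_fst measurable_fst] train_component_measurable(2)[OF that]])
qed measurable

text \<open>By honesty the tree sees only covariates, and the weights see only covariates and trees.
  The response 0 is an arbitrary placeholder that makes the independence of the \<open>i\<close>-th
  response explicit.\<close>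

lemma weight_of_honest:
  assumes i: "i \<in> I1 n" and d: "d \<in> space (Pi\<^sub>M (I1 n - {i}) (\<lambda>_. borel))" and t: "t \<in> space (\<Theta>M n)"
    and k: "k \<in> I1 n"
  shows "weight_of n (d(i := z), t) x k = weight_of n (d(i := (fst z, 0)), t) x k"
  unfolding weight_of_def
proof (intro forest_weight_cong k)
  show "fst (fst (d(i := z), t) j) = fst (fst (d(i := (fst z, 0)), t) j)" for j by simp
  fix b assume b: "b < B n"
  have sp: "d(i := u) \<in> space (trainM n)" for u
    using d i unfolding train_eq(2) by (auto simp: space_PiM PiE_def extensional_def)
  have "t b \<in> space S" using t b by (auto simp: Theta_eq(2) space_PiM PiE_def Pi_def)
  then show "tree_of n b (d(i := z), t) = tree_of n b (d(i := (fst z, 0)), t)"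
    unfolding tree_of_def by (simp, intro honest_splits sp) auto
qed

text \<open>Fix the test point, the forest randomness and all training pairs except the
  \<open>i\<close>-th. The weights then depend on that pair through its covariate only, and the
  residual of index \<open>j\<close> not at all, so integrating over the \<open>i\<close>-th pair
  gives 0.\<close>

lemma residuals_orthogonal:
  assumes q[measurable]: "q \<in> borel_measurable borel" and ij: "i \<in> I1 n" "j \<in> I1 n" "i \<noteq> j"
  shows "expectation (\<lambda>\<omega>.
     (weight n \<omega> (X \<omega>) i * (of_bool (Ys i \<omega> \<le> q (X \<omega>)) - cdf (K (Xs i \<omega>)) (q (X \<omega>)))) *
     (weight n \<omega> (X \<omega>) j * (of_bool (Ys j \<omega> \<le> q (X \<omega>)) - cdf (K (Xs j \<omega>)) (q (X \<omega>))))) = 0"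
proof -
  let ?W = "trainM n \<Otimes>\<^sub>M \<Theta>M n" and ?L = "trainL n \<Otimes>\<^sub>M \<Theta>L n"
  interpret mu: prob_space \<mu> by (rule prob_space_mu)
  interpret tr: prob_space "trainL n" by (rule prob_space_trainL)
  interpret Th: prob_space "\<Theta>L n" by (rule prob_space_ThetaL)
  interpret TT: pair_prob_space "trainL n" "\<Theta>L n" ..
  interpret LM: pair_prob_space ?L \<mu> ..
  interpret P: prob_space P by (rule prob_space_P)
  interpret PI: product_sigma_finite "\<lambda>_::nat. P" by standard
  have sL[measurable_cong]: "sets ?L = sets ?W" by (intro sets_pair_measure_cong) auto
  define r where "r k d x = of_bool (snd (d k) \<le> q x) - cdf (K (fst (d k))) (q x)" for k and d :: "nat \<Rightarrow> (real ^ 'n) \<times> real" and x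
  define H where "H D x = (weight_of n D x i * r i (fst D) x) * (weight_of n D x j * r j (fst D) x)" for D x
  have r_bd: "\<bar>r k d x\<bar> \<le> 1" for k d x
    unfolding r_def using cdf_K_bounds[of "fst (d k)" "q x"] by auto
  have w_bd: "0 \<le> weight_of n D x k" "weight_of n D x k \<le> 1" if "k \<in> I1 n" for D x k
    unfolding weight_of_def using B_pos that by (auto intro: forest_weight_le_1)
  have H_bd: "\<bar>H D x\<bar> \<le> 1" for D x
  proof -
    have *: "\<bar>weight_of n D x k * r k (fst D) x\<bar> \<le> 1 * 1" if "k \<in> I1 n" for k
      unfolding abs_mult using w_bd[OF that] r_bd by (intro mult_mono) auto
    show ?thesis unfolding H_def abs_mult[of "weight_of n D x i * r i (fst D) x"]
      using mult_mono[OF *[OF ij(1)] *[OF ij(2)]] by simp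
  qed
  have r_meas: "(\<lambda>z. r k (fst (fst z)) (snd z)) \<in> borel_measurable (?W \<Otimes>\<^sub>M borel)" if "k \<in> I1 n" for k
  proof -
    have f: "(\<lambda>z. fst (fst (fst z) k)) \<in> borel_measurable (?W \<Otimes>\<^sub>M borel)"
      and s[measurable]: "(\<lambda>z. snd (fst (fst z) k)) \<in> borel_measurable (?W \<Otimes>\<^sub>M borel)"
      by (rule measurable_compose[OF measurable_compose[OF measurable_fst measurable_fst] train_component_measurable(2)[OF that]]
        measurable_compose[OF measurable_compose[OF measurable_fst measurable_fst] train_component_measurable(3)[OF that]])+
    have [measurable]: "(\<lambda>z. cdf (K (fst (fst (fst z) k))) (q (snd z))) \<in> borel_measurable (?W \<Otimes>\<^sub>M borel)"
      by (rule cdf_K_measurable[OF f]) measurable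
    show ?thesis unfolding r_def by measurable
  qed
  have H_meas[measurable]: "(\<lambda>z. H (fst z) (snd z)) \<in> borel_measurable (?W \<Otimes>\<^sub>M borel)"
    unfolding H_def using r_meas[OF ij(1)] r_meas[OF ij(2)] ij by measurable
  have inner: "(\<integral>d. H (d, t) x \<partial>trainL n) = 0" if t: "t \<in> space (\<Theta>L n)" for t x
  proof -
    have t': "t \<in> space (\<Theta>M n)" using t sets_eq_imp_space_eq[OF sets_ThetaL] by simp
    \<comment> \<open>Split the product law of the training data into the \<open>i\<close>-th pair
      and the rest.\<close>
    define I' where "I' = I1 n - {i}"
    have I': "finite I'" "i \<notin> I'" "insert i I' = I1 n" using ij by (auto simp: I'_def)
    have [measurable]: "(\<lambda>d. H (d, t) x) \<in> borel_measurable (trainL n)"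
      using measurable_compose[OF _ H_meas, of "\<lambda>d. ((d, t), x)" "trainL n"] t' by simp
    have int: "integrable (trainL n) (\<lambda>d. H (d, t) x)"
      using H_bd by (intro tr.integrable_const_bound[where B=1]) auto
    have "(\<integral>d. H (d, t) x \<partial>trainL n) = (\<integral>d. (\<integral>z. H (d(i := z), t) x \<partial>P) \<partial>Pi\<^sub>M I' (\<lambda>_. P))"
      unfolding trainL_def I'(3)[symmetric]
      by (rule PI.product_integral_insert[OF I'(1,2)]) (use int in \<open>simp add: trainL_def I'(3)\<close>)
    also have "\<dots> = (\<integral>d. 0 \<partial>Pi\<^sub>M I' (\<lambda>_. P))"
    proof (intro Bochner_Integration.integral_cong refl)
      fix d assume "d \<in> space (Pi\<^sub>M I' (\<lambda>_. P))"
      moreover have "space (Pi\<^sub>M I' (\<lambda>_. P)) = space (Pi\<^sub>M I' (\<lambda>_. borel))"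
        by (intro sets_eq_imp_space_eq sets_PiM_cong) auto
      ultimately have d: "d \<in> space (Pi\<^sub>M (I1 n - {i}) (\<lambda>_. borel))" by (simp add: I'_def)
      \<comment> \<open>Everything in the product except the \<open>i\<close>-th residual, as a
        bounded function of the \<open>i\<close>-th covariate.\<close>
      define h where "h u = weight_of n (d(i := (u, 0)), t) x i * (weight_of n (d(i := (u, 0)), t) x j * r j d x)" for u
      have upd: "(\<lambda>u. d(i := (u, 0))) \<in> borel \<rightarrow>\<^sub>M trainM n"
      proof -
        have "(\<lambda>u. d(i := (u, 0))) \<in> borel \<rightarrow>\<^sub>M Pi\<^sub>M (insert i I') (\<lambda>_. borel)"
        proof (rule measurable_fun_upd[where J=I'])
          show "(\<lambda>u. d) \<in> borel \<rightarrow>\<^sub>M Pi\<^sub>M I' (\<lambda>_. borel)" using d by (simp add: I'_def)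
          have "(\<lambda>u. (u, 0::real)) \<in> borel_measurable (borel :: (real ^ 'n) measure)"
            by (intro borel_measurable_continuous_onI continuous_intros)
          then show "(\<lambda>u. (u, 0)) \<in> borel \<rightarrow>\<^sub>M (borel :: ((real ^ 'n) \<times> real) measure)" .
        qed simp
        then show ?thesis by (simp add: train_eq(2) I'(3))
      qed
      have wm: "(\<lambda>u. weight_of n (d(i := (u, 0)), t) x k) \<in> borel_measurable borel" if "k \<in> I1 n" for k
      proof -
        have "(\<lambda>u. ((d(i := (u, 0)), t), x)) \<in> borel \<rightarrow>\<^sub>M ?W \<Otimes>\<^sub>M borel"
          using upd t' by (intro measurable_Pair) auto
        from measurable_compose[OF this weight_of_measurable[OF that]] show ?thesis by simp
      qed
      have h: "h \<in> borel_measurable borel"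
        unfolding h_def using wm[OF ij(1)] wm[OF ij(2)] by measurable
      have h_bd: "\<bar>h u\<bar> \<le> 1" for u
      proof -
        have "\<bar>h u\<bar> \<le> 1 * (1 * 1)"
          unfolding h_def abs_mult using w_bd[OF ij(1)] w_bd[OF ij(2)] r_bd by (intro mult_mono) auto
        then show ?thesis by simp
      qed
      have "H (d(i := z), t) x = h (fst z) * (of_bool (snd z \<le> q x) - cdf (K (fst z)) (q x))" for z
        unfolding H_def h_def using ij
        by (simp add: weight_of_honest[OF ij(1) d t' ij(1), of z x] weight_of_honest[OF ij(1) d t' ij(2), of z x] r_def)
      then show "(\<integral>z. H (d(i := z), t) x \<partial>P) = 0"
        using integral_cond_centred[OF h h_bd] by simp
    qed
    finally show ?thesis by simp
  qed
  have int: "integrable (?L \<Otimes>\<^sub>M \<mu>) (\<lambda>(D, x). H D x)"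
    using H_bd by (intro LM.P.integrable_const_bound[where B=1]) (auto simp: case_prod_unfold)
  have "expectation (\<lambda>\<omega>. (\<lambda>z. H (fst z) (snd z)) ((train n \<omega>, \<Theta> n \<omega>), X \<omega>))
     = (\<integral>z. H (fst z) (snd z) \<partial>(?L \<Otimes>\<^sub>M \<mu>))"
    unfolding distr_forest_X[symmetric] by (intro integral_distr[symmetric]) measurable
  also have "\<dots> = (\<integral>x. (\<integral>D. H D x \<partial>?L) \<partial>\<mu>)"
    using LM.integral_snd[OF int] by (simp add: case_prod_unfold)
  also have "\<dots> = (\<integral>x. 0 \<partial>\<mu>)"
  proof (intro Bochner_Integration.integral_cong refl)
    fix x
    have [measurable]: "(\<lambda>D. H D x) \<in> borel_measurable ?L"
      using measurable_compose[OF _ H_meas, of "\<lambda>D. (D, x)" ?L] by simp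
    have "integrable ?L (\<lambda>(d, t). H (d, t) x)"
      using H_bd by (intro TT.P.integrable_const_bound[where B=1]) (auto simp: case_prod_unfold)
    from TT.integral_snd[OF this] have "(\<integral>D. H D x \<partial>?L) = (\<integral>t. (\<integral>d. H (d, t) x \<partial>trainL n) \<partial>\<Theta>L n)"
      by (simp add: case_prod_unfold)
    also have "\<dots> = (\<integral>t. 0 \<partial>\<Theta>L n)" by (intro Bochner_Integration.integral_cong refl inner)
    finally show "(\<integral>D. H D x \<partial>?L) = 0" by simp
  qed
  finally show ?thesis
    using ij by (simp add: H_def weight_of_eq r_def train_apply)
qed

end

text \<open>Choose \<open>k\<close> to make \<open>C k\<close> improbable, then \<open>n\<close>.
  The sets \<open>C k\<close> collect the outcomes where the margin at \<open>X\<close> is too small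
  for the \<open>k\<close>-th approximation, which replaces a uniform margin.\<close>

lemma (in prob_space) prob_tendsto_0_approx:
  assumes [measurable]: "\<And>n. Measurable.pred M (A n)" "\<And>k n. Measurable.pred M (Q k n)" "\<And>k. Measurable.pred M (C k)"
    and imp: "\<And>k n. AE \<omega> in M. A n \<omega> \<longrightarrow> Q k n \<omega> \<or> C k \<omega>"
    and Q: "\<And>k. (\<lambda>n. prob {\<omega> \<in> space M. Q k n \<omega>}) \<longlonglongrightarrow> 0"
    and C: "(\<lambda>k. prob {\<omega> \<in> space M. C k \<omega>}) \<longlonglongrightarrow> 0"
  shows "(\<lambda>n. prob {\<omega> \<in> space M. A n \<omega>}) \<longlonglongrightarrow> 0"
proof (rule LIMSEQ_I)
  fix r :: real assume r: "0 < r"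
  have "\<forall>\<^sub>F k in sequentially. prob {\<omega> \<in> space M. C k \<omega>} < r / 2"
    by (rule order_tendstoD[OF C]) (use r in simp)
  then obtain k where k: "prob {\<omega> \<in> space M. C k \<omega>} < r / 2" by (auto dest: eventually_happens)
  have "\<forall>\<^sub>F n in sequentially. prob {\<omega> \<in> space M. Q k n \<omega>} < r / 2"
    by (rule order_tendstoD[OF Q]) (use r in simp)
  then have "\<forall>\<^sub>F n in sequentially. prob {\<omega> \<in> space M. A n \<omega>} < r"
  proof eventually_elim
    case (elim n)
    have "prob {\<omega> \<in> space M. A n \<omega>} \<le> prob ({\<omega> \<in> space M. Q k n \<omega>} \<union> {\<omega> \<in> space M. C k \<omega>})"
      using imp[of n k] by (intro finite_measure_mono_AE) auto
    also have "\<dots> \<le> prob {\<omega> \<in> space M. Q k n \<omega>} + prob {\<omega> \<in> space M. C k \<omega>}"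
      by (intro measure_Un_le) measurable
    finally show ?case using elim k by linarith
  qed
  then show "\<exists>no. \<forall>n\<ge>no. norm (prob {\<omega> \<in> space M. A n \<omega>} - 0) < r"
    by (simp add: eventually_sequentially)
qed

context forest_setting
begin

section \<open>Second moment of the stochastic error\<close>

lemma weight_bounds: "0 \<le> weight n \<omega> x i" "i \<in> I1 n \<Longrightarrow> weight n \<omega> x i \<le> 1"
  using B_pos[of n] by (auto intro: forest_weight_le_1)

lemma sum_weight_squares_le_1: "(\<Sum>i\<in>I1 n. (weight n \<omega> x i)\<^sup>2) \<le> 1"
proof -
  have "(\<Sum>i\<in>I1 n. (weight n \<omega> x i)\<^sup>2) \<le> (\<Sum>i\<in>I1 n. weight n \<omega> x i)"
    using weight_bounds by (intro sum_mono) (simp add: power2_eq_square mult_left_le)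
  also have "\<dots> \<le> 1" using B_pos by (intro forest_weight_sum_le) auto
  finally show ?thesis .
qed

text \<open>Almost surely the sum is eventually at most the inverse of any given leaf count, and it
  never exceeds 1, so dominated convergence applies.\<close>

lemma weight_squares_tendsto_0:
  "(\<lambda>n. expectation (\<lambda>\<omega>. \<Sum>i\<in>I1 n. (weight n \<omega> (X \<omega>) i)\<^sup>2)) \<longlonglongrightarrow> 0"
proof -
  have "(\<lambda>n. expectation (\<lambda>\<omega>. \<Sum>i\<in>I1 n. (weight n \<omega> (X \<omega>) i)\<^sup>2)) \<longlonglongrightarrow> expectation (\<lambda>_. 0)"
  proof (rule integral_dominated_convergence[where w="\<lambda>_. 1"])
    show "AE \<omega> in M. (\<lambda>n. \<Sum>i\<in>I1 n. (weight n \<omega> (X \<omega>) i)\<^sup>2) \<longlonglongrightarrow> 0"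
      using AE_leaf_count_ge
    proof eventually_elim
      case (elim \<omega>)
      show ?case
      proof (rule LIMSEQ_I)
        fix r :: real assume r: "0 < r"
        obtain k :: nat where k: "1 / r < real k" using reals_Archimedean2 by blast
        then have k0: "0 < real k" using r by (meson less_trans zero_less_divide_1_iff)
        have "\<forall>\<^sub>F n in sequentially. (\<Sum>i\<in>I1 n. (weight n \<omega> (X \<omega>) i)\<^sup>2) < r"
          using elim[rule_format, of k]
        proof eventually_elim
          case (elim n)
          have "(\<Sum>i\<in>I1 n. (weight n \<omega> (X \<omega>) i)\<^sup>2) \<le> 1 / real k"
            using elim leaf_of_in_leaves B_pos k0
            by (intro forest_weight_sum_squares_le) auto
          also have "\<dots> < r" using k r k0 by (simp add: field_simps)
          finally show ?case .
        qed
        then show "\<exists>no. \<forall>n\<ge>no. norm ((\<Sum>i\<in>I1 n. (weight n \<omega> (X \<omega>) i)\<^sup>2) - 0) < r"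
          by (simp add: eventually_sequentially sum_nonneg)
      qed
    qed
    show "AE \<omega> in M. norm (\<Sum>i\<in>I1 n. (weight n \<omega> (X \<omega>) i)\<^sup>2) \<le> 1" for n
      using sum_weight_squares_le_1 by (intro AE_I2) (simp add: sum_nonneg)
  qed measurable
  then show ?thesis by simp
qed

text \<open>The stochastic part of the forest estimate, at a threshold that is a deterministic
  function of \<open>X\<close>. An estimated threshold would involve the responses and destroy the
  orthogonality.\<close>

definition residual :: "(real ^ 'n \<Rightarrow> real) \<Rightarrow> nat \<Rightarrow> 'w \<Rightarrow> real" where
  "residual q n \<omega> = (\<Sum>i\<in>I1 n. weight n \<omega> (X \<omega>) i *
     (of_bool (Ys i \<omega> \<le> q (X \<omega>)) - cdf (K (Xs i \<omega>)) (q (X \<omega>))))"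

lemma residual_term_measurable [measurable]:
  assumes [measurable]: "q \<in> borel_measurable borel" and i: "i \<in> I1 n"
  shows "(\<lambda>\<omega>. weight n \<omega> (X \<omega>) i * (of_bool (Ys i \<omega> \<le> q (X \<omega>)) - cdf (K (Xs i \<omega>)) (q (X \<omega>)))) \<in> borel_measurable M"
proof -
  have [measurable]: "(\<lambda>\<omega>. weight n \<omega> (X \<omega>) i) \<in> borel_measurable M" "Ys i \<in> borel_measurable M"
    "(\<lambda>\<omega>. cdf (K (Xs i \<omega>)) (q (X \<omega>))) \<in> borel_measurable M"
    using i I_ge_1(1)[OF i] by (auto intro!: cdf_K_measurable)
  show ?thesis by measurable
qed

lemma residual_measurable [measurable]: "q \<in> borel_measurable borel \<Longrightarrow> residual q n \<in> borel_measurable M"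
  unfolding residual_def[abs_def] by measurable

lemma residual_term_bound:
  "i \<in> I1 n \<Longrightarrow> \<bar>weight n \<omega> x i * (of_bool (Ys i \<omega> \<le> y) - cdf (K (Xs i \<omega>)) y)\<bar> \<le> weight n \<omega> x i"
proof -
  have "\<bar>of_bool (Ys i \<omega> \<le> y) - cdf (K (Xs i \<omega>)) y\<bar> \<le> 1"
    using cdf_K_bounds[of "Xs i \<omega>" y] by auto
  then show ?thesis using weight_bounds(1)[of n \<omega> x i] by (simp add: abs_mult mult_left_le)
qed

lemma residual_abs_le_1: "\<bar>residual q n \<omega>\<bar> \<le> 1"
proof -
  have "\<bar>residual q n \<omega>\<bar> \<le> (\<Sum>i\<in>I1 n. weight n \<omega> (X \<omega>) i)"
    unfolding residual_def by (intro order_trans[OF sum_abs] sum_mono residual_term_bound)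
  also have "\<dots> \<le> 1" using B_pos by (intro forest_weight_sum_le) auto
  finally show ?thesis .
qed

lemma residual_square_le:
  assumes q[measurable]: "q \<in> borel_measurable borel"
  shows "expectation (\<lambda>\<omega>. (residual q n \<omega>)\<^sup>2) \<le> expectation (\<lambda>\<omega>. \<Sum>i\<in>I1 n. (weight n \<omega> (X \<omega>) i)\<^sup>2)"
proof -
  let ?f = "\<lambda>i \<omega>. weight n \<omega> (X \<omega>) i * (of_bool (Ys i \<omega> \<le> q (X \<omega>)) - cdf (K (Xs i \<omega>)) (q (X \<omega>)))"
  have le: "(?f i \<omega>)\<^sup>2 \<le> (weight n \<omega> (X \<omega>) i)\<^sup>2" "\<bar>?f i \<omega>\<bar> \<le> 1" if "i \<in> I1 n" for i \<omega>
  proof -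
    show "(?f i \<omega>)\<^sup>2 \<le> (weight n \<omega> (X \<omega>) i)\<^sup>2"
      using residual_term_bound[OF that] by (intro power2_le_iff_abs_le[THEN iffD2] weight_bounds) auto
    show "\<bar>?f i \<omega>\<bar> \<le> 1" using residual_term_bound[OF that, of \<omega>] weight_bounds(2)[OF that] order_trans by blast
  qed
  have wi: "integrable M (\<lambda>\<omega>. (weight n \<omega> (X \<omega>) i)\<^sup>2)" if "i \<in> I1 n" for i
    using that weight_bounds by (intro integrable_const_bound[where B=1]) (auto simp: power_le_one)
  have "expectation (\<lambda>\<omega>. (residual q n \<omega>)\<^sup>2) = (\<Sum>i\<in>I1 n. expectation (\<lambda>\<omega>. (?f i \<omega>)\<^sup>2))"
    unfolding residual_def
    by (rule expectation_square_orthogonal_sum[where c=1]) (use le(2) residuals_orthogonal[OF q] q in simp_all)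
  also have "\<dots> \<le> (\<Sum>i\<in>I1 n. expectation (\<lambda>\<omega>. (weight n \<omega> (X \<omega>) i)\<^sup>2))"
  proof (intro sum_mono integral_mono wi le(1))
    fix i assume i: "i \<in> I1 n"
    show "integrable M (\<lambda>\<omega>. (?f i \<omega>)\<^sup>2)"
    proof (rule integrable_const_bound[where B=1])
      show "AE \<omega> in M. norm ((?f i \<omega>)\<^sup>2) \<le> 1"
        using le(2)[OF i] by (intro AE_I2) (simp add: abs_square_le_1)
    qed (use i q in measurable)
  qed
  also have "\<dots> = expectation (\<lambda>\<omega>. \<Sum>i\<in>I1 n. (weight n \<omega> (X \<omega>) i)\<^sup>2)"
    using wi by (simp add: Bochner_Integration.integral_sum)
  finally show ?thesis .
qed

lemma residual_tendsto_0:
  assumes q[measurable]: "q \<in> borel_measurable borel" and e: "0 < e"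
  shows "(\<lambda>n. prob {\<omega> \<in> space M. e \<le> \<bar>residual q n \<omega>\<bar>}) \<longlonglongrightarrow> 0"
proof -
  have "(\<lambda>n. prob {\<omega> \<in> space M. e\<^sup>2 \<le> (residual q n \<omega>)\<^sup>2}) \<longlonglongrightarrow> 0"
  proof (rule markov_tendsto_0)
    show "integrable M (\<lambda>\<omega>. (residual q n \<omega>)\<^sup>2)" for n
    proof (rule integrable_const_bound[where B=1])
      show "AE \<omega> in M. norm ((residual q n \<omega>)\<^sup>2) \<le> 1"
        using residual_abs_le_1 by (intro AE_I2) (simp add: abs_square_le_1)
    qed measurable
    show "(\<lambda>n. expectation (\<lambda>\<omega>. (residual q n \<omega>)\<^sup>2)) \<longlonglongrightarrow> 0"
      by (rule tendsto_sandwich[OF _ _ tendsto_const weight_squares_tendsto_0])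
        (use residual_square_le[OF q] in auto)
  qed (use e in auto)
  moreover have "e\<^sup>2 \<le> (residual q n \<omega>)\<^sup>2 \<longleftrightarrow> e \<le> \<bar>residual q n \<omega>\<bar>" for n \<omega>
    using abs_le_square_iff[of e "residual q n \<omega>"] e by simp
  ultimately show ?thesis by simp
qed

text \<open>The event that some tree has no training point in the leaf of \<open>X\<close>; there
  the weights do not sum to 1 and the Galois property of the quantile may fail.\<close>

definition degenerate :: "nat \<Rightarrow> 'w \<Rightarrow> bool" where
  "degenerate n \<omega> \<longleftrightarrow> (\<Sum>i\<in>I1 n. weight n \<omega> (X \<omega>) i) \<noteq> 1"

lemma degenerate_measurable [measurable]: "Measurable.pred M (degenerate n)"
  unfolding degenerate_def[abs_def] by measurable

lemma degenerate_tendsto_0: "(\<lambda>n. prob {\<omega> \<in> space M. degenerate n \<omega>}) \<longlonglongrightarrow> 0"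
proof (rule AE_eventually_imp_prob_tendsto_0[OF degenerate_measurable])
  show "AE \<omega> in M. \<forall>\<^sub>F n in sequentially. \<not> degenerate n \<omega>"
    using AE_leaf_count_ge
  proof eventually_elim
    case (elim \<omega>)
    from elim[rule_format, of 1] show ?case
    proof eventually_elim
      case (elim n)
      have "(\<Sum>i\<in>I1 n. weight n \<omega> (X \<omega>) i) = 1"
        by (intro forest_weight_sum_eq finite_I B_pos) (use elim leaf_of_in_leaves in \<open>fastforce simp: Suc_le_eq\<close>)
      then show ?case by (simp add: degenerate_def)
    qed
  qed
qed

section \<open>Consistency of the forest distribution function at a conditional quantile\<close>

definition est_cdf :: "nat \<Rightarrow> 'w \<Rightarrow> real \<Rightarrow> real" where
  "est_cdf n \<omega> y = (\<Sum>i\<in>I1 n. weight n \<omega> (X \<omega>) i * of_bool (Ys i \<omega> \<le> y))"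

lemma est_cdf_measurable [measurable]:
  assumes [measurable]: "q \<in> borel_measurable M"
  shows "(\<lambda>\<omega>. est_cdf n \<omega> (q \<omega>)) \<in> borel_measurable M"
proof -
  have [measurable]: "Ys i \<in> borel_measurable M" if "i \<in> I1 n" for i using I_ge_1(1) that by auto
  show ?thesis unfolding est_cdf_def by measurable
qed

lemma est_cdf_error_le:
  assumes X: "X \<omega> \<in> \<X>" and Xs: "\<And>i. i \<ge> 1 \<Longrightarrow> Xs i \<omega> \<in> \<X>" and nd: "\<not> degenerate n \<omega>"
    and C: "\<And>x x' y. x \<in> \<X> \<Longrightarrow> x' \<in> \<X> \<Longrightarrow>
      \<bar>cdf (K x) y - cdf (K x') y\<bar> \<le> C * (\<Sum>m\<in>UNIV. \<bar>x $ m - x' $ m\<bar>)"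
  shows "\<bar>est_cdf n \<omega> (q (X \<omega>)) - cdf (K (X \<omega>)) (q (X \<omega>))\<bar> \<le> \<bar>residual q n \<omega>\<bar> + C * leaf_spread n \<omega>"
proof -
  let ?w = "weight n \<omega> (X \<omega>)" and ?y = "q (X \<omega>)"
  \<comment> \<open>Total weight 1 allows the target value to be written as a weighted mean, so that
    the error becomes residual plus bias.\<close>
  have "cdf (K (X \<omega>)) ?y = (\<Sum>i\<in>I1 n. ?w i) * cdf (K (X \<omega>)) ?y" using nd by (simp add: degenerate_def)
  also have "\<dots> = (\<Sum>i\<in>I1 n. ?w i * cdf (K (X \<omega>)) ?y)" by (rule sum_distrib_right)
  finally have "est_cdf n \<omega> ?y - cdf (K (X \<omega>)) ?y
      = residual q n \<omega> + (\<Sum>i\<in>I1 n. ?w i * (cdf (K (Xs i \<omega>)) ?y - cdf (K (X \<omega>)) ?y))"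
    unfolding residual_def est_cdf_def by (simp add: right_diff_distrib sum_subtractf)
  moreover have "\<bar>\<Sum>i\<in>I1 n. ?w i * (cdf (K (Xs i \<omega>)) ?y - cdf (K (X \<omega>)) ?y)\<bar>
      \<le> (\<Sum>i\<in>I1 n. ?w i * (C * (\<Sum>m\<in>UNIV. \<bar>Xs i \<omega> $ m - X \<omega> $ m\<bar>)))"
    using X Xs I_ge_1(1) weight_bounds(1)
    by (intro order_trans[OF sum_abs] sum_mono) (auto simp: abs_mult intro!: mult_left_mono C)
  moreover have "(\<Sum>i\<in>I1 n. ?w i * (C * (\<Sum>m\<in>UNIV. \<bar>Xs i \<omega> $ m - X \<omega> $ m\<bar>))) = C * leaf_spread n \<omega>"
  proof -
    have "(\<Sum>i\<in>I. w i * (C * d i)) = C * (\<Sum>i\<in>I. w i * d i)" for I :: "nat set" and w d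
      by (simp add: sum_distrib_left mult.left_commute)
    then show ?thesis unfolding leaf_spread_def .
  qed
  ultimately show ?thesis by linarith
qed

lemma est_cdf_consistent:
  assumes \<beta>: "0 < \<beta>" "\<beta> < 1" and e: "0 < e"
  shows "(\<lambda>n. prob {\<omega> \<in> space M. e \<le> \<bar>est_cdf n \<omega> (quantile \<beta> (X \<omega>)) - \<beta>\<bar>}) \<longlonglongrightarrow> 0"
proof -
  note [measurable] = quantile_measurable[OF \<beta>]
  obtain C where C: "C > 0" "\<And>x x' y. x \<in> \<X> \<Longrightarrow> x' \<in> \<X> \<Longrightarrow>
      \<bar>cdf (K x) y - cdf (K x') y\<bar> \<le> C * (\<Sum>m\<in>UNIV. \<bar>x $ m - x' $ m\<bar>)"
    using cdf_K_lipschitz by blast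
  have 1: "(\<lambda>n. prob {\<omega> \<in> space M. e / 2 \<le> \<bar>residual (quantile \<beta>) n \<omega>\<bar> \<or> e / (2 * C) \<le> leaf_spread n \<omega>}) \<longlonglongrightarrow> 0"
    by (rule prob_tendsto_0_Un[OF _ _ _ residual_tendsto_0[of "quantile \<beta>" "e / 2"] leaf_spread_tendsto_0[of "e / (2 * C)"]]) (use e C in auto)
  show ?thesis
  proof (rule prob_tendsto_0_Un[OF _ _ _ 1 degenerate_tendsto_0])
    fix n
    show "AE \<omega> in M. e \<le> \<bar>est_cdf n \<omega> (quantile \<beta> (X \<omega>)) - \<beta>\<bar> \<longrightarrow>
      (e / 2 \<le> \<bar>residual (quantile \<beta>) n \<omega>\<bar> \<or> e / (2 * C) \<le> leaf_spread n \<omega>) \<or> degenerate n \<omega>"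
      using AE_X_support AE_Xs_support
    proof eventually_elim
      case (elim \<omega>)
      show ?case
      proof (intro impI, rule ccontr)
        assume a: "e \<le> \<bar>est_cdf n \<omega> (quantile \<beta> (X \<omega>)) - \<beta>\<bar>"
          and b: "\<not> ((e / 2 \<le> \<bar>residual (quantile \<beta>) n \<omega>\<bar> \<or> e / (2 * C) \<le> leaf_spread n \<omega>) \<or> degenerate n \<omega>)"
        have "\<bar>est_cdf n \<omega> (quantile \<beta> (X \<omega>)) - \<beta>\<bar> \<le> \<bar>residual (quantile \<beta>) n \<omega>\<bar> + C * leaf_spread n \<omega>"
          using est_cdf_error_le[of \<omega> n C "quantile \<beta>"] elim b C(2) cdf_quantile[OF \<beta>] by auto
        moreover have "C * leaf_spread n \<omega> < e / 2"
          using b C(1) by (simp add: field_simps not_le)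
        ultimately show False using a b by auto
      qed
    qed
  qed auto
qed

section \<open>Consistency of the forest quantile\<close>

definition v :: "nat \<Rightarrow> 'w \<Rightarrow> real ^ 'n \<Rightarrow> real" where
  "v n \<omega> x = qrf \<alpha> (I1 n) (\<lambda>i. Xs i \<omega>) (\<lambda>i. Ys i \<omega>) (B n) (\<lambda>b. T n b \<omega>) x"

lemma v_measurable [measurable]:
  assumes "f \<in> borel_measurable M"
  shows "(\<lambda>\<omega>. v n \<omega> (f \<omega>)) \<in> borel_measurable M"
  unfolding v_def using assms I_ge_1(1) alpha by (intro qrf_measurable) auto

lemma v_le_iff: "\<not> degenerate n \<omega> \<Longrightarrow> v n \<omega> (X \<omega>) \<le> c \<longleftrightarrow> \<alpha> \<le> est_cdf n \<omega> c"
  unfolding v_def qrf_eq est_cdf_def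
  by (intro weighted_quantile_le_iff) (use alpha in \<open>auto simp: degenerate_def\<close>)

text \<open>An estimate above the quantile of level \<beta> means that the estimated distribution
  function there is still below \<alpha>, an error of at least \<open>\<beta> - \<alpha>\<close>.
  Consistency at this one level suffices.\<close>

lemma v_above_quantile:
  assumes \<beta>: "\<alpha> < \<beta>" "\<beta> < 1"
  shows "(\<lambda>n. prob {\<omega> \<in> space M. quantile \<beta> (X \<omega>) < v n \<omega> (X \<omega>)}) \<longlonglongrightarrow> 0"
proof -
  have \<beta>0: "0 < \<beta>" using \<beta> alpha by simp
  note [measurable] = quantile_measurable[OF \<beta>0 \<beta>(2)]
  show ?thesis
  proof (rule prob_tendsto_0_Un[OF _ _ _ est_cdf_consistent[OF \<beta>0 \<beta>(2), of "\<beta> - \<alpha>"] degenerate_tendsto_0])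
    show "AE \<omega> in M. quantile \<beta> (X \<omega>) < v n \<omega> (X \<omega>) \<longrightarrow>
       \<beta> - \<alpha> \<le> \<bar>est_cdf n \<omega> (quantile \<beta> (X \<omega>)) - \<beta>\<bar> \<or> degenerate n \<omega>" for n
    proof (rule AE_I2, rule impI, rule disjCI)
      fix \<omega> assume "quantile \<beta> (X \<omega>) < v n \<omega> (X \<omega>)" "\<not> degenerate n \<omega>"
      then have "est_cdf n \<omega> (quantile \<beta> (X \<omega>)) < \<alpha>" using v_le_iff[of n \<omega> "quantile \<beta> (X \<omega>)"] by auto
      then show "\<beta> - \<alpha> \<le> \<bar>est_cdf n \<omega> (quantile \<beta> (X \<omega>)) - \<beta>\<bar>" by linarith
    qed
  qed (use \<beta> in auto)
qed

lemma v_below_quantile: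
  assumes \<beta>: "0 < \<beta>" "\<beta> < \<alpha>"
  shows "(\<lambda>n. prob {\<omega> \<in> space M. v n \<omega> (X \<omega>) \<le> quantile \<beta> (X \<omega>)}) \<longlonglongrightarrow> 0"
proof -
  have \<beta>1: "\<beta> < 1" using \<beta> alpha by simp
  note [measurable] = quantile_measurable[OF \<beta>(1) \<beta>1]
  show ?thesis
  proof (rule prob_tendsto_0_Un[OF _ _ _ est_cdf_consistent[OF \<beta>(1) \<beta>1, of "\<alpha> - \<beta>"] degenerate_tendsto_0])
    show "AE \<omega> in M. v n \<omega> (X \<omega>) \<le> quantile \<beta> (X \<omega>) \<longrightarrow>
       \<alpha> - \<beta> \<le> \<bar>est_cdf n \<omega> (quantile \<beta> (X \<omega>)) - \<beta>\<bar> \<or> degenerate n \<omega>" for n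
    proof (rule AE_I2, rule impI, rule disjCI)
      fix \<omega> assume "v n \<omega> (X \<omega>) \<le> quantile \<beta> (X \<omega>)" "\<not> degenerate n \<omega>"
      then have "\<alpha> \<le> est_cdf n \<omega> (quantile \<beta> (X \<omega>))" using v_le_iff[of n \<omega> "quantile \<beta> (X \<omega>)"] by auto
      then show "\<alpha> - \<beta> \<le> \<bar>est_cdf n \<omega> (quantile \<beta> (X \<omega>)) - \<beta>\<bar>" by linarith
    qed
  qed (use \<beta> in auto)
qed

abbreviation q\<alpha> :: "real ^ 'n \<Rightarrow> real" where "q\<alpha> \<equiv> quantile \<alpha>"

lemmas q\<alpha>_measurable [measurable] = quantile_measurable[OF alpha]

lemma cdf_near_quantile:
  assumes x: "x \<in> \<X>" and \<eta>: "0 < \<eta>"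
  shows "cdf (K x) (q\<alpha> x - \<eta>) < \<alpha>" "\<alpha> < cdf (K x) (q\<alpha> x + \<eta>)"
  using strict_monoD[OF cdf_strict[rule_format, OF x], of "q\<alpha> x - \<eta>" "q\<alpha> x"]
    strict_monoD[OF cdf_strict[rule_format, OF x], of "q\<alpha> x" "q\<alpha> x + \<eta>"] \<eta> cdf_quantile[OF alpha x]
  by auto

text \<open>By strict monotonicity the level reached at the quantile plus \<eta> exceeds \<alpha>.
  Once it is at least \<open>\<beta> k\<close>, the quantile of level \<open>\<beta> k\<close> is at
  most the \<alpha>-quantile plus \<eta>, and \<open>v_above_quantile\<close> applies. How close to
  \<alpha> the level must be depends on \<open>X\<close>, hence the limit in
  \<open>k\<close>.\<close>

lemma v_upper:
  assumes \<eta>: "0 < \<eta>"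
  shows "(\<lambda>n. prob {\<omega> \<in> space M. q\<alpha> (X \<omega>) + \<eta> < v n \<omega> (X \<omega>)}) \<longlonglongrightarrow> 0"
proof -
  \<comment> \<open>Levels decreasing to \<alpha>; the offset 2 keeps them below 1 from
    \<open>k = 0\<close> on.\<close>
  define \<beta> where "\<beta> k = \<alpha> + (1 - \<alpha>) / real (k + 2)" for k
  have \<beta>: "\<alpha> < \<beta> k" "\<beta> k < 1" "0 < \<beta> k" for k
  proof -
    define d where "d = (1 - \<alpha>) / real (k + 2)"
    have "0 < d" using alpha by (simp add: d_def)
    moreover have "d \<le> (1 - \<alpha>) / 2" unfolding d_def by (rule divide_left_mono) (use alpha in simp_all)
    moreover have "\<beta> k = \<alpha> + d" by (simp add: \<beta>_def d_def)
    ultimately show "\<alpha> < \<beta> k" "\<beta> k < 1" "0 < \<beta> k" using alpha by (simp_all add: field_simps)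
  qed
  have \<beta>_lim: "\<beta> \<longlonglongrightarrow> \<alpha>"
  proof -
    have "(\<lambda>k. (1 - \<alpha>) / real (k + 2)) \<longlonglongrightarrow> 0"
      by (rule LIMSEQ_ignore_initial_segment) (rule lim_const_over_n)
    from tendsto_add[OF tendsto_const this, of \<alpha>] show ?thesis by (simp add: \<beta>_def[abs_def])
  qed
  have [measurable]: "(\<lambda>\<omega>. cdf (K (X \<omega>)) (q\<alpha> (X \<omega>) + \<eta>)) \<in> borel_measurable M"
    by (rule cdf_K_measurable) measurable
  note [measurable] = quantile_measurable[OF \<beta>(3,2)]
  show ?thesis
  proof (rule prob_tendsto_0_approx[where Q="\<lambda>k n \<omega>. quantile (\<beta> k) (X \<omega>) < v n \<omega> (X \<omega>)"
        and C="\<lambda>k \<omega>. cdf (K (X \<omega>)) (q\<alpha> (X \<omega>) + \<eta>) < \<beta> k"])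
    show "(\<lambda>n. prob {\<omega> \<in> space M. quantile (\<beta> k) (X \<omega>) < v n \<omega> (X \<omega>)}) \<longlonglongrightarrow> 0" for k
      using \<beta> by (intro v_above_quantile)
    show "(\<lambda>k. prob {\<omega> \<in> space M. cdf (K (X \<omega>)) (q\<alpha> (X \<omega>) + \<eta>) < \<beta> k}) \<longlonglongrightarrow> 0"
    proof (rule AE_eventually_imp_prob_tendsto_0)
      show "AE \<omega> in M. \<forall>\<^sub>F k in sequentially. \<not> cdf (K (X \<omega>)) (q\<alpha> (X \<omega>) + \<eta>) < \<beta> k"
        using AE_X_support
      proof eventually_elim
        case (elim \<omega>)
        from order_tendstoD(2)[OF \<beta>_lim cdf_near_quantile(2)[OF elim \<eta>]]
        show ?case by eventually_elim simp
      qed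
    qed measurable
    show "AE \<omega> in M. q\<alpha> (X \<omega>) + \<eta> < v n \<omega> (X \<omega>) \<longrightarrow>
      quantile (\<beta> k) (X \<omega>) < v n \<omega> (X \<omega>) \<or> cdf (K (X \<omega>)) (q\<alpha> (X \<omega>) + \<eta>) < \<beta> k" for n k
      using quantile_le_iff[OF \<beta>(3,2)] by (intro AE_I2) (meson le_less_trans not_le)
  qed measurable
qed

lemma v_lower:
  assumes \<eta>: "0 < \<eta>"
  shows "(\<lambda>n. prob {\<omega> \<in> space M. v n \<omega> (X \<omega>) < q\<alpha> (X \<omega>) - \<eta>}) \<longlonglongrightarrow> 0"
proof -
  \<comment> \<open>Levels increasing to \<alpha>; the offset 2 keeps them positive from
    \<open>k = 0\<close> on.\<close>
  define \<beta> where "\<beta> k = \<alpha> - \<alpha> / real (k + 2)" for k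
  have \<beta>: "\<beta> k < \<alpha>" "0 < \<beta> k" "\<beta> k < 1" for k
  proof -
    have "0 < \<alpha> / real (k + 2)" using alpha by simp
    moreover have "\<alpha> / real (k + 2) \<le> \<alpha> / 2" by (rule divide_left_mono) (use alpha in simp_all)
    ultimately show "\<beta> k < \<alpha>" "0 < \<beta> k" "\<beta> k < 1" using alpha unfolding \<beta>_def by - linarith+
  qed
  have \<beta>_lim: "\<beta> \<longlonglongrightarrow> \<alpha>"
  proof -
    have "(\<lambda>k. \<alpha> / real (k + 2)) \<longlonglongrightarrow> 0"
      by (rule LIMSEQ_ignore_initial_segment) (rule lim_const_over_n)
    from tendsto_diff[OF tendsto_const this, of \<alpha>] show ?thesis by (simp add: \<beta>_def[abs_def])
  qed
  have [measurable]: "(\<lambda>\<omega>. cdf (K (X \<omega>)) (q\<alpha> (X \<omega>) - \<eta>)) \<in> borel_measurable M"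
    by (rule cdf_K_measurable) measurable
  note [measurable] = quantile_measurable[OF \<beta>(2,3)]
  show ?thesis
  proof (rule prob_tendsto_0_approx[where Q="\<lambda>k n \<omega>. v n \<omega> (X \<omega>) \<le> quantile (\<beta> k) (X \<omega>)"
        and C="\<lambda>k \<omega>. \<beta> k \<le> cdf (K (X \<omega>)) (q\<alpha> (X \<omega>) - \<eta>)"])
    show "(\<lambda>n. prob {\<omega> \<in> space M. v n \<omega> (X \<omega>) \<le> quantile (\<beta> k) (X \<omega>)}) \<longlonglongrightarrow> 0" for k
      using \<beta> by (intro v_below_quantile)
    show "(\<lambda>k. prob {\<omega> \<in> space M. \<beta> k \<le> cdf (K (X \<omega>)) (q\<alpha> (X \<omega>) - \<eta>)}) \<longlonglongrightarrow> 0"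
    proof (rule AE_eventually_imp_prob_tendsto_0)
      show "AE \<omega> in M. \<forall>\<^sub>F k in sequentially. \<not> \<beta> k \<le> cdf (K (X \<omega>)) (q\<alpha> (X \<omega>) - \<eta>)"
        using AE_X_support
      proof eventually_elim
        case (elim \<omega>)
        from order_tendstoD(1)[OF \<beta>_lim cdf_near_quantile(1)[OF elim \<eta>]]
        show ?case by eventually_elim simp
      qed
    qed measurable
    show "AE \<omega> in M. v n \<omega> (X \<omega>) < q\<alpha> (X \<omega>) - \<eta> \<longrightarrow>
      v n \<omega> (X \<omega>) \<le> quantile (\<beta> k) (X \<omega>) \<or> \<beta> k \<le> cdf (K (X \<omega>)) (q\<alpha> (X \<omega>) - \<eta>)" for n k
      using quantile_le_iff[OF \<beta>(2,3)] by (intro AE_I2) (meson less_imp_le linear order_trans)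
  qed measurable
qed

section \<open>The conformal correction\<close>

text \<open>The conditional law is specified on rectangles, but events such as
  \<open>Y \<le> r X\<close> are not rectangles. Both sides are measures, so agreement on rectangles
  extends to all Borel sets.\<close>

lemma emeasure_P_eq:
  assumes A: "A \<in> sets borel"
  shows "emeasure P A = (\<integral>\<^sup>+x. emeasure (K x) (Pair x -` A) \<partial>\<mu>)"
proof -
  let ?b = "borel :: ((real ^ 'n) \<times> real) measure"
  let ?N = "\<lambda>x. distr (K x) ?b (Pair x)"
  let ?E = "{A \<times> C |A C. A \<in> sets (borel :: (real ^ 'n) measure) \<and> C \<in> sets (borel :: real measure)}"
  have setsK: "sets (K x) = sets borel" for x using K_real_distribution[of x] by (simp add: real_distribution_def real_distribution_axioms_def)
  have Pair: "Pair x \<in> K x \<rightarrow>\<^sub>M ?b" for x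
  proof -
    have "Pair x \<in> (borel :: real measure) \<rightarrow>\<^sub>M borel \<Otimes>\<^sub>M borel" by simp
    then show ?thesis by (simp add: borel_prod cong: measurable_cong_sets[OF setsK refl])
  qed
  have N: "?N \<in> \<mu> \<rightarrow>\<^sub>M subprob_algebra ?b"
  proof (rule measurable_distr2[where M=borel])
    have "(\<lambda>(x, y). (x, y)) \<in> \<mu> \<Otimes>\<^sub>M (borel :: real measure) \<rightarrow>\<^sub>M borel \<Otimes>\<^sub>M borel" by measurable
    then show "case_prod Pair \<in> \<mu> \<Otimes>\<^sub>M (borel :: real measure) \<rightarrow>\<^sub>M ?b" by (simp add: borel_prod)
    have "K \<in> borel \<rightarrow>\<^sub>M subprob_algebra borel" by (rule measurable_prob_algebraD) measurable
    then show "K \<in> \<mu> \<rightarrow>\<^sub>M subprob_algebra borel" by (simp cong: measurable_cong_sets[OF sets_mu refl])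
  qed
  have ne: "space \<mu> \<noteq> {}" using sets_eq_imp_space_eq[OF sets_mu] by simp
  have bind: "emeasure (\<mu> \<bind> ?N) A = (\<integral>\<^sup>+x. emeasure (K x) (Pair x -` A) \<partial>\<mu>)" if A: "A \<in> sets ?b" for A
  proof -
    have "emeasure (\<mu> \<bind> ?N) A = (\<integral>\<^sup>+x. emeasure (?N x) A \<partial>\<mu>)"
      by (rule emeasure_bind[OF ne N A])
    also have "\<dots> = (\<integral>\<^sup>+x. emeasure (K x) (Pair x -` A) \<partial>\<mu>)"
      using sets_eq_imp_space_eq[OF setsK] by (simp add: emeasure_distr[OF Pair A])
    finally show ?thesis .
  qed
  interpret P: prob_space P by (rule prob_space_P)
  have gen: "sets ?b = sigma_sets UNIV ?E"
    unfolding borel_prod[symmetric] sets_pair_measure by simp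
  \<comment> \<open>The right-hand side draws the point from \<mu> and the response from the kernel
    at that point.\<close>
  have "P = \<mu> \<bind> ?N"
  proof (rule measure_eqI_generator_eq[where A="\<lambda>_. UNIV" and \<Omega>=UNIV and E="?E"])
    show "Int_stable ?E" by (rule Int_stable_pair_measure_generator)
    show "sets P = sigma_sets UNIV ?E" using gen by simp
    show "sets (\<mu> \<bind> ?N) = sigma_sets UNIV ?E"
      using sets_bind[OF sets_kernel[OF N] ne] gen by simp
    show "range (\<lambda>_. UNIV) \<subseteq> ?E"
      by (auto intro!: exI[of _ UNIV])
    fix D assume "D \<in> ?E"
    then obtain A C where D: "D = A \<times> C" "A \<in> sets borel" "C \<in> sets borel" by blast
    then have Db: "D \<in> sets ?b" unfolding borel_prod[symmetric] by auto
    have "emeasure P D = emeasure M {\<omega> \<in> space M. X \<omega> \<in> A \<and> Y \<omega> \<in> C}"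
      unfolding P_def using Db by (subst emeasure_distr) (auto simp: D intro!: arg_cong[where f="emeasure M"])
    also have "\<dots> = (\<integral>\<^sup>+x\<in>A. emeasure (K x) C \<partial>\<mu>)"
      using cond_dist[unfolded is_regular_cond_dist_def, THEN conjunct2, rule_format, OF D(2,3)]
      by (simp add: \<mu>_def)
    also have "\<dots> = (\<integral>\<^sup>+x. emeasure (K x) (Pair x -` D) \<partial>\<mu>)"
      by (intro nn_integral_cong) (auto simp: D indicator_def)
    finally show "emeasure P D = emeasure (\<mu> \<bind> ?N) D" using bind[OF Db] by simp
  qed auto
  then show ?thesis using bind[OF A] by simp
qed

lemma below_borel:
  assumes r: "r \<in> borel_measurable borel"
  shows "{z :: (real ^ 'n) \<times> real. snd z \<le> r (fst z)} \<in> sets borel"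
proof -
  have "(\<lambda>z :: (real ^ 'n) \<times> real. r (fst z)) \<in> borel_measurable borel"
    by (rule measurable_compose[OF fst_snd_borel(1) r])
  then have "Measurable.pred borel (\<lambda>z :: (real ^ 'n) \<times> real. snd z \<le> r (fst z))"
    using fst_snd_borel(2) by measurable
  then show ?thesis by (simp add: pred_def)
qed

lemma measure_P_below:
  assumes r[measurable]: "r \<in> borel_measurable borel"
  shows "measure P {z. snd z \<le> r (fst z)} = (\<integral>x. cdf (K x) (r x) \<partial>\<mu>)"
proof -
  interpret mu: prob_space \<mu> by (rule prob_space_mu)
  interpret P: prob_space P by (rule prob_space_P)
  have [measurable]: "(\<lambda>x. cdf (K x) (r x)) \<in> borel_measurable borel"
    by (rule cdf_K_measurable) measurable
  have int: "integrable \<mu> (\<lambda>x. cdf (K x) (r x))"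
    by (rule mu.integrable_const_bound[where B=1]) (use cdf_K_bounds in auto)
  have "emeasure P {z. snd z \<le> r (fst z)} = (\<integral>\<^sup>+x. emeasure (K x) {..r x} \<partial>\<mu>)"
    by (subst emeasure_P_eq[OF below_borel[OF r]]) (auto intro!: nn_integral_cong arg_cong2[where f=emeasure])
  also have "\<dots> = (\<integral>\<^sup>+x. ennreal (cdf (K x) (r x)) \<partial>\<mu>)"
  proof -
    have "emeasure (K x) {..y} = ennreal (cdf (K x) y)" for x y
    proof -
      interpret Kx: real_distribution "K x" by (rule K_real_distribution)
      show ?thesis by (simp add: cdf_def Kx.emeasure_eq_measure)
    qed
    then show ?thesis by simp
  qed
  also have "\<dots> = ennreal (\<integral>x. cdf (K x) (r x) \<partial>\<mu>)"
    using int by (intro nn_integral_eq_integral) (auto simp: cdf_K_bounds)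
  finally show ?thesis by (simp add: P.emeasure_eq_measure integral_nonneg cdf_K_bounds)
qed

text \<open>Puts the \<alpha>-quantile of the ideal score \<open>Y - q\<alpha> X\<close> at 0, with
  a strict margin on both sides: pointwise strict inequalities on a set of full measure survive
  integration.\<close>

lemma measure_P_near_quantile:
  assumes \<eta>: "0 < \<eta>"
  shows "\<alpha> < measure P {z. snd z \<le> q\<alpha> (fst z) + \<eta>}" "measure P {z. snd z \<le> q\<alpha> (fst z) - \<eta>} < \<alpha>"
proof -
  interpret mu: prob_space \<mu> by (rule prob_space_mu)
  have [measurable]: "(\<lambda>x. cdf (K x) (q\<alpha> x + \<eta>)) \<in> borel_measurable borel"
    "(\<lambda>x. cdf (K x) (q\<alpha> x - \<eta>)) \<in> borel_measurable borel"
    by (rule cdf_K_measurable; measurable)+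
  have int: "integrable \<mu> (\<lambda>x. cdf (K x) (q\<alpha> x + \<eta>))" "integrable \<mu> (\<lambda>x. cdf (K x) (q\<alpha> x - \<eta>))"
    by (rule mu.integrable_const_bound[where B=1]; use cdf_K_bounds in auto)+
  have "(\<integral>x. \<alpha> \<partial>\<mu>) < (\<integral>x. cdf (K x) (q\<alpha> x + \<eta>) \<partial>\<mu>)"
  proof (rule mu.integral_less_AE_space[OF _ int(1)])
    show "AE x in \<mu>. \<alpha> < cdf (K x) (q\<alpha> x + \<eta>)"
      using AE_mu_support by eventually_elim (rule cdf_near_quantile(2)[OF _ \<eta>])
  qed (simp_all add: mu.emeasure_space_1)
  then show "\<alpha> < measure P {z. snd z \<le> q\<alpha> (fst z) + \<eta>}"
    by (subst measure_P_below) (simp_all add: mu.prob_space)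
  have "(\<integral>x. cdf (K x) (q\<alpha> x - \<eta>) \<partial>\<mu>) < (\<integral>x. \<alpha> \<partial>\<mu>)"
  proof (rule mu.integral_less_AE_space[OF int(2)])
    show "AE x in \<mu>. cdf (K x) (q\<alpha> x - \<eta>) < \<alpha>"
      using AE_mu_support by eventually_elim (rule cdf_near_quantile(1)[OF _ \<eta>])
  qed (simp_all add: mu.emeasure_space_1)
  then show "measure P {z. snd z \<le> q\<alpha> (fst z) - \<eta>} < \<alpha>"
    by (subst measure_P_below) (simp_all add: mu.prob_space)
qed

section \<open>Averages over the calibration set\<close>

definition calib_fraction :: "((real ^ 'n) \<times> real) set \<Rightarrow> nat \<Rightarrow> 'w \<Rightarrow> real" where
  "calib_fraction A n \<omega> = (\<Sum>i\<in>I2 n. indicat_real A (Xs i \<omega>, Ys i \<omega>)) / real (card (I2 n))"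

lemma calib_fraction_measurable [measurable]:
  assumes A: "A \<in> sets borel"
  shows "calib_fraction A n \<in> borel_measurable M"
proof -
  have [measurable]: "(\<lambda>\<omega>. indicat_real A (Xs i \<omega>, Ys i \<omega>)) \<in> borel_measurable M" if "i \<in> I2 n" for i
    by (rule measurable_compose[OF XYs_measurable[OF I_ge_1(2)[OF that]] borel_measurable_indicator[OF A]])
  show ?thesis unfolding calib_fraction_def[abs_def] by measurable
qed

lemma sum_div_card_le_1:
  fixes f :: "nat \<Rightarrow> real"
  assumes "\<And>i. i \<in> I \<Longrightarrow> f i \<le> 1"
  shows "(\<Sum>i\<in>I. f i) / real (card I) \<le> 1"
proof -
  have "(\<Sum>i\<in>I. f i) \<le> (\<Sum>i\<in>I. 1)" using assms by (intro sum_mono)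
  then show ?thesis by (cases "card I = 0") (auto simp: divide_le_eq_1)
qed

text \<open>Law of large numbers for a fixed set; the calibration pairs are i.i.d. and
  \<open>A\<close> does not involve the forest.\<close>

lemma calib_fraction_tendsto:
  assumes A[measurable]: "A \<in> sets borel" and c: "0 < c"
  shows "(\<lambda>n. prob {\<omega> \<in> space M. c \<le> \<bar>calib_fraction A n \<omega> - measure P A\<bar>}) \<longlonglongrightarrow> 0"
proof (rule markov_tendsto_0[OF _ _ _ _ c])
  interpret P: prob_space P by (rule prob_space_P)
  show "(\<lambda>\<omega>. \<bar>calib_fraction A n \<omega> - measure P A\<bar>) \<in> borel_measurable M" for n by measurable
  show "integrable M (\<lambda>\<omega>. \<bar>calib_fraction A n \<omega> - measure P A\<bar>)" for n
  proof (rule integrable_const_bound[where B=1])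
    have "0 \<le> calib_fraction A n \<omega>" for \<omega>
      unfolding calib_fraction_def by (intro divide_nonneg_nonneg sum_nonneg) auto
    moreover have "calib_fraction A n \<omega> \<le> 1" for \<omega>
      unfolding calib_fraction_def by (rule sum_div_card_le_1) (simp add: indicator_def)
    moreover have "0 \<le> measure P A" "measure P A \<le> 1" by auto
    ultimately show "AE \<omega> in M. norm \<bar>calib_fraction A n \<omega> - measure P A\<bar> \<le> 1"
      by (intro AE_I2) (smt (verit) real_norm_def)
  qed measurable
  show "(\<lambda>n. expectation (\<lambda>\<omega>. \<bar>calib_fraction A n \<omega> - measure P A\<bar>)) \<longlonglongrightarrow> 0"
  proof (rule tendsto_sandwich[of "\<lambda>_. 0"])
    show "(\<lambda>n. 1 / sqrt (real (card (I2 n)))) \<longlonglongrightarrow> 0"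
      by (intro real_tendsto_divide_at_top[OF tendsto_const] filterlim_compose[OF sqrt_at_top]
        filterlim_compose[OF filterlim_real_sequentially] calibration_size)
    have "\<forall>\<^sub>F n in sequentially. 1 \<le> card (I2 n)"
      using calibration_size unfolding filterlim_at_top by blast
    then show "\<forall>\<^sub>F n in sequentially. expectation (\<lambda>\<omega>. \<bar>calib_fraction A n \<omega> - measure P A\<bar>)
        \<le> 1 / sqrt (real (card (I2 n)))"
    proof eventually_elim
      case (elim n)
      show ?case unfolding calib_fraction_def
        using elim I_ge_1(2)[of _ n]
        by (intro expectation_empirical_deviation[where N=borel] indep_XYs distr_XYs) auto
    qed
  qed auto
qed auto

text \<open>The event may involve the training data and the randomness, but not the calibration
  data: the equality of laws is with these two only.\<close>

lemma prob_Xs_eq_prob_X: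
  assumes i: "i \<in> I2 n" and G[measurable]: "Measurable.pred ((trainM n \<Otimes>\<^sub>M \<Theta>M n) \<Otimes>\<^sub>M borel) G"
  shows "prob {\<omega> \<in> space M. G ((train n \<omega>, \<Theta> n \<omega>), Xs i \<omega>)}
      = prob {\<omega> \<in> space M. G ((train n \<omega>, \<Theta> n \<omega>), X \<omega>)}"
proof -
  let ?W = "(trainM n \<Otimes>\<^sub>M \<Theta>M n) \<Otimes>\<^sub>M borel"
  have [measurable]: "Xs i \<in> borel_measurable M" using I_ge_1(2)[OF i] by measurable
  have S: "{z \<in> space ?W. G z} \<in> sets ?W" by measurable
  have "prob {\<omega> \<in> space M. G ((train n \<omega>, \<Theta> n \<omega>), f \<omega>)}
      = measure (distr M ?W (\<lambda>\<omega>. ((train n \<omega>, \<Theta> n \<omega>), f \<omega>))) {z \<in> space ?W. G z}"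
    if [measurable]: "f \<in> borel_measurable M" for f
  proof -
    have m: "(\<lambda>\<omega>. ((train n \<omega>, \<Theta> n \<omega>), f \<omega>)) \<in> M \<rightarrow>\<^sub>M ?W" by measurable
    show ?thesis
      unfolding measure_distr[OF m S] using measurable_space[OF m]
      by (intro arg_cong[where f="measure M"]) auto
  qed
  then show ?thesis using distr_forest_Xs[OF i] distr_forest_X[of n] by simp
qed

definition v_of :: "nat \<Rightarrow> (nat \<Rightarrow> (real ^ 'n) \<times> real) \<times> (nat \<Rightarrow> 'c) \<Rightarrow> real ^ 'n \<Rightarrow> real" where
  "v_of n D x = weighted_quantile \<alpha> (I1 n) (weight_of n D x) (\<lambda>i. snd (fst D i))"

lemma weighted_quantile_cong:
  assumes "\<And>i. i \<in> I \<Longrightarrow> w i = w' i" "\<And>i. i \<in> I \<Longrightarrow> y i = y' i"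
  shows "weighted_quantile a I w y = weighted_quantile a I w' y'"
  unfolding weighted_quantile_def using assms by (simp cong: sum.cong)

lemma v_of_eq: "v_of n (train n \<omega>, \<Theta> n \<omega>) x = v n \<omega> x"
  unfolding v_of_def v_def qrf_eq
  by (intro weighted_quantile_cong) (auto simp: weight_of_eq train_apply)

lemma v_of_measurable [measurable]:
  "(\<lambda>z. v_of n (fst z) (snd z)) \<in> borel_measurable ((trainM n \<Otimes>\<^sub>M \<Theta>M n) \<Otimes>\<^sub>M borel)"
  unfolding v_of_def
proof (intro weighted_quantile_measurable finite_I alpha)
  show "0 \<le> weight_of n (fst z) (snd z) i" for z i by (simp add: weight_of_def)
  show "(\<lambda>z. snd (fst (fst z) i)) \<in> borel_measurable ((trainM n \<Otimes>\<^sub>M \<Theta>M n) \<Otimes>\<^sub>M borel)" if "i \<in> I1 n" for i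
    by (rule measurable_compose[OF measurable_compose[OF measurable_fst measurable_fst] train_component_measurable(3)[OF that]])
qed measurable

definition calib_failures :: "(real \<Rightarrow> real ^ 'n \<Rightarrow> bool) \<Rightarrow> nat \<Rightarrow> 'w \<Rightarrow> real" where
  "calib_failures G n \<omega> = (\<Sum>i\<in>I2 n. of_bool (G (v n \<omega> (Xs i \<omega>)) (Xs i \<omega>))) / real (card (I2 n))"

text \<open>The calibration points share one forest, but linearity suffices: the mean fraction of
  failures equals the probability of failure at \<open>X\<close>, and the Markov inequality
  concludes.\<close>

lemma calib_failures_tendsto_0:
  fixes G :: "real \<Rightarrow> real ^ 'n \<Rightarrow> bool"
  assumes G: "Measurable.pred (borel \<Otimes>\<^sub>M borel) (\<lambda>(u, x). G u x)"
    and lim: "(\<lambda>n. prob {\<omega> \<in> space M. G (v n \<omega> (X \<omega>)) (X \<omega>)}) \<longlonglongrightarrow> 0" and c: "0 < c"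
  shows "(\<lambda>n. prob {\<omega> \<in> space M. c \<le> calib_failures G n \<omega>}) \<longlonglongrightarrow> 0"
    and "Measurable.pred M (\<lambda>\<omega>. c \<le> calib_failures G n \<omega>)"
proof -
  let ?U = "calib_failures G"
  have Gv: "Measurable.pred M (\<lambda>\<omega>. G (v n \<omega> (Xs i \<omega>)) (Xs i \<omega>))" if "i \<in> I2 n" for n i
    using I_ge_1(2)[OF that] measurable_compose[OF measurable_Pair G, of "\<lambda>\<omega>. v n \<omega> (Xs i \<omega>)" M "Xs i"] by simp
  have GvX: "Measurable.pred M (\<lambda>\<omega>. G (v n \<omega> (X \<omega>)) (X \<omega>))" for n
    using measurable_compose[OF measurable_Pair G, of "\<lambda>\<omega>. v n \<omega> (X \<omega>)" M X] by simp
  have Um: "?U n \<in> borel_measurable M" for n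
    unfolding calib_failures_def[abs_def] using Gv by measurable
  then show "Measurable.pred M (\<lambda>\<omega>. c \<le> ?U n \<omega>)" by measurable
  have U0: "0 \<le> ?U n \<omega>" for n \<omega>
    unfolding calib_failures_def by (intro divide_nonneg_nonneg sum_nonneg) auto
  have U1: "?U n \<omega> \<le> 1" for n \<omega>
    unfolding calib_failures_def by (rule sum_div_card_le_1) simp
  have EU: "expectation (?U n) = prob {\<omega> \<in> space M. G (v n \<omega> (X \<omega>)) (X \<omega>)}" if n: "1 \<le> card (I2 n)" for n
  proof -
    have Ei: "expectation (\<lambda>\<omega>. of_bool (G (v n \<omega> (Xs i \<omega>)) (Xs i \<omega>)) :: real) = prob {\<omega> \<in> space M. G (v n \<omega> (X \<omega>)) (X \<omega>)}"
      if i: "i \<in> I2 n" for i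
    proof -
      have "expectation (\<lambda>\<omega>. of_bool (G (v n \<omega> (Xs i \<omega>)) (Xs i \<omega>)) :: real)
          = expectation (indicator {\<omega> \<in> space M. G (v n \<omega> (Xs i \<omega>)) (Xs i \<omega>)})"
        by (intro Bochner_Integration.integral_cong) (auto simp: indicator_def)
      also have "\<dots> = prob {\<omega> \<in> space M. G (v n \<omega> (Xs i \<omega>)) (Xs i \<omega>)}"
        using Gv[OF i] by (simp add: pred_def)
      also have "\<dots> = prob {\<omega> \<in> space M. G (v n \<omega> (X \<omega>)) (X \<omega>)}"
      proof -
        have "Measurable.pred ((trainM n \<Otimes>\<^sub>M \<Theta>M n) \<Otimes>\<^sub>M borel) (\<lambda>z. G (v_of n (fst z) (snd z)) (snd z))"
          using measurable_compose[OF measurable_Pair[OF v_of_measurable measurable_snd] G] by simp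
        from prob_Xs_eq_prob_X[OF i this] show ?thesis by (simp add: v_of_eq)
      qed
      finally show ?thesis .
    qed
    have "expectation (?U n) = (\<Sum>i\<in>I2 n. expectation (\<lambda>\<omega>. of_bool (G (v n \<omega> (Xs i \<omega>)) (Xs i \<omega>)))) / real (card (I2 n))"
      unfolding calib_failures_def[abs_def] using Gv
      by (subst integral_divide_zero, subst Bochner_Integration.integral_sum)
        (auto intro!: integrable_const_bound[where B=1])
    also have "\<dots> = prob {\<omega> \<in> space M. G (v n \<omega> (X \<omega>)) (X \<omega>)}"
      using n by (cases "I2 n = {}") (auto simp: Ei)
    finally show ?thesis .
  qed
  show "(\<lambda>n. prob {\<omega> \<in> space M. c \<le> ?U n \<omega>}) \<longlonglongrightarrow> 0"
  proof (rule markov_tendsto_0[OF Um _ U0 _ c])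
    show "integrable M (?U n)" for n
      using Um U0 U1 by (intro integrable_const_bound[where B=1]) auto
    have "\<forall>\<^sub>F n in sequentially. 1 \<le> card (I2 n)"
      using calibration_size unfolding filterlim_at_top by blast
    then have "\<forall>\<^sub>F n in sequentially. prob {\<omega> \<in> space M. G (v n \<omega> (X \<omega>)) (X \<omega>)} = expectation (?U n)"
      by eventually_elim (simp add: EU)
    then show "(\<lambda>n. expectation (?U n)) \<longlonglongrightarrow> 0" by (rule Lim_transform_eventually[OF lim])
  qed
qed

definition correction :: "nat \<Rightarrow> 'w \<Rightarrow> real" where
  "correction n \<omega> = empirical_quantile \<alpha> (I2 n) (\<lambda>i. Ys i \<omega> - v n \<omega> (Xs i \<omega>))"

lemma correction_measurable [measurable]: "correction n \<in> borel_measurable M"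
  unfolding correction_def[abs_def] empirical_quantile_eq[OF finite_I(2)] using I_ge_1(2)[of _ n] alpha
  by (intro weighted_quantile_measurable) auto

lemma correction_le_iff:
  assumes "I2 n \<noteq> {}"
  shows "correction n \<omega> \<le> c \<longleftrightarrow> \<alpha> \<le> (\<Sum>i\<in>I2 n. of_bool (Ys i \<omega> - v n \<omega> (Xs i \<omega>) \<le> c)) / real (card (I2 n))"
proof -
  have "correction n \<omega> \<le> c \<longleftrightarrow> \<alpha> \<le> (\<Sum>i\<in>I2 n. 1 / real (card (I2 n)) * of_bool (Ys i \<omega> - v n \<omega> (Xs i \<omega>) \<le> c))"
    unfolding correction_def empirical_quantile_eq[OF finite_I(2)]
    using assms alpha by (intro weighted_quantile_le_iff) auto
  also have "(\<Sum>i\<in>I2 n. 1 / real (card (I2 n)) * of_bool (Ys i \<omega> - v n \<omega> (Xs i \<omega>) \<le> c))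
      = 1 / real (card (I2 n)) * (\<Sum>i\<in>I2 n. of_bool (Ys i \<omega> - v n \<omega> (Xs i \<omega>) \<le> c))"
    by (simp only: sum_distrib_left)
  finally show ?thesis by simp
qed

text \<open>The condition is deterministic; as an event it can be added to a union bound.\<close>

lemma no_calibration_tendsto_0: "(\<lambda>n. prob {\<omega> \<in> space M. I2 n = {}}) \<longlonglongrightarrow> 0"
proof -
  have "\<forall>\<^sub>F n in sequentially. 1 \<le> card (I2 n)"
    using calibration_size unfolding filterlim_at_top by blast
  then have "\<forall>\<^sub>F n in sequentially. prob {\<omega> \<in> space M. I2 n = {}} = 0"
  proof eventually_elim
    case (elim n)
    then have "I2 n \<noteq> {}" by auto
    then show ?case by simp
  qed
  then show ?thesis by (rule tendsto_eventually)
qed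

lemma sum_div_card_mono:
  fixes f g :: "nat \<Rightarrow> real"
  assumes "\<And>i. i \<in> I \<Longrightarrow> f i \<le> g i + h i"
  shows "(\<Sum>i\<in>I. f i) / real (card I) \<le> (\<Sum>i\<in>I. g i) / real (card I) + (\<Sum>i\<in>I. h i) / real (card I)"
proof -
  have "(\<Sum>i\<in>I. f i) \<le> (\<Sum>i\<in>I. g i) + (\<Sum>i\<in>I. h i)"
    using assms unfolding sum.distrib[symmetric] by (intro sum_mono)
  then show ?thesis by (simp add: divide_right_mono flip: add_divide_distrib)
qed

text \<open>Up to the rare calibration points where the forest quantile is off by more than half the
  tolerance, the scores can be compared with those of the true quantile, which are i.i.d.\<close>

lemma correction_upper:
  assumes \<eta>: "0 < \<eta>"
  shows "(\<lambda>n. prob {\<omega> \<in> space M. \<eta> < correction n \<omega>}) \<longlonglongrightarrow> 0"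
proof -
  \<comment> \<open>The tolerance \<eta> is halved: one half for the ideal score, the other for the
    error of the forest quantile.\<close>
  define A where "A = {z :: (real ^ 'n) \<times> real. snd z \<le> q\<alpha> (fst z) + \<eta> / 2}"
  define G where "G u x \<longleftrightarrow> u < q\<alpha> x - \<eta> / 2" for u x
  \<comment> \<open>Half of the margin for the frequency of \<open>A\<close>, half for the
    failures.\<close>
  define c where "c = (measure P A - \<alpha>) / 2"
  have A[measurable]: "A \<in> sets borel" unfolding A_def by (rule below_borel) measurable
  have c: "0 < c" using measure_P_near_quantile(1)[of "\<eta> / 2"] \<eta> by (simp add: c_def A_def)
  have G: "Measurable.pred (borel \<Otimes>\<^sub>M borel) (\<lambda>(u, x). G u x)" unfolding G_def by measurable
  have lim: "(\<lambda>n. prob {\<omega> \<in> space M. G (v n \<omega> (X \<omega>)) (X \<omega>)}) \<longlonglongrightarrow> 0"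
    unfolding G_def using \<eta> by (intro v_lower) simp
  let ?U = "calib_failures G"
  note U = calib_failures_tendsto_0[OF G lim c]
  note [measurable] = U(2)
  have 1: "(\<lambda>n. prob {\<omega> \<in> space M. c \<le> \<bar>calib_fraction A n \<omega> - measure P A\<bar> \<or> c \<le> ?U n \<omega>}) \<longlonglongrightarrow> 0"
    by (rule prob_tendsto_0_Un[OF _ _ _ calib_fraction_tendsto[OF A c] U(1)]) auto
  show ?thesis
  proof (rule prob_tendsto_0_Un[OF _ _ _ 1 no_calibration_tendsto_0])
    fix n
    show "AE \<omega> in M. \<eta> < correction n \<omega> \<longrightarrow>
      (c \<le> \<bar>calib_fraction A n \<omega> - measure P A\<bar> \<or> c \<le> ?U n \<omega>) \<or> I2 n = {}"
    proof (intro AE_I2 impI, rule ccontr)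
      fix \<omega> assume a: "\<eta> < correction n \<omega>"
        and b: "\<not> ((c \<le> \<bar>calib_fraction A n \<omega> - measure P A\<bar> \<or> c \<le> ?U n \<omega>) \<or> I2 n = {})"
      let ?s = "(\<Sum>i\<in>I2 n. of_bool (Ys i \<omega> - v n \<omega> (Xs i \<omega>) \<le> \<eta>)) / real (card (I2 n))"
      have "?s < \<alpha>" using a b correction_le_iff[of n \<omega> \<eta>] by auto
      \<comment> \<open>If the ideal score is at most \<open>\<eta> / 2\<close> and the forest
        quantile is not too low by more than \<open>\<eta> / 2\<close>, the actual score is at most
        \<eta>.\<close>
      moreover have "calib_fraction A n \<omega> \<le> ?s + ?U n \<omega>"
        unfolding calib_fraction_def calib_failures_def
        by (intro sum_div_card_mono) (auto simp: A_def G_def indicator_def)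
      ultimately show False using b c unfolding c_def by (auto simp: abs_less_iff not_le)
    qed
  qed measurable
qed

text \<open>Mirror image of the upper bound: a score at most \<open>-\<eta>\<close> together with a
  forest quantile at most \<open>\<eta> / 2\<close> too high forces the ideal score below
  \<open>-\<eta> / 2\<close>, which happens with frequency near a number less than \<alpha>.\<close>

lemma correction_lower:
  assumes \<eta>: "0 < \<eta>"
  shows "(\<lambda>n. prob {\<omega> \<in> space M. correction n \<omega> \<le> - \<eta>}) \<longlonglongrightarrow> 0"
proof -
  define A where "A = {z :: (real ^ 'n) \<times> real. snd z \<le> q\<alpha> (fst z) - \<eta> / 2}"
  define G where "G u x \<longleftrightarrow> q\<alpha> x + \<eta> / 2 < u" for u x
  define c where "c = (\<alpha> - measure P A) / 2"
  have A[measurable]: "A \<in> sets borel" unfolding A_def by (rule below_borel) measurable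
  have c: "0 < c" using measure_P_near_quantile(2)[of "\<eta> / 2"] \<eta> by (simp add: c_def A_def)
  have G: "Measurable.pred (borel \<Otimes>\<^sub>M borel) (\<lambda>(u, x). G u x)" unfolding G_def by measurable
  have lim: "(\<lambda>n. prob {\<omega> \<in> space M. G (v n \<omega> (X \<omega>)) (X \<omega>)}) \<longlonglongrightarrow> 0"
    unfolding G_def using \<eta> by (intro v_upper) simp
  let ?U = "calib_failures G"
  note U = calib_failures_tendsto_0[OF G lim c]
  note [measurable] = U(2)
  have 1: "(\<lambda>n. prob {\<omega> \<in> space M. c \<le> \<bar>calib_fraction A n \<omega> - measure P A\<bar> \<or> c \<le> ?U n \<omega>}) \<longlonglongrightarrow> 0"
    by (rule prob_tendsto_0_Un[OF _ _ _ calib_fraction_tendsto[OF A c] U(1)]) auto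
  show ?thesis
  proof (rule prob_tendsto_0_Un[OF _ _ _ 1 no_calibration_tendsto_0])
    fix n
    show "AE \<omega> in M. correction n \<omega> \<le> - \<eta> \<longrightarrow>
      (c \<le> \<bar>calib_fraction A n \<omega> - measure P A\<bar> \<or> c \<le> ?U n \<omega>) \<or> I2 n = {}"
    proof (intro AE_I2 impI, rule ccontr)
      fix \<omega> assume a: "correction n \<omega> \<le> - \<eta>"
        and b: "\<not> ((c \<le> \<bar>calib_fraction A n \<omega> - measure P A\<bar> \<or> c \<le> ?U n \<omega>) \<or> I2 n = {})"
      let ?s = "(\<Sum>i\<in>I2 n. of_bool (Ys i \<omega> - v n \<omega> (Xs i \<omega>) \<le> - \<eta>)) / real (card (I2 n))"
      have "\<alpha> \<le> ?s" using a b correction_le_iff[of n \<omega> "- \<eta>"] by auto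
      moreover have "?s \<le> calib_fraction A n \<omega> + ?U n \<omega>"
        unfolding calib_fraction_def calib_failures_def
        by (intro sum_div_card_mono) (auto simp: A_def G_def indicator_def)
      ultimately show False using b c unfolding c_def by (auto simp: abs_less_iff not_le)
    qed
  qed measurable
qed

section \<open>The coverage error at the independent test point\<close>

definition coverage_error :: "nat \<Rightarrow> 'w \<Rightarrow> real" where
  "coverage_error n \<omega> = \<bar>cdf (K (X \<omega>)) (v n \<omega> (X \<omega>) + correction n \<omega>) - \<alpha>\<bar>"

lemma coverage_error_measurable [measurable]: "coverage_error n \<in> borel_measurable M"
proof -
  have [measurable]: "(\<lambda>\<omega>. cdf (K (X \<omega>)) (v n \<omega> (X \<omega>) + correction n \<omega>)) \<in> borel_measurable M"
    by (rule cdf_K_measurable) measurable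
  show ?thesis unfolding coverage_error_def[abs_def] by measurable
qed

lemma coverage_error_bounds: "0 \<le> coverage_error n \<omega>" "coverage_error n \<omega> \<le> 1"
  unfolding coverage_error_def using cdf_K_bounds[of "X \<omega>" "v n \<omega> (X \<omega>) + correction n \<omega>"] alpha
  by (auto simp: abs_le_iff)

lemma coverage_error_tendsto_0_in_prob:
  assumes e: "0 < e"
  shows "(\<lambda>n. prob {\<omega> \<in> space M. e \<le> coverage_error n \<omega>}) \<longlonglongrightarrow> 0"
proof -
  define \<eta> where "\<eta> k = 1 / real (Suc k)" for k
  have \<eta>: "0 < \<eta> k" for k by (simp add: \<eta>_def)
  have \<eta>_lim: "\<eta> \<longlonglongrightarrow> 0" unfolding \<eta>_def[abs_def] using LIMSEQ_inverse_real_of_nat by (simp add: inverse_eq_divide)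
  \<comment> \<open>Forest quantile and correction are each off by at most \<open>\<eta> k\<close>,
    together by \<open>2 * \<eta> k\<close>. \<open>C k\<close> holds where this shift moves the
    conditional distribution function by at least \<open>e\<close>; continuity at \<open>X\<close>
    excludes it for large \<open>k\<close>.\<close>
  define C where "C k \<omega> \<longleftrightarrow> \<alpha> + e \<le> cdf (K (X \<omega>)) (q\<alpha> (X \<omega>) + 2 * \<eta> k)
      \<or> cdf (K (X \<omega>)) (q\<alpha> (X \<omega>) - 2 * \<eta> k) \<le> \<alpha> - e" for k \<omega>
  have [measurable]: "(\<lambda>\<omega>. cdf (K (X \<omega>)) (q\<alpha> (X \<omega>) + 2 * \<eta> k)) \<in> borel_measurable M"
    "(\<lambda>\<omega>. cdf (K (X \<omega>)) (q\<alpha> (X \<omega>) - 2 * \<eta> k)) \<in> borel_measurable M" for k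
    by (rule cdf_K_measurable; measurable)+
  have Cm[measurable]: "Measurable.pred M (C k)" for k unfolding C_def[abs_def] by measurable
  let ?up = "\<lambda>k n \<omega>. q\<alpha> (X \<omega>) + \<eta> k < v n \<omega> (X \<omega>) \<or> \<eta> k < correction n \<omega>"
  let ?lo = "\<lambda>k n \<omega>. v n \<omega> (X \<omega>) < q\<alpha> (X \<omega>) - \<eta> k \<or> correction n \<omega> \<le> - \<eta> k"
  have up: "(\<lambda>n. prob {\<omega> \<in> space M. ?up k n \<omega>}) \<longlonglongrightarrow> 0" for k
    by (rule prob_tendsto_0_Un[OF _ _ _ v_upper[OF \<eta>, of k] correction_upper[OF \<eta>, of k]]) auto
  have lo: "(\<lambda>n. prob {\<omega> \<in> space M. ?lo k n \<omega>}) \<longlonglongrightarrow> 0" for k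
    by (rule prob_tendsto_0_Un[OF _ _ _ v_lower[OF \<eta>, of k] correction_lower[OF \<eta>, of k]]) auto
  show ?thesis
  proof (rule prob_tendsto_0_approx[where Q="\<lambda>k n \<omega>. ?up k n \<omega> \<or> ?lo k n \<omega>" and C=C])
    show "(\<lambda>n. prob {\<omega> \<in> space M. ?up k n \<omega> \<or> ?lo k n \<omega>}) \<longlonglongrightarrow> 0" for k
      by (rule prob_tendsto_0_Un[OF _ _ _ up[of k] lo[of k]]) auto
    show "(\<lambda>k. prob {\<omega> \<in> space M. C k \<omega>}) \<longlonglongrightarrow> 0"
    proof (rule AE_eventually_imp_prob_tendsto_0[OF Cm])
      show "AE \<omega> in M. \<forall>\<^sub>F k in sequentially. \<not> C k \<omega>"
        using AE_X_support
      proof eventually_elim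
        case (elim \<omega>)
        let ?q = "q\<alpha> (X \<omega>)"
        have "(\<lambda>k. cdf (K (X \<omega>)) (?q + 2 * \<eta> k)) \<longlonglongrightarrow> cdf (K (X \<omega>)) (?q + 2 * 0)"
          "(\<lambda>k. cdf (K (X \<omega>)) (?q - 2 * \<eta> k)) \<longlonglongrightarrow> cdf (K (X \<omega>)) (?q - 2 * 0)"
          by (intro isCont_tendsto_compose[OF isCont_cdf_K[OF elim]] tendsto_intros \<eta>_lim)+
        then have "(\<lambda>k. cdf (K (X \<omega>)) (?q + 2 * \<eta> k)) \<longlonglongrightarrow> \<alpha>"
          "(\<lambda>k. cdf (K (X \<omega>)) (?q - 2 * \<eta> k)) \<longlonglongrightarrow> \<alpha>"
          by (simp_all add: cdf_quantile[OF alpha elim])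
        from order_tendstoD(2)[OF this(1), of "\<alpha> + e"] order_tendstoD(1)[OF this(2), of "\<alpha> - e"]
        have "\<forall>\<^sub>F k in sequentially. cdf (K (X \<omega>)) (?q + 2 * \<eta> k) < \<alpha> + e"
          "\<forall>\<^sub>F k in sequentially. \<alpha> - e < cdf (K (X \<omega>)) (?q - 2 * \<eta> k)" using e by auto
        then show ?case by eventually_elim (simp add: C_def)
      qed
    qed
    show "AE \<omega> in M. e \<le> coverage_error n \<omega> \<longrightarrow> (?up k n \<omega> \<or> ?lo k n \<omega>) \<or> C k \<omega>" for k n
    proof (intro AE_I2 impI, rule ccontr)
      fix \<omega> assume a: "e \<le> coverage_error n \<omega>" and b: "\<not> ((?up k n \<omega> \<or> ?lo k n \<omega>) \<or> C k \<omega>)"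
      let ?c = "v n \<omega> (X \<omega>) + correction n \<omega>"
      have "?c \<le> q\<alpha> (X \<omega>) + 2 * \<eta> k" "q\<alpha> (X \<omega>) - 2 * \<eta> k \<le> ?c" using b by auto
      then have "cdf (K (X \<omega>)) ?c \<le> cdf (K (X \<omega>)) (q\<alpha> (X \<omega>) + 2 * \<eta> k)"
        "cdf (K (X \<omega>)) (q\<alpha> (X \<omega>) - 2 * \<eta> k) \<le> cdf (K (X \<omega>)) ?c"
        by (auto intro: cdf_K_mono)
      then show False using a b unfolding C_def coverage_error_def by (auto simp: abs_real_def split: if_splits)
    qed
  qed measurable
qed

text \<open>The error is bounded by 1, so convergence in probability becomes convergence in mean.
  The mean is a numerical null sequence from which the tolerance of the random sets is
  built.\<close>

lemma coverage_error_expectation_tendsto_0: "(\<lambda>n. expectation (coverage_error n)) \<longlonglongrightarrow> 0"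
  and coverage_error_integrable: "integrable M (coverage_error n)"
proof -
  show int: "integrable M (coverage_error n)" for n
    using coverage_error_bounds by (intro integrable_const_bound[where B=1]) auto
  show "(\<lambda>n. expectation (coverage_error n)) \<longlonglongrightarrow> 0"
  proof (rule LIMSEQ_I)
    fix r :: real assume r: "0 < r"
    have "\<forall>\<^sub>F n in sequentially. prob {\<omega> \<in> space M. r / 2 \<le> coverage_error n \<omega>} < r / 2"
      by (rule order_tendstoD[OF coverage_error_tendsto_0_in_prob]) (use r in auto)
    then have "\<forall>\<^sub>F n in sequentially. norm (expectation (coverage_error n) - 0) < r"
    proof eventually_elim
      case (elim n)
      define S where "S = {\<omega> \<in> space M. r / 2 \<le> coverage_error n \<omega>}"
      have [measurable]: "S \<in> sets M" unfolding S_def by measurable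
      have intS: "integrable M (indicat_real S)"
        by (intro integrable_real_indicator) (simp_all add: emeasure_eq_measure)
      have "expectation (coverage_error n) \<le> expectation (\<lambda>\<omega>. r / 2 + indicat_real S \<omega>)"
      proof (rule integral_mono[OF int])
        show "coverage_error n \<omega> \<le> r / 2 + indicator S \<omega>" if "\<omega> \<in> space M" for \<omega>
          using that coverage_error_bounds[of n \<omega>] r by (auto simp: S_def indicator_def)
      qed (use intS in simp)
      also have "\<dots> = r / 2 + prob S" using intS by (simp add: prob_space)
      also have "prob S < r / 2" using elim by (simp add: S_def)
      finally show ?case using coverage_error_bounds by (simp add: integral_nonneg)
    qed
    then show "\<exists>no. \<forall>n\<ge>no. norm (expectation (coverage_error n) - 0) < r"
      by (simp only: eventually_sequentially)
  qed
qed

text \<open>The conformal estimate factored through the offline sample and the forest randomness, so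
  that the random sets are functions of these alone.\<close>

definition vc_of :: "nat \<Rightarrow> (nat \<Rightarrow> (real ^ 'n) \<times> real) \<times> (nat \<Rightarrow> 'c) \<Rightarrow> real ^ 'n \<Rightarrow> real" where
  "vc_of n D x = v_of n (restrict (fst D) (I1 n), snd D) x
     + empirical_quantile \<alpha> (I2 n) (\<lambda>i. snd (fst D i) - v_of n (restrict (fst D) (I1 n), snd D) (fst (fst D i)))"

lemma vc_of_eq: "vc_of n (sample n \<omega>, \<Theta> n \<omega>) x = v n \<omega> x + correction n \<omega>"
proof -
  have "sample n \<omega> i = (Xs i \<omega>, Ys i \<omega>)" if "i \<in> I2 n" for i
    using that I_subset(2)[of n] by (auto simp: sample_eq(1))
  then have "{i \<in> I2 n. snd (sample n \<omega> i) - v n \<omega> (fst (sample n \<omega> i)) \<le> q}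
      = {i \<in> I2 n. Ys i \<omega> - v n \<omega> (Xs i \<omega>) \<le> q}" for q
    by auto
  then show ?thesis
    by (simp add: vc_of_def correction_def restrict_sample v_of_eq empirical_quantile_def)
qed

lemma vc_of_measurable:
  "(\<lambda>z. vc_of n (fst z) (snd z)) \<in> borel_measurable ((sampleM n \<Otimes>\<^sub>M \<Theta>M n) \<Otimes>\<^sub>M borel)"
proof -
  let ?W = "(sampleM n \<Otimes>\<^sub>M \<Theta>M n) \<Otimes>\<^sub>M (borel :: (real ^ 'n) measure)"
  have D: "(\<lambda>z. (restrict (fst (fst z)) (I1 n), snd (fst z))) \<in> ?W \<rightarrow>\<^sub>M trainM n \<Otimes>\<^sub>M \<Theta>M n"
    by (intro measurable_Pair measurable_compose[OF _ restrict_train] measurable_compose[OF measurable_fst measurable_fst]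
        measurable_compose[OF measurable_fst measurable_snd])
  have v: "(\<lambda>z. v_of n (restrict (fst (fst z)) (I1 n), snd (fst z)) (f z)) \<in> borel_measurable ?W"
    if "f \<in> borel_measurable ?W" for f
    using measurable_compose[OF measurable_Pair[OF D that] v_of_measurable] by simp
  have c: "(\<lambda>z. fst (fst z) i) \<in> borel_measurable ?W" if "i \<in> I2 n" for i
  proof -
    have "(\<lambda>d. d i) \<in> sampleM n \<rightarrow>\<^sub>M borel"
      unfolding sample_eq(2) using that I_subset(2)[of n] by (intro measurable_component_singleton) auto
    from measurable_compose[OF measurable_compose[OF measurable_fst measurable_fst] this] show ?thesis .
  qed
  have "(\<lambda>z. empirical_quantile \<alpha> (I2 n) (\<lambda>i. snd (fst (fst z) i)
      - v_of n (restrict (fst (fst z)) (I1 n), snd (fst z)) (fst (fst (fst z) i)))) \<in> borel_measurable ?W"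
    unfolding empirical_quantile_eq[OF finite_I(2)]
    using measurable_compose[OF c fst_snd_borel(1)] measurable_compose[OF c fst_snd_borel(2)] v alpha
    by (intro weighted_quantile_measurable borel_measurable_diff) auto
  then show ?thesis unfolding vc_of_def using v[OF measurable_snd] by (intro borel_measurable_add)
qed

text \<open>On the sets the error is bounded by the tolerance by construction, so the content is
  that \<open>X\<close> falls into them with probability tending to 1.\<close>

lemma conformal_coverage:
  "\<exists>\<Lambda> :: nat \<Rightarrow> (nat \<Rightarrow> (real ^ 'n) \<times> real) \<times> (nat \<Rightarrow> 'c) \<Rightarrow> (real ^ 'n) set.
    (\<forall>n. {(d, x). d \<in> space (sampleM n \<Otimes>\<^sub>M \<Theta>M n) \<and> x \<in> \<Lambda> n d}
            \<in> sets ((sampleM n \<Otimes>\<^sub>M \<Theta>M n) \<Otimes>\<^sub>M borel)) \<and>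
    (\<lambda>n. measure M {\<omega> \<in> space M. X \<omega> \<in> \<Lambda> n (sample n \<omega>, \<Theta> n \<omega>)}) \<longlonglongrightarrow> 1 \<and>
    tendsto_zero_in_prob M
      (\<lambda>n \<omega>. SUP x\<in>\<Lambda> n (sample n \<omega>, \<Theta> n \<omega>). ennreal \<bar>cdf (K x) (v n \<omega> x + correction n \<omega>) - \<alpha>\<bar>)"
proof -
  define m where "m n = expectation (coverage_error n)" for n
  \<comment> \<open>With the square root, the Markov bound \<open>m n / \<epsilon> n\<close> is at
    most \<open>sqrt (m n)\<close>, so tolerance and exceptional probability vanish together; the
    second summand keeps the tolerance positive when the mean error is 0.\<close>
  define \<epsilon> where "\<epsilon> n = sqrt (m n) + 1 / real (Suc n)" for n
  define \<Lambda> where "\<Lambda> n D = {x. \<bar>cdf (K x) (vc_of n D x) - \<alpha>\<bar> \<le> \<epsilon> n}" for n D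
  have m: "0 \<le> m n" for n unfolding m_def by (simp add: integral_nonneg coverage_error_bounds)
  have m_lim: "m \<longlonglongrightarrow> 0" unfolding m_def[abs_def] by (rule coverage_error_expectation_tendsto_0)
  have sm_lim: "(\<lambda>n. sqrt (m n)) \<longlonglongrightarrow> 0" using tendsto_real_sqrt[OF m_lim] by simp
  have \<epsilon>_pos: "0 < \<epsilon> n" "sqrt (m n) \<le> \<epsilon> n" for n
    using m[of n] by (simp_all add: \<epsilon>_def add_nonneg_pos)
  have \<epsilon>_lim: "\<epsilon> \<longlonglongrightarrow> 0"
    unfolding \<epsilon>_def[abs_def] using tendsto_add[OF sm_lim LIMSEQ_inverse_real_of_nat] by (simp add: inverse_eq_divide)
  have meas: "{(d, x). d \<in> space (sampleM n \<Otimes>\<^sub>M \<Theta>M n) \<and> x \<in> \<Lambda> n d}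
            \<in> sets ((sampleM n \<Otimes>\<^sub>M \<Theta>M n) \<Otimes>\<^sub>M borel)" for n
  proof -
    let ?W = "(sampleM n \<Otimes>\<^sub>M \<Theta>M n) \<Otimes>\<^sub>M (borel :: (real ^ 'n) measure)"
    have [measurable]: "(\<lambda>z. cdf (K (snd z)) (vc_of n (fst z) (snd z))) \<in> borel_measurable ?W"
      by (rule cdf_K_measurable[OF measurable_snd vc_of_measurable])
    have "{z \<in> space ?W. \<bar>cdf (K (snd z)) (vc_of n (fst z) (snd z)) - \<alpha>\<bar> \<le> \<epsilon> n} \<in> sets ?W" by measurable
    also have "{z \<in> space ?W. \<bar>cdf (K (snd z)) (vc_of n (fst z) (snd z)) - \<alpha>\<bar> \<le> \<epsilon> n}
        = {(d, x). d \<in> space (sampleM n \<Otimes>\<^sub>M \<Theta>M n) \<and> x \<in> \<Lambda> n d}"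
      by (auto simp: \<Lambda>_def space_pair_measure)
    finally show ?thesis .
  qed
  have "(\<lambda>n. prob {\<omega> \<in> space M. \<epsilon> n \<le> coverage_error n \<omega>}) \<longlonglongrightarrow> 0"
  proof (rule tendsto_sandwich[OF _ _ tendsto_const sm_lim])
    have "prob {\<omega> \<in> space M. \<epsilon> n \<le> coverage_error n \<omega>} \<le> sqrt (m n)" for n
    proof -
      have "prob {\<omega> \<in> space M. \<epsilon> n \<le> coverage_error n \<omega>} \<le> m n / \<epsilon> n"
        using integral_Markov_inequality_measure[OF coverage_error_integrable sets.empty_sets, where c="\<epsilon> n"] \<epsilon>_pos
        by (simp add: coverage_error_bounds m_def)
      also have "\<dots> \<le> sqrt (m n)"
      proof -
        have "m n = sqrt (m n) * sqrt (m n)" using m[of n] by simp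
        also have "\<dots> \<le> sqrt (m n) * \<epsilon> n" using \<epsilon>_pos[of n] m[of n] by (intro mult_left_mono) auto
        finally show ?thesis using \<epsilon>_pos(1)[of n] by (simp add: divide_le_eq)
      qed
      finally show ?thesis .
    qed
    then show "\<forall>\<^sub>F n in sequentially. prob {\<omega> \<in> space M. \<epsilon> n \<le> coverage_error n \<omega>} \<le> sqrt (m n)" by simp
  qed simp
  then have lim: "(\<lambda>n. 1 - prob {\<omega> \<in> space M. \<epsilon> n \<le> coverage_error n \<omega>}) \<longlonglongrightarrow> 1"
    using tendsto_diff[OF tendsto_const, of _ 0 sequentially 1] by simp
  have "(\<lambda>n. prob {\<omega> \<in> space M. X \<omega> \<in> \<Lambda> n (sample n \<omega>, \<Theta> n \<omega>)}) \<longlonglongrightarrow> 1"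
  proof (rule tendsto_sandwich[OF _ _ lim tendsto_const])
    have "1 - prob {\<omega> \<in> space M. \<epsilon> n \<le> coverage_error n \<omega>}
        \<le> prob {\<omega> \<in> space M. X \<omega> \<in> \<Lambda> n (sample n \<omega>, \<Theta> n \<omega>)}" for n
    proof -
      have eq: "{\<omega> \<in> space M. X \<omega> \<in> \<Lambda> n (sample n \<omega>, \<Theta> n \<omega>)} = {\<omega> \<in> space M. coverage_error n \<omega> \<le> \<epsilon> n}"
        by (auto simp: \<Lambda>_def vc_of_eq coverage_error_def)
      have "1 - prob {\<omega> \<in> space M. \<epsilon> n \<le> coverage_error n \<omega>}
          = prob (space M - {\<omega> \<in> space M. \<epsilon> n \<le> coverage_error n \<omega>})"
        by (rule prob_compl[symmetric]) measurable
      also have "\<dots> \<le> prob {\<omega> \<in> space M. coverage_error n \<omega> \<le> \<epsilon> n}"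
        by (intro finite_measure_mono) auto
      finally show ?thesis by (simp add: eq)
    qed
    then show "\<forall>\<^sub>F n in sequentially. 1 - prob {\<omega> \<in> space M. \<epsilon> n \<le> coverage_error n \<omega>}
        \<le> prob {\<omega> \<in> space M. X \<omega> \<in> \<Lambda> n (sample n \<omega>, \<Theta> n \<omega>)}" by simp
  qed simp
  moreover have "tendsto_zero_in_prob M
      (\<lambda>n \<omega>. SUP x\<in>\<Lambda> n (sample n \<omega>, \<Theta> n \<omega>). ennreal \<bar>cdf (K x) (v n \<omega> x + correction n \<omega>) - \<alpha>\<bar>)"
    unfolding tendsto_zero_in_prob_def
  proof (intro allI impI)
    fix \<delta> :: ennreal assume \<delta>: "0 < \<delta>"
    have "(\<lambda>n. ennreal (\<epsilon> n)) \<longlonglongrightarrow> ennreal 0" by (intro tendsto_ennrealI \<epsilon>_lim)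
    then have "\<forall>\<^sub>F n in sequentially. ennreal (\<epsilon> n) < \<delta>"
      using \<delta> by (intro order_tendstoD(2)) auto
    then have "\<forall>\<^sub>F n in sequentially. outer_measure_of M {\<omega> \<in> space M.
        \<delta> < (SUP x\<in>\<Lambda> n (sample n \<omega>, \<Theta> n \<omega>). ennreal \<bar>cdf (K x) (v n \<omega> x + correction n \<omega>) - \<alpha>\<bar>)} = 0"
    proof eventually_elim
      case (elim n)
      \<comment> \<open>The bound holds for every outcome, so for large \<open>n\<close> the event
        is empty and the outer measure raises no measurability question. An empty set of points
        gives supremum 0.\<close>
      have "(SUP x\<in>\<Lambda> n (sample n \<omega>, \<Theta> n \<omega>). ennreal \<bar>cdf (K x) (v n \<omega> x + correction n \<omega>) - \<alpha>\<bar>) \<le> ennreal (\<epsilon> n)" for \<omega>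
        by (intro SUP_least ennreal_leI) (simp add: \<Lambda>_def vc_of_eq)
      then have "{\<omega> \<in> space M. \<delta> < (SUP x\<in>\<Lambda> n (sample n \<omega>, \<Theta> n \<omega>).
          ennreal \<bar>cdf (K x) (v n \<omega> x + correction n \<omega>) - \<alpha>\<bar>)} = {}"
        using elim by (auto simp: not_less intro: order_trans less_imp_le)
      then show ?case by (simp only: outer_measure_of_eq[OF sets.empty_sets] emeasure_empty)
    qed
    then show "(\<lambda>n. outer_measure_of M {\<omega> \<in> space M.
        \<delta> < (SUP x\<in>\<Lambda> n (sample n \<omega>, \<Theta> n \<omega>). ennreal \<bar>cdf (K x) (v n \<omega> x + correction n \<omega>) - \<alpha>\<bar>)}) \<longlonglongrightarrow> 0"
      by (rule tendsto_eventually)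
  qed
  ultimately show ?thesis using meas by blast
qed

end

theorem theorem3:
  fixes M :: "'w measure"
    and X :: "'w \<Rightarrow> real ^ 'n" and Y :: "'w \<Rightarrow> real"
    and Xs :: "nat \<Rightarrow> 'w \<Rightarrow> real ^ 'n" and Ys :: "nat \<Rightarrow> 'w \<Rightarrow> real"
    and K :: "real ^ 'n \<Rightarrow> real measure"
    and \<alpha> :: real
    and I1 I2 :: "nat \<Rightarrow> nat set"
    and S :: "'c measure" and B :: "nat \<Rightarrow> nat" and \<theta> :: "nat \<Rightarrow> nat \<Rightarrow> 'w \<Rightarrow> 'c"
    and grow :: "nat \<Rightarrow> 'c \<Rightarrow> (nat \<Rightarrow> (real ^ 'n) \<times> real) \<Rightarrow> 'n rtree"
    and T :: "nat \<Rightarrow> nat \<Rightarrow> 'w \<Rightarrow> 'n rtree"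
    and v vc :: "nat \<Rightarrow> 'w \<Rightarrow> real ^ 'n \<Rightarrow> real" and E :: "nat \<Rightarrow> nat \<Rightarrow> 'w \<Rightarrow> real"
    and \<X> :: "(real ^ 'n) set"
    and train :: "nat \<Rightarrow> 'w \<Rightarrow> nat \<Rightarrow> (real ^ 'n) \<times> real"
    and sample :: "nat \<Rightarrow> 'w \<Rightarrow> nat \<Rightarrow> (real ^ 'n) \<times> real"
    and \<Theta> :: "nat \<Rightarrow> 'w \<Rightarrow> nat \<Rightarrow> 'c"
    and trainM sampleM :: "nat \<Rightarrow> (nat \<Rightarrow> (real ^ 'n) \<times> real) measure"
    and \<Theta>M :: "nat \<Rightarrow> (nat \<Rightarrow> 'c) measure"
  assumes prob: "prob_space M"
    and alpha: "0 < \<alpha>" "\<alpha> < 1"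
    and split: "\<And>n. I1 n \<union> I2 n = {1..n}" "\<And>n. I1 n \<inter> I2 n = {}"
    and calibration_size: "filterlim (\<lambda>n. card (I2 n)) at_top sequentially"
    and train_eq: "\<And>n \<omega>. train n \<omega> = (\<lambda>i\<in>I1 n. (Xs i \<omega>, Ys i \<omega>))"
      "\<And>n. trainM n = Pi\<^sub>M (I1 n) (\<lambda>_. borel)"
    and sample_eq: "\<And>n \<omega>. sample n \<omega> = (\<lambda>i\<in>{1..n}. (Xs i \<omega>, Ys i \<omega>))"
      "\<And>n. sampleM n = Pi\<^sub>M {1..n} (\<lambda>_. borel)"
    and Theta_eq: "\<And>n \<omega>. \<Theta> n \<omega> = (\<lambda>b\<in>{..<B n}. \<theta> n b \<omega>)"
      "\<And>n. \<Theta>M n = Pi\<^sub>M {..<B n} (\<lambda>_. S)"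
    and iid: "prob_space.indep_vars M (\<lambda>_. borel) (\<lambda>i \<omega>. (Xs i \<omega>, Ys i \<omega>)) {1..}"
      "\<And>i. i \<ge> 1 \<Longrightarrow>
         distr M borel (\<lambda>\<omega>. (Xs i \<omega>, Ys i \<omega>)) = distr M borel (\<lambda>\<omega>. (X \<omega>, Y \<omega>))"
    and fresh: "\<And>n. indep_rv M borel (\<lambda>\<omega>. (X \<omega>, Y \<omega>))
                  (sampleM n \<Otimes>\<^sub>M \<Theta>M n) (\<lambda>\<omega>. (sample n \<omega>, \<Theta> n \<omega>))"
    and cond_dist: "is_regular_cond_dist M X Y K"
    and support: "\<X> = measure_support (distr M borel X)"
    and B_pos: "\<And>n. B n \<ge> 1"
    and grow: "\<And>n. (\<lambda>(t, d). grow n t d) \<in> S \<Otimes>\<^sub>M trainM n \<rightarrow>\<^sub>M tree_space"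
    and T_eq: "\<And>n b \<omega>. T n b \<omega> = grow n (\<theta> n b \<omega>) (train n \<omega>)"
    and v_eq: "\<And>n \<omega> x. v n \<omega> x =
        qrf \<alpha> (I1 n) (\<lambda>i. Xs i \<omega>) (\<lambda>i. Ys i \<omega>) (B n) (\<lambda>b. T n b \<omega>) x"
    and E_eq: "\<And>n i \<omega>. E n i \<omega> = Ys i \<omega> - v n \<omega> (Xs i \<omega>)"
    and vc_eq: "\<And>n \<omega> x. vc n \<omega> x = v n \<omega> x + empirical_quantile \<alpha> (I2 n) (\<lambda>i. E n i \<omega>)"
    and support_bounded: "bounded \<X>"
    and X_density: "\<exists>f c1 c2. distributed M lborel X (\<lambda>x. ennreal (f x)) \<and> 0 < c1 \<and>
                      (\<forall>x\<in>\<X>. c1 \<le> f x \<and> f x \<le> c2)"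
    and leaf_max: "AE \<omega> in M.
        (\<lambda>n. real (Max {node_count (I1 n) (\<lambda>i. Xs i \<omega>) (T n b \<omega>) l |b l.
                          b < B n \<and> l \<in> leaves (T n b \<omega>)})) \<in> o(\<lambda>n. real (card (I1 n)))"
    \<comment> \<open>\<open>1 / min = o(1)\<close> is stated as divergence of the minimum, since \<open>1 / 0 = 0\<close> here\<close>
    and leaf_min: "AE \<omega> in M.
        filterlim (\<lambda>n. Min {node_count (I1 n) (\<lambda>i. Xs i \<omega>) (T n b \<omega>) l |b l.
                              b < B n \<and> l \<in> leaves (T n b \<omega>)}) at_top sequentially"
    and split_variable: "\<exists>C0>0. \<forall>n. \<forall>b<B n. \<forall>p m. AE \<omega> in M. split_at (T n b \<omega>) p \<noteq> None \<longrightarrow>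
        real_cond_exp M (split_history M (trainM n) (train n) (T n b) p)
          (indicat_real {\<omega> \<in> space M. \<exists>s. split_at (T n b \<omega>) p = Some (m, s)}) \<omega> \<ge> C0"
    and split_balance: "\<exists>\<gamma>>0. \<gamma> \<le> 1 / 2 \<and> (\<forall>n. \<forall>b<B n. AE \<omega> in M. \<forall>p c.
        split_at (T n b \<omega>) p \<noteq> None \<longrightarrow>
          real (node_count (I1 n) (\<lambda>i. Xs i \<omega>) (T n b \<omega>) (p @ [c]))
            / real (node_count (I1 n) (\<lambda>i. Xs i \<omega>) (T n b \<omega>) p) \<ge> \<gamma>)"
    and lipschitz: "\<exists>C>0. \<forall>x\<in>\<X>. \<forall>x'\<in>\<X>.
        (SUP y. \<bar>cdf (K x) y - cdf (K x') y\<bar>) \<le> C * (\<Sum>j\<in>UNIV. \<bar>x $ j - x' $ j\<bar>)"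
    and cdf_strict: "\<forall>x\<in>\<X>. strict_mono (cdf (K x))"
    and moments: "\<exists>\<delta>>0. \<exists>C::real. \<forall>x\<in>\<X>. (\<integral>\<^sup>+y. ennreal (\<bar>y\<bar> powr (2 + \<delta>)) \<partial>K x) \<le> ennreal C"
    and honest_randomness: "\<And>n. indep_rv M (\<Theta>M n) (\<Theta> n) (sampleM n) (sample n)"
    and honest_splits: "\<And>n t d d'. t \<in> space S \<Longrightarrow> d \<in> space (trainM n) \<Longrightarrow> d' \<in> space (trainM n)
        \<Longrightarrow> (\<And>i. i \<in> I1 n \<Longrightarrow> fst (d i) = fst (d' i)) \<Longrightarrow> grow n t d = grow n t d'"
    and score_density: "\<exists>U c. open U \<and> 0 \<in> U \<and> 0 < c \<and> (\<forall>\<^sub>F n in sequentially. \<forall>i\<in>I2 n.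
        \<exists>g. distributed M lborel (E n i) g \<and> (\<forall>e\<in>U. ennreal c \<le> g e))"
    and Y_density: "\<forall>x\<in>\<X>. \<exists>h. continuous_on UNIV h \<and> (\<forall>y. 0 \<le> h y) \<and>
        K x = density lborel (\<lambda>y. ennreal (h y))"
  \<comment> \<open>The random set is a measurable function of the offline sample and the forest randomness.\<close>
  shows "\<exists>\<Lambda> :: nat \<Rightarrow> (nat \<Rightarrow> (real ^ 'n) \<times> real) \<times> (nat \<Rightarrow> 'c) \<Rightarrow> (real ^ 'n) set.
    (\<forall>n. {(d, x). d \<in> space (sampleM n \<Otimes>\<^sub>M \<Theta>M n) \<and> x \<in> \<Lambda> n d}
            \<in> sets ((sampleM n \<Otimes>\<^sub>M \<Theta>M n) \<Otimes>\<^sub>M borel)) \<and>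
    (\<lambda>n. measure M {\<omega> \<in> space M. X \<omega> \<in> \<Lambda> n (sample n \<omega>, \<Theta> n \<omega>)}) \<longlonglongrightarrow> 1 \<and>
    tendsto_zero_in_prob M
      (\<lambda>n \<omega>. SUP x\<in>\<Lambda> n (sample n \<omega>, \<Theta> n \<omega>). ennreal \<bar>cdf (K x) (vc n \<omega> x) - \<alpha>\<bar>)"
proof -
  interpret prob_space M by fact
  interpret forest_setting M X Y Xs Ys K \<alpha> I1 I2 S B \<theta> grow T train sample \<Theta> trainM sampleM \<Theta>M \<X>
    by unfold_locales (fact assms)+
  have "vc n \<omega> x = forest_setting.v Xs Ys \<alpha> I1 B T n \<omega> x + correction n \<omega>" for n \<omega> x
    by (simp add: vc_eq v_eq E_eq v_def correction_def)
  then show ?thesis using conformal_coverage by simp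
qed

end
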